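(* Let $([\mathbf G,\mathbf o],S)$ be a proper extension of a unimodular network. If $[\mathbf G]$ can be unimodularized, then: (i) There exists an admissible kernel $T:\mathcal G_{**}\to\mathbb R^{\ge0}$ such that $\mathcal P'_T$ exists (i.e. $\mathbb E[T_{\mathbf G}^-(\mathbf o)\mid I]<\infty$ a.s.). (ii) Any unimodularization of $[\mathbf G]$ can be obtained by biasing $\mathcal P'_T$, with $T$ as in part (i), by a function that does not depend on the root. (iii) $T$ can be chosen such that almost surely $T_{\mathbf G}^-(\cdot)$ is constant on $S_{\mathbf G}$ (the constant depending only on $[\mathbf G]$).
   Context: Networks. Fix a complete separable metric space $\Xi$ (the mark space). A network is a connected, locally finite (every vertex has finite degree) multigraph $G$ with vertex set $V(G)$, together with a mark in $\Xi$ for each vertex $v$ and for each pair $(v,e)$ with $e$ an edge incident to $v$. A rooted network $(G,o)$ is a network with a distinguished vertex $o$; a doubly-rooted network $(G,o,v)$ has an ordered pair of distinguished vertices. Isomorphisms preserve marks and distinguished vertices. $\mathcal G$, $\mathcal G_*$ and $\mathcal G_{**}$ are the sets of isomorphism classes $[G]$, $[G,o]$ and $[G,o,v]$ of networks, rooted networks and doubly-rooted networks. $\mathcal G_*$ and $\mathcal G_{**}$ carry the Borel sigma-fields of the (Polish) local topologies: $[G_n,o_n]\to[G,o]$ iff for all $r\in\mathbb N$ and $\varepsilon>0$, for all large $n$ there is a graph isomorphism between the balls of radius $r$ about the roots that maps root to root and for which corresponding marks are at distance less than $\varepsilon$; for $\mathcal G_{**}$ one uses balls about the first root, with $r$ at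 least the distance of the two roots in the limit, and isomorphisms must also map second root to second root. For a function $f$ we write $f[G,o]$ for $f([G,o])$, etc. $\pi:\mathcal G_*\to\mathcal G$ is $\pi[G,o]=[G]$, and $J=\{B\subseteq\mathcal G:\pi^{-1}(B)\text{ is measurable}\}$. A random rooted network $[\mathbf G,\mathbf o]$ is a random element of $\mathcal G_*$ (probability measures on $\mathcal G_*$ are identified with random rooted networks); $[\mathbf G]$ is its image under $\pi$, a random element of $(\mathcal G,J)$. For measurable $T:\mathcal G_{**}\to\mathbb R^{\ge0}$: $T_G(u,v)=T[G,u,v]$, $T_G^+(o)=\sum_{v\in V(G)}T_G(o,v)$, $T_G^-(o)=\sum_{v\in V(G)}T_G(v,o)$. Unimodular: $[\mathbf G,\mathbf o]$ is unimodular (a "unimodular network") if $\mathbb E[g_{\mathbf G}^+(\mathbf o)]=\mathbb E[g_{\mathbf G}^-(\mathbf o)]$ for all measurable $g:\mathcal G_{**}\to\mathbb R^{\ge0}$ (both sides may be infinite). Invariant sigma-field $I$: the family of measurable $A\subseteq\mathcal G_*$ such that $[G,o]\in A$ and $v\in V(G)$ imply $[G,v]\in A$. $\mathbb E[\,\cdot\mid I]$ is conditional expectation given the events $\{[\mathbf G,\mathbf o]\in A\}$, $A\in I$. A measurable function $w$ on $\mathcal G_*$ does not depend on the root if $w[G,o]=w[G,v]$ for every rooted network $(G,o)$ and $v\in V(G)$ (equivalently, it is $I$-measurable). Biasing a probability measure $\mu$ on $\mathcal G_*$ by a measurable $w:\mathcal G_*\to\mathbb R^{\ge0}$ with $0<\int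 w\,d\mu<\infty$ gives the probability measure $A\mapsto\frac1{\int w\,d\mu}\int w1_A\,d\mu$. Covariant subset: a map $S$ associating to each network $G$ a set $S_G\subseteq V(G)$ such that $[G,o]\mapsto 1_{\{o\in S_G\}}$ is well defined and measurable on $\mathcal G_*$. The same symbol $S_G$ denotes the subnetwork of $G$ induced by $S_G$; $S$ is then called a covariant subnetwork. Extension: an extension of a unimodular network $[\mathbf G_0,\mathbf o_0]$ is a pair $([\mathbf G,\mathbf o],S)$ where $[\mathbf G,\mathbf o]$ is a (not necessarily unimodular) random rooted network (possibly with a larger mark space) and $S$ is a covariant subnetwork such that $\mathbf o\in S_{\mathbf G}$ a.s., $S_{\mathbf G}$ is connected a.s., and $[S_{\mathbf G},\mathbf o]$ has the same distribution as $[\mathbf G_0,\mathbf o_0]$. It is proper if $\mathbb E\big[\sum_{v\in S_{\mathbf G}}g[\mathbf G,\mathbf o,v]\big]=\mathbb E\big[\sum_{v\in S_{\mathbf G}}g[\mathbf G,v,\mathbf o]\big]$ for all measurable $g:\mathcal G_{**}\to\mathbb R^{\ge0}$. Unimodularization: a unimodular network $[\mathbf G',\mathbf o']$ is a strong unimodularization of $[\mathbf G]$ if $[\mathbf G']$ and $[\mathbf G]$ have the same distribution on $(\mathcal G,J)$, and a weak unimodularization of $[\mathbf G]$ if these distributions are mutually absolutely continuous. "Unimodularization" means weak or strong; $[\mathbf G]$ can be unimodularized if one exists. Admissible kernel: a measurable $T:\mathcal G_{**}\to\mathbb R^{\ge0}$ such that almost surely, for all $v\in V(\mathbf G)$, $T_{\mathbf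 G}^+(v)=1$ and $T_{\mathbf G}(v,z)=0$ for all $z\in V(\mathbf G)\setminus S_{\mathbf G}$. For such $T$ put $M=T_{\mathbf G}^-(\mathbf o)$; when $\mathbb E[M\mid I]<\infty$ a.s., $\mathcal P'_T$ is the probability measure on $\mathcal G_*$ given by $\mathcal P'_T[A]=\mathbb E\big[\frac1{\mathbb E[M\mid I]}\sum_{v\in V(\mathbf G)}T_{\mathbf G}(v,\mathbf o)1_A[\mathbf G,v]\big]$. *)

theory Defs
  imports "HOL-Probability.Probability"
begin

section \<open>Networks\<close>

text \<open>
  A connected locally finite multigraph is countable, so vertices and edges are taken to be natural
  numbers.  An edge has one endpoint (a loop) or two; parallel edges are allowed.  The values of
  the fields outside the vertex and edge sets are irrelevant, and so is \<^term>\<open>emark G v e\<close>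
  when \<^term>\<open>e\<close> is not incident to \<^term>\<open>v\<close>.
\<close>

record 'x network =
  verts :: "nat set"
  edges :: "nat set"
  ends :: "nat \<Rightarrow> nat set"
  vmark :: "nat \<Rightarrow> 'x"
  emark :: "nat \<Rightarrow> nat \<Rightarrow> 'x"

definition adj :: "'x network \<Rightarrow> nat rel" where
  "adj G = {(u, v). \<exists>e\<in>edges G. ends G e = {u, v}}"

definition connected_net :: "'x network \<Rightarrow> bool" where
  "connected_net G \<longleftrightarrow> verts G \<noteq> {} \<and> (\<forall>u\<in>verts G. \<forall>v\<in>verts G. (u, v) \<in> (adj G)\<^sup>*)"

definition is_network :: "'x network \<Rightarrow> bool" where
  "is_network G \<longleftrightarrow>
     (\<forall>e\<in>edges G. ends G e \<subseteq> verts G \<and> card (ends G e) \<in> {1, 2}) \<and>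
     (\<forall>v\<in>verts G. finite {e \<in> edges G. v \<in> ends G e}) \<and>
     connected_net G"

definition subnet :: "'x network \<Rightarrow> nat set \<Rightarrow> 'x network" where
  "subnet G W = G\<lparr>verts := verts G \<inter> W, edges := {e \<in> edges G. ends G e \<subseteq> W}\<rparr>"

definition ball_net :: "'x network \<Rightarrow> nat \<Rightarrow> nat \<Rightarrow> 'x network" where
  "ball_net G u r = subnet G {v. \<exists>n\<le>r. (u, v) \<in> adj G ^^ n}"

definition graph_iso :: "'x network \<Rightarrow> 'y network \<Rightarrow> (nat \<Rightarrow> nat) \<Rightarrow> (nat \<Rightarrow> nat) \<Rightarrow> bool" where
  "graph_iso G H f g \<longleftrightarrow>
     bij_betw f (verts G) (verts H) \<and> bij_betw g (edges G) (edges H) \<and>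
     (\<forall>e\<in>edges G. ends H (g e) = f ` ends G e)"

definition network_iso :: "'x network \<Rightarrow> 'x network \<Rightarrow> (nat \<Rightarrow> nat) \<Rightarrow> (nat \<Rightarrow> nat) \<Rightarrow> bool" where
  "network_iso G H f g \<longleftrightarrow> graph_iso G H f g \<and>
     (\<forall>v\<in>verts G. vmark H (f v) = vmark G v) \<and>
     (\<forall>e\<in>edges G. \<forall>v\<in>ends G e. emark H (f v) (g e) = emark G v e)"

lemma network_iso_refl: "network_iso G G id id"
  by (simp add: network_iso_def graph_iso_def)

lemma network_iso_sym:
  assumes "network_iso G H f g" "is_network G"
  shows "network_iso H G (inv_into (verts G) f) (inv_into (edges G) g)"
proof -
  let ?f = "inv_into (verts G) f" and ?g = "inv_into (edges G) g"
  have f: "bij_betw f (verts G) (verts H)" and g: "bij_betw g (edges G) (edges H)"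
    using assms by (auto simp: network_iso_def graph_iso_def)
  have ff: "?f (f v) = v" if "v \<in> verts G" for v
    using f that by (simp add: bij_betw_def)
  have gg: "?g (g e) = e" if "e \<in> edges G" for e
    using g that by (simp add: bij_betw_def)
  have V: "\<exists>v\<in>verts G. w = f v" if "w \<in> verts H" for w
    using f that by (auto simp: bij_betw_def)
  have E: "\<exists>e\<in>edges G. d = g e" if "d \<in> edges H" for d
    using g that by (auto simp: bij_betw_def)
  have sub: "ends G e \<subseteq> verts G" if "e \<in> edges G" for e
    using assms(2) that by (auto simp: is_network_def)
  have img: "?f ` f ` ends G e = ends G e" if "e \<in> edges G" for e
    using sub[OF that] ff by (force simp: image_image)
  show ?thesis
    unfolding network_iso_def graph_iso_def
  proof (intro conjI ballI)
    show "bij_betw ?f (verts H) (verts G)" using f by (rule bij_betw_inv_into)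
    show "bij_betw ?g (edges H) (edges G)" using g by (rule bij_betw_inv_into)
  next
    fix d assume "d \<in> edges H"
    then obtain e where e: "e \<in> edges G" "d = g e" using E by blast
    then show "ends G (?g d) = ?f ` ends H d"
      using assms(1) img gg by (simp add: network_iso_def graph_iso_def)
  next
    fix w assume "w \<in> verts H"
    then obtain v where "v \<in> verts G" "w = f v" using V by blast
    then show "vmark G (?f w) = vmark H w"
      using assms(1) ff by (simp add: network_iso_def)
  next
    fix d w assume d: "d \<in> edges H" and w: "w \<in> ends H d"
    obtain e where e: "e \<in> edges G" "d = g e" using E d by blast
    then obtain v where v: "v \<in> ends G e" "w = f v"
      using assms(1) w by (auto simp: network_iso_def graph_iso_def)
    then show "emark G (?f w) (?g d) = emark H w d"
      using assms(1) e sub[OF e(1)] ff gg by (auto simp: network_iso_def)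
  qed
qed

lemma network_iso_trans:
  assumes "network_iso G H f g" "network_iso H K f' g'"
  shows "network_iso G K (f' \<circ> f) (g' \<circ> g)"
proof -
  have g: "g e \<in> edges H" if "e \<in> edges G" for e
    using assms(1) that by (auto simp: network_iso_def graph_iso_def bij_betw_def)
  have f: "f v \<in> verts H" if "v \<in> verts G" for v
    using assms(1) that by (auto simp: network_iso_def graph_iso_def bij_betw_def)
  show ?thesis
    using assms f g bij_betw_trans[of f "verts G" "verts H" f' "verts K"]
      bij_betw_trans[of g "edges G" "edges H" g' "edges K"]
    by (auto simp: network_iso_def graph_iso_def image_comp)
qed

lemma is_network_example:
  "is_network \<lparr>verts = {0}, edges = {}, ends = (\<lambda>_. {}), vmark = m, emark = k\<rparr>"
  by (simp add: is_network_def connected_net_def)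


section \<open>Isomorphism classes\<close>

definition unrooted_eq :: "'x network \<Rightarrow> 'x network \<Rightarrow> bool" where
  "unrooted_eq G H \<longleftrightarrow> is_network G \<and> is_network H \<and> (\<exists>f g. network_iso G H f g)"

definition rooted_eq :: "'x network \<times> nat \<Rightarrow> 'x network \<times> nat \<Rightarrow> bool" where
  "rooted_eq = (\<lambda>(G, u) (H, v). is_network G \<and> is_network H \<and> u \<in> verts G \<and> v \<in> verts H \<and>
     (\<exists>f g. network_iso G H f g \<and> f u = v))"

definition birooted_eq :: "'x network \<times> nat \<times> nat \<Rightarrow> 'x network \<times> nat \<times> nat \<Rightarrow> bool" where
  "birooted_eq = (\<lambda>(G, u, u') (H, v, v'). is_network G \<and> is_network H \<and>
     u \<in> verts G \<and> u' \<in> verts G \<and> v \<in> verts H \<and> v' \<in> verts H \<and>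
     (\<exists>f g. network_iso G H f g \<and> f u = v \<and> f u' = v'))"

lemma inv_into_iso_root:
  "network_iso G H f g \<Longrightarrow> u \<in> verts G \<Longrightarrow> inv_into (verts G) f (f u) = u"
  by (simp add: network_iso_def graph_iso_def bij_betw_def)

quotient_type 'x unrooted = "'x network" / partial: unrooted_eq
proof (rule part_equivpI)
  show "\<exists>G::'x network. unrooted_eq G G"
    using is_network_example network_iso_refl unfolding unrooted_eq_def by blast
  show "symp (unrooted_eq :: 'x network \<Rightarrow> _)"
    unfolding unrooted_eq_def by (intro sympI) (blast dest: network_iso_sym)
  show "transp (unrooted_eq :: 'x network \<Rightarrow> _)"
    unfolding unrooted_eq_def by (intro transpI) (blast dest: network_iso_trans)
qed

quotient_type 'x rooted = "'x network \<times> nat" / partial: rooted_eq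
proof (rule part_equivpI)
  define G :: "'x network" where
    "G = \<lparr>verts = {0}, edges = {}, ends = (\<lambda>_. {}), vmark = undefined, emark = undefined\<rparr>"
  have "is_network G" "0 \<in> verts G" unfolding G_def by (rule is_network_example) simp
  then have "rooted_eq (G, 0) (G, 0)"
    using network_iso_refl[of G] unfolding rooted_eq_def prod.case
    by (intro conjI exI[of _ id]) simp_all
  then show "\<exists>p::'x network \<times> nat. rooted_eq p p" by blast
next
  show "symp (rooted_eq :: 'x network \<times> nat \<Rightarrow> _)"
  proof (rule sympI)
    fix p q :: "'x network \<times> nat" assume pq: "rooted_eq p q"
    obtain G u H v where e: "p = (G, u)" "q = (H, v)" by (cases p, cases q)
    obtain f g where f: "network_iso G H f g" "f u = v" "is_network G" "is_network H"
        "u \<in> verts G" "v \<in> verts H"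
      using pq unfolding e rooted_eq_def prod.case by blast
    have "inv_into (verts G) f v = u"
      using inv_into_iso_root[OF f(1,5)] f(2) by simp
    then show "rooted_eq q p"
      using network_iso_sym[OF f(1,3)] f(3-6) unfolding e rooted_eq_def prod.case by blast
  qed
next
  show "transp (rooted_eq :: 'x network \<times> nat \<Rightarrow> _)"
  proof (rule transpI)
    fix p q s :: "'x network \<times> nat" assume pq: "rooted_eq p q" and qs: "rooted_eq q s"
    obtain G u H v K w where e: "p = (G, u)" "q = (H, v)" "s = (K, w)"
      by (cases p, cases q, cases s)
    obtain f g where f: "network_iso G H f g" "f u = v"
      using pq unfolding e rooted_eq_def prod.case by blast
    obtain f' g' where f': "network_iso H K f' g'" "f' v = w"
      using qs unfolding e rooted_eq_def prod.case by blast
    have "(f' \<circ> f) u = w" using f(2) f'(2) by simp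
    then show "rooted_eq p s"
      using network_iso_trans[OF f(1) f'(1)] pq qs unfolding e rooted_eq_def prod.case by blast
  qed
qed

quotient_type 'x birooted = "'x network \<times> nat \<times> nat" / partial: birooted_eq
proof (rule part_equivpI)
  define G :: "'x network" where
    "G = \<lparr>verts = {0}, edges = {}, ends = (\<lambda>_. {}), vmark = undefined, emark = undefined\<rparr>"
  have "is_network G" "0 \<in> verts G" unfolding G_def by (rule is_network_example) simp
  then have "birooted_eq (G, 0, 0) (G, 0, 0)"
    using network_iso_refl[of G] unfolding birooted_eq_def prod.case
    by (intro conjI exI[of _ id]) simp_all
  then show "\<exists>p::'x network \<times> nat \<times> nat. birooted_eq p p" by blast
next
  show "symp (birooted_eq :: 'x network \<times> nat \<times> nat \<Rightarrow> _)"
  proof (rule sympI)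
    fix p q :: "'x network \<times> nat \<times> nat" assume pq: "birooted_eq p q"
    obtain G u u' H v v' where e: "p = (G, u, u')" "q = (H, v, v')" by (cases p, cases q)
    obtain f g where f: "network_iso G H f g" "f u = v" "f u' = v'" "is_network G" "is_network H"
        "u \<in> verts G" "u' \<in> verts G" "v \<in> verts H" "v' \<in> verts H"
      using pq unfolding e birooted_eq_def prod.case by blast
    have "inv_into (verts G) f v = u" "inv_into (verts G) f v' = u'"
      using inv_into_iso_root[OF f(1,6)] inv_into_iso_root[OF f(1,7)] f(2,3) by simp_all
    then show "birooted_eq q p"
      using network_iso_sym[OF f(1,4)] f(4-9) unfolding e birooted_eq_def prod.case by blast
  qed
next
  show "transp (birooted_eq :: 'x network \<times> nat \<times> nat \<Rightarrow> _)"
  proof (rule transpI)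
    fix p q s :: "'x network \<times> nat \<times> nat" assume pq: "birooted_eq p q" and qs: "birooted_eq q s"
    obtain G u u' H v v' K w w' where e: "p = (G, u, u')" "q = (H, v, v')" "s = (K, w, w')"
      by (cases p, cases q, cases s)
    obtain f g where f: "network_iso G H f g" "f u = v" "f u' = v'"
      using pq unfolding e birooted_eq_def prod.case by blast
    obtain f' g' where f': "network_iso H K f' g'" "f' v = w" "f' v' = w'"
      using qs unfolding e birooted_eq_def prod.case by blast
    have "(f' \<circ> f) u = w" "(f' \<circ> f) u' = w'" using f(2,3) f'(2,3) by simp_all
    then show "birooted_eq p s"
      using network_iso_trans[OF f(1) f'(1)] pq qs unfolding e birooted_eq_def prod.case by blast
  qed
qed

definition ucls :: "'x network \<Rightarrow> 'x unrooted" where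
  "ucls G = abs_unrooted G"

definition rcls :: "'x network \<Rightarrow> nat \<Rightarrow> 'x rooted" where
  "rcls G u = abs_rooted (G, u)"

definition bcls :: "'x network \<Rightarrow> nat \<Rightarrow> nat \<Rightarrow> 'x birooted" where
  "bcls G u v = abs_birooted (G, u, v)"

text \<open>
  Evaluation of an expression in a rooted network at a class, through a chosen representative.
  It is only applied to expressions that are invariant under isomorphism, for which the choice
  does not matter (\<open>at_root_rcls\<close> below).
\<close>

definition at_root :: "('x network \<Rightarrow> nat \<Rightarrow> 'b) \<Rightarrow> 'x rooted \<Rightarrow> 'b" where
  "at_root F c = (case rep_rooted c of (G, u) \<Rightarrow> F G u)"

lemma rcls_eq_iff:
  assumes "is_network G" "u \<in> verts G" "is_network H" "v \<in> verts H"
  shows "rcls G u = rcls H v \<longleftrightarrow> (\<exists>f g. network_iso G H f g \<and> f u = v)"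
proof -
  have refl: "rooted_eq (K, w) (K, w)" if "is_network K" "w \<in> verts K" for K :: "'a network" and w
    unfolding rooted_eq_def prod.case using that network_iso_refl[of K]
    by (intro conjI exI[of _ id]) simp_all
  have "rcls G u = rcls H v \<longleftrightarrow> rooted_eq (G, u) (H, v)"
    unfolding rcls_def
    using Quotient3_rel[OF Quotient3_rooted, of "(G, u)" "(H, v)"]
      refl[OF assms(1,2)] refl[OF assms(3,4)] by simp
  then show ?thesis using assms by (auto simp: rooted_eq_def)
qed

lemma bcls_eqI:
  assumes "is_network G" "is_network H" "u \<in> verts G" "u' \<in> verts G"
    "network_iso G H f g"
  shows "bcls G u u' = bcls H (f u) (f u')"
proof -
  have "f u \<in> verts H" "f u' \<in> verts H"
    using assms by (auto simp: network_iso_def graph_iso_def bij_betw_def)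
  then have "birooted_eq (G, u, u') (H, f u, f u')"
    unfolding birooted_eq_def prod.case using assms by blast
  then show ?thesis
    unfolding bcls_def
    using Quotient3_rel[OF Quotient3_birooted, of "(G, u, u')" "(H, f u, f u')"] by simp
qed

lemma rooted_representative:
  obtains G u where "rep_rooted c = (G, u)" "is_network G" "u \<in> verts G" "c = rcls G u"
proof -
  obtain G u where p: "rep_rooted c = (G, u)" by (cases "rep_rooted c")
  have "rooted_eq (G, u) (G, u)"
    using Quotient3_rep_reflp[OF Quotient3_rooted, of c] p by simp
  moreover have "c = rcls G u"
    using Quotient3_abs_rep[OF Quotient3_rooted, of c] p by (simp add: rcls_def)
  ultimately show thesis using p that by (auto simp: rooted_eq_def)
qed

lemma at_root_rcls:
  assumes "is_network G" "u \<in> verts G"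
    and inv: "\<And>H f g. is_network H \<Longrightarrow> network_iso G H f g \<Longrightarrow> F H (f u) = F G u"
  shows "at_root F (rcls G u) = F G u"
proof -
  obtain H v where H: "rep_rooted (rcls G u) = (H, v)" "is_network H" "v \<in> verts H"
      "rcls G u = rcls H v"
    by (rule rooted_representative)
  then obtain f g where "network_iso G H f g" "f u = v"
    using rcls_eq_iff[of G u H v] assms by auto
  then show ?thesis using inv H by (auto simp: at_root_def)
qed


section \<open>Local topologies\<close>

definition marks_within ::
  "real \<Rightarrow> 'x::metric_space network \<Rightarrow> 'x network \<Rightarrow> (nat \<Rightarrow> nat) \<Rightarrow> (nat \<Rightarrow> nat) \<Rightarrow> bool" where
  "marks_within \<epsilon> G H f g \<longleftrightarrow>
     (\<forall>v\<in>verts G. dist (vmark H (f v)) (vmark G v) < \<epsilon>) \<and>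
     (\<forall>e\<in>edges G. \<forall>v\<in>ends G e. dist (emark H (f v) (g e)) (emark G v e) < \<epsilon>)"

definition rooted_conv :: "(nat \<Rightarrow> 'x::metric_space rooted) \<Rightarrow> 'x rooted \<Rightarrow> bool" where
  "rooted_conv X c \<longleftrightarrow> (case rep_rooted c of (G, u) \<Rightarrow>
     \<forall>r. \<forall>\<epsilon>>0. \<forall>\<^sub>F n in sequentially. case rep_rooted (X n) of (H, v) \<Rightarrow>
       \<exists>f g. graph_iso (ball_net G u r) (ball_net H v r) f g \<and>
         marks_within \<epsilon> (ball_net G u r) (ball_net H v r) f g \<and> f u = v)"

definition birooted_conv :: "(nat \<Rightarrow> 'x::metric_space birooted) \<Rightarrow> 'x birooted \<Rightarrow> bool" where
  "birooted_conv X c \<longleftrightarrow> (case rep_birooted c of (G, u, u') \<Rightarrow>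
     \<forall>r. u' \<in> verts (ball_net G u r) \<longrightarrow>
       (\<forall>\<epsilon>>0. \<forall>\<^sub>F n in sequentially. case rep_birooted (X n) of (H, v, v') \<Rightarrow>
         \<exists>f g. graph_iso (ball_net G u r) (ball_net H v r) f g \<and>
           marks_within \<epsilon> (ball_net G u r) (ball_net H v r) f g \<and> f u = v \<and> f u' = v'))"

text \<open>
  The local topologies are metrizable, hence determined by their convergent sequences: a set is
  open iff it is sequentially open.  The Borel sigma-fields are then the library's
  \<^const>\<open>borel\<close>.
\<close>

instantiation rooted :: (metric_space) topological_space
begin

definition open_rooted :: "'a rooted set \<Rightarrow> bool" where
  "open_rooted U \<longleftrightarrow> (\<forall>X. \<forall>c\<in>U. rooted_conv X c \<longrightarrow> (\<forall>\<^sub>F n in sequentially. X n \<in> U))"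

instance
proof
  show "open (UNIV :: 'a rooted set)" by (simp add: open_rooted_def)
next
  fix A B :: "'a rooted set" assume "open A" "open B"
  then show "open (A \<inter> B)" unfolding open_rooted_def by (auto intro!: eventually_conj)
next
  fix K :: "'a rooted set set" assume K: "\<forall>A\<in>K. open A"
  show "open (\<Union>K)"
    unfolding open_rooted_def
  proof (intro allI ballI impI)
    fix X and c :: "'a rooted" assume "c \<in> \<Union>K" "rooted_conv X c"
    then obtain A where "A \<in> K" "\<forall>\<^sub>F n in sequentially. X n \<in> A"
      using K by (auto simp: open_rooted_def)
    then show "\<forall>\<^sub>F n in sequentially. X n \<in> \<Union>K"
      by (auto elim: eventually_mono)
  qed
qed

end

instantiation birooted :: (metric_space) topological_space
begin

definition open_birooted :: "'a birooted set \<Rightarrow> bool" where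
  "open_birooted U \<longleftrightarrow> (\<forall>X. \<forall>c\<in>U. birooted_conv X c \<longrightarrow> (\<forall>\<^sub>F n in sequentially. X n \<in> U))"

instance
proof
  show "open (UNIV :: 'a birooted set)" by (simp add: open_birooted_def)
next
  fix A B :: "'a birooted set" assume "open A" "open B"
  then show "open (A \<inter> B)" unfolding open_birooted_def by (auto intro!: eventually_conj)
next
  fix K :: "'a birooted set set" assume K: "\<forall>A\<in>K. open A"
  show "open (\<Union>K)"
    unfolding open_birooted_def
  proof (intro allI ballI impI)
    fix X and c :: "'a birooted" assume "c \<in> \<Union>K" "birooted_conv X c"
    then obtain A where "A \<in> K" "\<forall>\<^sub>F n in sequentially. X n \<in> A"
      using K by (auto simp: open_birooted_def)
    then show "\<forall>\<^sub>F n in sequentially. X n \<in> \<Union>K"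
      by (auto elim: eventually_mono)
  qed
qed

end

definition forget_root :: "'x rooted \<Rightarrow> 'x unrooted" where
  "forget_root = at_root (\<lambda>G u. ucls G)"

definition unrooted_space :: "'x::metric_space unrooted measure" where
  "unrooted_space = sigma UNIV {B. forget_root -` B \<in> sets borel}"

definition invariant_field :: "'x::metric_space rooted measure" where
  "invariant_field = sigma UNIV {A \<in> sets borel. \<forall>G u v. is_network G \<longrightarrow> u \<in> verts G \<longrightarrow>
     v \<in> verts G \<longrightarrow> rcls G u \<in> A \<longrightarrow> rcls G v \<in> A}"

definition root_independent :: "('x rooted \<Rightarrow> 'b) \<Rightarrow> bool" where
  "root_independent w \<longleftrightarrow> (\<forall>G u v. is_network G \<longrightarrow> u \<in> verts G \<longrightarrow> v \<in> verts G \<longrightarrow>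
     w (rcls G u) = w (rcls G v))"


section \<open>Random rooted networks and unimodularity\<close>

definition random_rooted_network :: "'x::metric_space rooted measure \<Rightarrow> bool" where
  "random_rooted_network M \<longleftrightarrow> prob_space M \<and> sets M = sets borel"

definition transport :: "('x::metric_space birooted \<Rightarrow> real) \<Rightarrow> bool" where
  "transport T \<longleftrightarrow> T \<in> borel_measurable borel \<and> (\<forall>b. 0 \<le> T b)"

definition out_mass :: "('x birooted \<Rightarrow> real) \<Rightarrow> 'x network \<Rightarrow> nat \<Rightarrow> ennreal" where
  "out_mass T G u = (\<integral>\<^sup>+ v. ennreal (T (bcls G u v)) \<partial>count_space (verts G))"

definition in_mass :: "('x birooted \<Rightarrow> real) \<Rightarrow> 'x network \<Rightarrow> nat \<Rightarrow> ennreal" where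
  "in_mass T G u = (\<integral>\<^sup>+ v. ennreal (T (bcls G v u)) \<partial>count_space (verts G))"

definition unimodular :: "'x::metric_space rooted measure \<Rightarrow> bool" where
  "unimodular M \<longleftrightarrow> random_rooted_network M \<and>
     (\<forall>g. transport g \<longrightarrow>
       (\<integral>\<^sup>+ c. at_root (out_mass g) c \<partial>M) = (\<integral>\<^sup>+ c. at_root (in_mass g) c \<partial>M))"

definition bias :: "'x rooted measure \<Rightarrow> ('x rooted \<Rightarrow> real) \<Rightarrow> 'x rooted measure" where
  "bias M w = scale_measure (1 / (\<integral>\<^sup>+ c. ennreal (w c) \<partial>M)) (density M (\<lambda>c. ennreal (w c)))"


section \<open>Extensions\<close>

definition covariant_subset :: "('x::metric_space network \<Rightarrow> nat set) \<Rightarrow> bool" where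
  "covariant_subset S \<longleftrightarrow>
     (\<forall>G. is_network G \<longrightarrow> S G \<subseteq> verts G) \<and>
     (\<forall>G u H v. is_network G \<longrightarrow> is_network H \<longrightarrow> u \<in> verts G \<longrightarrow> v \<in> verts H \<longrightarrow>
        rcls G u = rcls H v \<longrightarrow> (u \<in> S G \<longleftrightarrow> v \<in> S H)) \<and>
     {c. at_root (\<lambda>G u. u \<in> S G) c} \<in> sets borel"

text \<open>
  The class of the subnetwork induced by \<^term>\<open>S\<close>, with the same root.  The second branch is only
  taken on a null event and makes the function total.
\<close>

definition subnet_class :: "('x network \<Rightarrow> nat set) \<Rightarrow> 'x rooted \<Rightarrow> 'x rooted" where
  "subnet_class S = at_root (\<lambda>G u.
     if u \<in> S G \<and> connected_net (subnet G (S G)) then rcls (subnet G (S G)) u else rcls G u)"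

definition map_marks :: "('y \<Rightarrow> 'x) \<Rightarrow> 'y network \<Rightarrow> 'x network" where
  "map_marks \<iota> G = \<lparr>verts = verts G, edges = edges G, ends = ends G,
     vmark = (\<lambda>v. \<iota> (vmark G v)), emark = (\<lambda>v e. \<iota> (emark G v e))\<rparr>"

text \<open>
  The mark space \<^typ>\<open>'x\<close> of the extension may be larger than the mark space \<^typ>\<open>'y\<close> of the
  network that is extended, which is regarded as a subspace through the embedding \<^term>\<open>\<iota>\<close>.
\<close>

definition extension ::
  "('y::metric_space \<Rightarrow> 'x::metric_space) \<Rightarrow> 'y rooted measure \<Rightarrow> 'x rooted measure \<Rightarrow>
   ('x network \<Rightarrow> nat set) \<Rightarrow> bool" where
  "extension \<iota> M\<^sub>0 M S \<longleftrightarrow>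
     unimodular M\<^sub>0 \<and> (\<exists>\<kappa>. homeomorphism UNIV (range \<iota>) \<iota> \<kappa>) \<and>
     random_rooted_network M \<and> covariant_subset S \<and>
     (AE c in M. at_root (\<lambda>G u. u \<in> S G) c) \<and>
     (AE c in M. at_root (\<lambda>G u. connected_net (subnet G (S G))) c) \<and>
     distr M borel (subnet_class S) = distr M\<^sub>0 borel (at_root (\<lambda>G u. rcls (map_marks \<iota> G) u))"

definition proper_extension ::
  "('y::metric_space \<Rightarrow> 'x::metric_space) \<Rightarrow> 'y rooted measure \<Rightarrow> 'x rooted measure \<Rightarrow>
   ('x network \<Rightarrow> nat set) \<Rightarrow> bool" where
  "proper_extension \<iota> M\<^sub>0 M S \<longleftrightarrow> extension \<iota> M\<^sub>0 M S \<and>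
     (\<forall>g. transport g \<longrightarrow>
       (\<integral>\<^sup>+ c. at_root (\<lambda>G u. \<integral>\<^sup>+ v. ennreal (g (bcls G u v)) \<partial>count_space (S G)) c \<partial>M) =
       (\<integral>\<^sup>+ c. at_root (\<lambda>G u. \<integral>\<^sup>+ v. ennreal (g (bcls G v u)) \<partial>count_space (S G)) c \<partial>M))"


section \<open>Unimodularizations and admissible kernels\<close>

definition strong_unimodularization :: "'x::metric_space rooted measure \<Rightarrow> 'x rooted measure \<Rightarrow> bool" where
  "strong_unimodularization M' M \<longleftrightarrow> unimodular M' \<and>
     distr M' unrooted_space forget_root = distr M unrooted_space forget_root"

definition weak_unimodularization :: "'x::metric_space rooted measure \<Rightarrow> 'x rooted measure \<Rightarrow> bool" where
  "weak_unimodularization M' M \<longleftrightarrow> unimodular M' \<and>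
     absolutely_continuous (distr M' unrooted_space forget_root) (distr M unrooted_space forget_root) \<and>
     absolutely_continuous (distr M unrooted_space forget_root) (distr M' unrooted_space forget_root)"

definition unimodularization :: "'x::metric_space rooted measure \<Rightarrow> 'x rooted measure \<Rightarrow> bool" where
  "unimodularization M' M \<longleftrightarrow> weak_unimodularization M' M \<or> strong_unimodularization M' M"

definition admissible_kernel ::
  "'x::metric_space rooted measure \<Rightarrow> ('x network \<Rightarrow> nat set) \<Rightarrow> ('x birooted \<Rightarrow> real) \<Rightarrow> bool" where
  "admissible_kernel M S T \<longleftrightarrow> transport T \<and>
     (AE c in M. at_root (\<lambda>G u. \<forall>v\<in>verts G. out_mass T G v = 1 \<and>
        (\<forall>z\<in>verts G - S G. T (bcls G v z) = 0)) c)"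

definition cond_in_mass ::
  "'x::metric_space rooted measure \<Rightarrow> ('x birooted \<Rightarrow> real) \<Rightarrow> 'x rooted \<Rightarrow> ennreal" where
  "cond_in_mass M T = nn_cond_exp M invariant_field (at_root (in_mass T))"

definition kernel_law_exists :: "'x::metric_space rooted measure \<Rightarrow> ('x birooted \<Rightarrow> real) \<Rightarrow> bool" where
  "kernel_law_exists M T \<longleftrightarrow> (AE c in M. cond_in_mass M T c < \<infinity>)"

definition kernel_law ::
  "'x::metric_space rooted measure \<Rightarrow> ('x birooted \<Rightarrow> real) \<Rightarrow> 'x rooted measure" where
  "kernel_law M T = measure_of UNIV (sets borel) (\<lambda>A.
     \<integral>\<^sup>+ c. 1 / cond_in_mass M T c *
       at_root (\<lambda>G u. \<integral>\<^sup>+ v. ennreal (T (bcls G v u)) * indicator A (rcls G v)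
         \<partial>count_space (verts G)) c \<partial>M)"


section \<open>Basic facts\<close>

lemma rcls_iso:
  assumes "is_network G" "is_network H" "u \<in> verts G" "network_iso G H f g"
  shows "rcls H (f u) = rcls G u"
proof -
  have "f u \<in> verts H"
    using assms by (auto simp: network_iso_def graph_iso_def bij_betw_def)
  then have "rcls G u = rcls H (f u)"
    using assms rcls_eq_iff[of G u H "f u"] by blast
  then show ?thesis by simp
qed

lemma network_iso_bij: "network_iso G H f g \<Longrightarrow> bij_betw f (verts G) (verts H)"
  by (simp add: network_iso_def graph_iso_def)

lemma at_root_out_mass:
  assumes "is_network G" "u \<in> verts G"
  shows "at_root (out_mass T) (rcls G u) = out_mass T G u"
proof (rule at_root_rcls[OF assms])
  fix H f g assume H: "is_network H" "network_iso G H f g"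
  have "out_mass T H (f u) = (\<integral>\<^sup>+ v. ennreal (T (bcls H (f u) (f v))) \<partial>count_space (verts G))"
    unfolding out_mass_def
    by (rule nn_integral_bij_count_space[OF network_iso_bij[OF H(2)], symmetric])
  also have "\<dots> = out_mass T G u"
    unfolding out_mass_def
    using bcls_eqI[OF assms(1) H(1) assms(2) _ H(2)]
    by (intro nn_integral_cong) simp
  finally show "out_mass T H (f u) = out_mass T G u" .
qed

lemma at_root_in_mass:
  assumes "is_network G" "u \<in> verts G"
  shows "at_root (in_mass T) (rcls G u) = in_mass T G u"
proof (rule at_root_rcls[OF assms])
  fix H f g assume H: "is_network H" "network_iso G H f g"
  have "in_mass T H (f u) = (\<integral>\<^sup>+ v. ennreal (T (bcls H (f v) (f u))) \<partial>count_space (verts G))"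
    unfolding in_mass_def
    by (rule nn_integral_bij_count_space[OF network_iso_bij[OF H(2)], symmetric])
  also have "\<dots> = in_mass T G u"
    unfolding in_mass_def
    using bcls_eqI[OF assms(1) H(1) _ assms(2) H(2)]
    by (intro nn_integral_cong) simp
  finally show "in_mass T H (f u) = in_mass T G u" .
qed

lemma forget_root_rcls:
  assumes "is_network G" "u \<in> verts G"
  shows "forget_root (rcls G u) = ucls G"
  unfolding forget_root_def
proof (rule at_root_rcls[OF assms])
  fix H f g assume "is_network H" "network_iso G H f g"
  then have "unrooted_eq G H" using assms by (auto simp: unrooted_eq_def)
  then show "ucls H = ucls G"
    unfolding ucls_def using Quotient3_rel[OF Quotient3_unrooted, of G H] by simp
qed

lemma sets_unrooted_space:
  "sets (unrooted_space :: 'x::metric_space unrooted measure) =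
     {B. forget_root -` B \<in> sets (borel :: 'x rooted measure)}"
proof -
  have "sigma_algebra UNIV {B. forget_root -` B \<in> sets (borel :: 'x rooted measure)}"
    unfolding sigma_algebra_iff2
  proof (intro conjI ballI allI impI)
    fix B :: "'x unrooted set" assume "B \<in> {B. forget_root -` B \<in> sets (borel :: 'x rooted measure)}"
    then have "- (forget_root -` B) \<in> sets (borel :: 'x rooted measure)" by (auto intro: borel_comp)
    then show "UNIV - B \<in> {B. forget_root -` B \<in> sets (borel :: 'x rooted measure)}"
      by (simp add: vimage_Diff Compl_eq_Diff_UNIV)
  next
    fix A :: "nat \<Rightarrow> 'x unrooted set"
    assume "range A \<subseteq> {B. forget_root -` B \<in> sets (borel :: 'x rooted measure)}"
    then have "(\<Union>i. forget_root -` A i) \<in> sets (borel :: 'x rooted measure)" by blast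
    then show "\<Union>(range A) \<in> {B. forget_root -` B \<in> sets (borel :: 'x rooted measure)}"
      by (simp add: vimage_UN)
  qed simp_all
  then show ?thesis
    unfolding unrooted_space_def by (simp add: sigma_algebra.sigma_sets_eq)
qed

lemma sets_invariant_field:
  "sets (invariant_field :: 'x::metric_space rooted measure) =
     {A \<in> sets borel. \<forall>G u v. is_network G \<longrightarrow> u \<in> verts G \<longrightarrow> v \<in> verts G \<longrightarrow>
        rcls G u \<in> A \<longrightarrow> rcls G v \<in> A}"
proof -
  define inv where "inv A \<longleftrightarrow> (\<forall>G u v. is_network G \<longrightarrow> u \<in> verts G \<longrightarrow> v \<in> verts G \<longrightarrow>
    rcls G u \<in> A \<longrightarrow> rcls G v \<in> A)" for A :: "'x rooted set"
  have compl: "inv (UNIV - A)" if "inv A" for A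
    using that unfolding inv_def by blast
  have Union: "inv (\<Union>i. A i)" if "\<And>i. inv (A i)" for A :: "nat \<Rightarrow> _"
    using that unfolding inv_def by blast
  have "inv {}" by (simp add: inv_def)
  then have "sigma_algebra UNIV {A \<in> sets borel. inv A}"
    unfolding sigma_algebra_iff2
    by (auto intro!: compl Union sets.compl_sets[of _ borel, simplified])
  then have "sets (sigma UNIV {A \<in> sets borel. inv A}) = {A \<in> sets borel. inv A}"
    by (subst sets_measure_of) (simp_all add: sigma_algebra.sigma_sets_eq)
  then show ?thesis
    unfolding invariant_field_def inv_def .
qed

lemma subalgebra_invariant_field:
  assumes "random_rooted_network M"
  shows "subalgebra M invariant_field"
proof -
  have M: "sets M = sets borel" using assms by (simp add: random_rooted_network_def)
  then have "space M = UNIV" using sets_eq_imp_space_eq[OF M] by simp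
  moreover have "space invariant_field = UNIV"
    unfolding invariant_field_def by (rule space_measure_of) simp
  moreover have "sets invariant_field \<subseteq> sets borel"
    unfolding sets_invariant_field by (rule Collect_restrict)
  ultimately show ?thesis using M unfolding subalgebra_def by blast
qed

end

theory Submission
  imports Defs
begin

text \<open>
  Let \<open>M'\<close> be the law of a unimodularization. Everything rests on one fact: \<open>M\<close> is the restriction
  of \<open>M'\<close> to the event that the root lies in \<open>S\<close>, up to a density \<open>\<rho>\<close> that does not see the root
  (\<open>root_independent_density\<close>). Indeed, a null event of \<open>M'\<close> is, by mass transport, almost never
  visible from any vertex; that no vertex sees it is a root-independent property, so it passes to \<open>M\<close>,
  and \<open>M\<close> is absolutely continuous with respect to \<open>M'\<close>. Both measures satisfy the mass transport
  principle for transports inside \<open>S\<close>. Testing them on the transport that sends \<open>h(u, v)\<close> from \<open>u\<close> to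
  \<open>v\<close> whenever the density is larger at \<open>u\<close> than at \<open>v\<close>, where \<open>h > 0\<close> is a fixed kernel with row sums
  at most 1, shows that the density is constant on \<open>S\<close>.
  
  Given \<open>\<rho>\<close>, mass transport under \<open>M'\<close> evaluates every integral of an admissible kernel
  (\<open>kernel_integral\<close>). Hence the conditional in-mass is finite for \<^emph>\<open>every\<close> admissible kernel, and the
  kernel law is \<open>M'\<close> with the root-independent density \<open>\<rho> / E[T\<^sup>-(o) | I]\<close>. Inverting that density
  exhibits \<open>M'\<close> as a biased kernel law (\<open>bias_kernel_law\<close>).
  
  It remains to construct an admissible kernel, and the balanced one serves for both existence claims.
  Every vertex is given supply 1 and every vertex of \<open>S\<close> capacity \<open>1 / P'(o \<in> S | I)\<close>. In each round the
  amount \<open>h(x, y) min(s(x), c(y))\<close> moves from \<open>x\<close> to \<open>y\<close>, where \<open>s\<close> and \<open>c\<close> are the remaining supply and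
  capacity. In the limit no network has both a vertex with supply left and a vertex with capacity
  left (\<open>greedy_transport\<close>), whereas by mass transport the expected leftovers agree on every invariant
  event. So both vanish almost surely (\<open>balanced_kernel\<close>).
  
  All of this needs sums over the second root to be measurable. The local topologies are determined
  by neighbourhoods of approximately isomorphic balls, so the number of second roots for which a
  doubly-rooted network lies in a given open set is lower semicontinuous (\<open>open_osum_gt\<close>); a Dynkin
  argument and monotone limits then give all measurable functions (\<open>measurable_osum\<close>).
\<close>

section \<open>Balls and approximate isomorphisms\<close>

definition vball :: "'x network \<Rightarrow> nat \<Rightarrow> nat \<Rightarrow> nat set" where
  "vball G u r = {v. \<exists>n\<le>r. (u, v) \<in> adj G ^^ n}"

lemma ball_net_vball: "ball_net G u r = subnet G (vball G u r)"
  by (simp add: ball_net_def vball_def)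

lemma adj_verts: "is_network G \<Longrightarrow> (u, v) \<in> adj G \<Longrightarrow> u \<in> verts G \<and> v \<in> verts G"
  by (auto simp: adj_def is_network_def)

lemma relpow_adj_verts: "is_network G \<Longrightarrow> u \<in> verts G \<Longrightarrow> (u, v) \<in> adj G ^^ n \<Longrightarrow> v \<in> verts G"
  by (cases n) (auto dest: adj_verts)

lemma vball_subset: "is_network G \<Longrightarrow> u \<in> verts G \<Longrightarrow> vball G u r \<subseteq> verts G"
  by (auto simp: vball_def relpow_adj_verts)

lemma vball_self: "u \<in> vball G u r"
  unfolding vball_def by (auto intro!: exI[of _ 0])

lemma vball_mono: "r \<le> R \<Longrightarrow> vball G u r \<subseteq> vball G u R"
proof
  fix x assume "r \<le> R" "x \<in> vball G u r"
  then obtain n where "n \<le> r" "(u, x) \<in> adj G ^^ n" by (auto simp: vball_def)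
  then show "x \<in> vball G u R" using \<open>r \<le> R\<close> by (auto simp: vball_def intro!: exI[of _ n])
qed

lemma vball_relpow: "v \<in> vball G u d \<Longrightarrow> (v, x) \<in> adj G ^^ n \<Longrightarrow> x \<in> vball G u (d + n)"
proof -
  assume "v \<in> vball G u d" "(v, x) \<in> adj G ^^ n"
  then obtain k where "k \<le> d" "(u, v) \<in> adj G ^^ k" by (auto simp: vball_def)
  then have "(u, x) \<in> adj G ^^ (k + n)"
    using \<open>(v, x) \<in> adj G ^^ n\<close> by (auto simp: relpow_add)
  then show ?thesis using \<open>k \<le> d\<close> by (auto simp: vball_def intro!: exI[of _ "k + n"])
qed

lemma vball_shift: "v \<in> vball G u d \<Longrightarrow> d + r \<le> R \<Longrightarrow> vball G v r \<subseteq> vball G u R"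
proof
  fix x assume v: "v \<in> vball G u d" and "d + r \<le> R" "x \<in> vball G v r"
  then obtain n where n: "n \<le> r" "(v, x) \<in> adj G ^^ n" by (auto simp: vball_def)
  then show "x \<in> vball G u R"
    using vball_relpow[OF v n(2)] vball_mono[of "d + n" R G u] \<open>d + r \<le> R\<close> by auto
qed

lemma vball_exhausts:
  assumes "is_network G" "u \<in> verts G" "v \<in> verts G"
  shows "\<exists>r. v \<in> vball G u r"
proof -
  have "(u, v) \<in> (adj G)\<^sup>*" using assms by (auto simp: is_network_def connected_net_def)
  then show ?thesis by (auto simp: vball_def rtrancl_power)
qed

lemma vball_finite:
  assumes G: "is_network G" and u: "u \<in> verts G"
  shows "finite (vball G u r)"
proof (induction r)
  case 0 then show ?case by (simp add: vball_def)
next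
  case (Suc r)
  have fin: "finite (adj G `` {v})" if "v \<in> verts G" for v
  proof (rule finite_subset)
    show "adj G `` {v} \<subseteq> \<Union> (ends G ` {e \<in> edges G. v \<in> ends G e})"
      by (auto simp: adj_def)
    have "finite (ends G e)" if "e \<in> edges G" for e
    proof -
      have "card (ends G e) \<in> {1, 2}" using G that by (simp add: is_network_def)
      then show ?thesis by (intro card_ge_0_finite) auto
    qed
    moreover have "finite {e \<in> edges G. v \<in> ends G e}"
      using G \<open>v \<in> verts G\<close> by (simp add: is_network_def)
    ultimately show "finite (\<Union> (ends G ` {e \<in> edges G. v \<in> ends G e}))" by auto
  qed
  have "vball G u (Suc r) \<subseteq> insert u (\<Union>v\<in>vball G u r. adj G `` {v})"
  proof
    fix x assume "x \<in> vball G u (Suc r)"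
    then obtain n where n: "n \<le> Suc r" "(u, x) \<in> adj G ^^ n" by (auto simp: vball_def)
    then show "x \<in> insert u (\<Union>v\<in>vball G u r. adj G `` {v})"
    proof (cases n)
      case (Suc m)
      then obtain y where "(u, y) \<in> adj G ^^ m" "(y, x) \<in> adj G" using n by auto
      then show ?thesis using n Suc by (auto simp: vball_def)
    qed (use n in auto)
  qed
  moreover have "finite (insert u (\<Union>v\<in>vball G u r. adj G `` {v}))"
    using Suc fin vball_subset[OF G u] by auto
  ultimately show ?case by (rule finite_subset)
qed

text \<open>
  The part of being a network that every induced subgraph inherits, connected or not. It is what
  inverting and restricting isomorphisms of balls rests on.
\<close>

definition wf_ends :: "'x network \<Rightarrow> bool" where
  "wf_ends G \<longleftrightarrow> (\<forall>e\<in>edges G. ends G e \<subseteq> verts G)"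

lemma wf_ends_subnet: "is_network G \<Longrightarrow> wf_ends (subnet G W)"
  by (auto simp: wf_ends_def subnet_def is_network_def)

lemma wf_ends_network: "is_network G \<Longrightarrow> wf_ends G"
  by (auto simp: wf_ends_def is_network_def)

definition approx_iso :: "real \<Rightarrow> 'x::metric_space network \<Rightarrow> 'x network \<Rightarrow> (nat \<Rightarrow> nat) \<Rightarrow> (nat \<Rightarrow> nat) \<Rightarrow> bool" where
  "approx_iso \<epsilon> G H f g \<longleftrightarrow> graph_iso G H f g \<and> marks_within \<epsilon> G H f g"

lemma approx_iso_subnet:
  assumes "wf_ends G" "wf_ends H" "W \<subseteq> verts G" "approx_iso \<epsilon> G H f g"
  shows "approx_iso \<epsilon> (subnet G W) (subnet H (f ` W)) f g"
proof -
  have f: "bij_betw f (verts G) (verts H)" and g: "bij_betw g (edges G) (edges H)"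
    and e: "\<And>e. e \<in> edges G \<Longrightarrow> ends H (g e) = f ` ends G e"
    using assms by (auto simp: approx_iso_def graph_iso_def)
  have W: "f ` W \<subseteq> verts H" using f assms(3) by (auto simp: bij_betw_def)
  have sub: "f ` ends G e \<subseteq> f ` W \<longleftrightarrow> ends G e \<subseteq> W" if "e \<in> edges G" for e
    using that assms(1,3) f unfolding wf_ends_def bij_betw_def
    by (metis inj_on_image_subset_iff)
  have "bij_betw f (verts G \<inter> W) (verts H \<inter> f ` W)"
    using f W assms(3) by (auto simp: Int_absorb1 bij_betw_subset)
  moreover have "bij_betw g {e \<in> edges G. ends G e \<subseteq> W} {e \<in> edges H. ends H e \<subseteq> f ` W}"
  proof (rule bij_betw_subset[OF g])
    show "g ` {e \<in> edges G. ends G e \<subseteq> W} = {e \<in> edges H. ends H e \<subseteq> f ` W}"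
    proof (intro equalityI subsetI)
      fix d assume d: "d \<in> {e \<in> edges H. ends H e \<subseteq> f ` W}"
      then obtain e' where "e' \<in> edges G" "d = g e'" using g by (auto simp: bij_betw_def)
      then show "d \<in> g ` {e \<in> edges G. ends G e \<subseteq> W}" using d e sub by auto
    next
      fix d assume "d \<in> g ` {e \<in> edges G. ends G e \<subseteq> W}"
      then obtain e' where e': "e' \<in> edges G" "ends G e' \<subseteq> W" "d = g e'" by blast
      then have "d \<in> edges H" "ends H d = f ` ends G e'"
        using e g by (auto simp: bij_betw_def)
      then show "d \<in> {e \<in> edges H. ends H e \<subseteq> f ` W}" using e'(2) by auto
    qed
  qed auto
  ultimately show ?thesis
    using assms(4) by (auto simp: approx_iso_def graph_iso_def marks_within_def subnet_def)
qed

lemma approx_iso_trans: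
  assumes "wf_ends G" "approx_iso \<epsilon> G H f g" "approx_iso \<delta> H K f' g'"
  shows "approx_iso (\<epsilon> + \<delta>) G K (f' \<circ> f) (g' \<circ> g)"
proof -
  have g: "g e \<in> edges H" if "e \<in> edges G" for e
    using assms(2) that by (auto simp: approx_iso_def graph_iso_def bij_betw_def)
  have f: "f v \<in> verts H" if "v \<in> verts G" for v
    using assms(2) that by (auto simp: approx_iso_def graph_iso_def bij_betw_def)
  have "graph_iso G K (f' \<circ> f) (g' \<circ> g)"
    using assms f g bij_betw_trans[of f "verts G" "verts H" f' "verts K"]
      bij_betw_trans[of g "edges G" "edges H" g' "edges K"]
    by (auto simp: approx_iso_def graph_iso_def image_comp)
  moreover have "marks_within (\<epsilon> + \<delta>) G K (f' \<circ> f) (g' \<circ> g)"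
    unfolding marks_within_def comp_def
  proof (intro conjI ballI)
    fix v assume "v \<in> verts G"
    then have "dist (vmark K (f' (f v))) (vmark H (f v)) < \<delta>" "dist (vmark H (f v)) (vmark G v) < \<epsilon>"
      using assms(2,3) f by (auto simp: approx_iso_def marks_within_def)
    then show "dist (vmark K (f' (f v))) (vmark G v) < \<epsilon> + \<delta>"
      using dist_triangle[of "vmark K (f' (f v))" "vmark G v" "vmark H (f v)"] by simp
  next
    fix e v assume e: "e \<in> edges G" "v \<in> ends G e"
    then have "f v \<in> ends H (g e)"
      using assms(2) by (auto simp: approx_iso_def graph_iso_def)
    then have "dist (emark K (f' (f v)) (g' (g e))) (emark H (f v) (g e)) < \<delta>"
        "dist (emark H (f v) (g e)) (emark G v e) < \<epsilon>"
      using assms(2,3) e g by (auto simp: approx_iso_def marks_within_def)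
    then show "dist (emark K (f' (f v)) (g' (g e))) (emark G v e) < \<epsilon> + \<delta>"
      using dist_triangle[of "emark K (f' (f v)) (g' (g e))" "emark G v e" "emark H (f v) (g e)"] by simp
  qed
  ultimately show ?thesis by (simp add: approx_iso_def)
qed

lemma network_iso_approx: "network_iso G H f g \<Longrightarrow> 0 < \<epsilon> \<Longrightarrow> approx_iso \<epsilon> G H f g"
  by (auto simp: approx_iso_def network_iso_def marks_within_def)

lemma graph_iso_inverse:
  assumes "graph_iso G H f g" "wf_ends G"
  shows "graph_iso H G (inv_into (verts G) f) (inv_into (edges G) g)"
proof -
  let ?f = "inv_into (verts G) f" and ?g = "inv_into (edges G) g"
  have f: "bij_betw f (verts G) (verts H)" and g: "bij_betw g (edges G) (edges H)"
    using assms by (auto simp: graph_iso_def)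
  have "ends G (?g d) = ?f ` ends H d" if "d \<in> edges H" for d
  proof -
    have "d \<in> g ` edges G" using g that by (simp add: bij_betw_def)
    then obtain e where e: "e \<in> edges G" "d = g e" by blast
    then have "?f ` ends H d = ?f ` f ` ends G e" using assms by (simp add: graph_iso_def)
    also have "\<dots> = ends G e"
      using e assms(2) by (intro inv_into_image_cancel bij_betw_imp_inj_on[OF f]) (simp add: wf_ends_def)
    finally show ?thesis using e g by (simp add: bij_betw_def)
  qed
  then show ?thesis
    using bij_betw_inv_into[OF f] bij_betw_inv_into[OF g] by (simp add: graph_iso_def)
qed

text \<open>
  A path of length \<open>n\<close> from \<open>v\<close> stays inside the ball of radius \<open>R\<close> as long as \<open>d + n \<le> R\<close>, so the
  isomorphism of the balls can be applied edge by edge.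
\<close>

lemma graph_iso_relpow:
  assumes iso: "graph_iso (ball_net G u R) (ball_net H w R) f g"
    and v: "v \<in> vball G u d" and n: "d + n \<le> R"
    and path: "(v, x) \<in> adj G ^^ n"
  shows "(f v, f x) \<in> adj H ^^ n"
  using n path
proof (induction n arbitrary: x)
  case (Suc n)
  then obtain y where y: "(v, y) \<in> adj G ^^ n" "(y, x) \<in> adj G" by auto
  have "y \<in> vball G u R"
    using vball_relpow[OF v y(1)] vball_mono[of "d + n" R G u] Suc.prems(1) by auto
  moreover have "x \<in> vball G u R"
    using vball_relpow[OF v Suc.prems(2)] vball_mono[of "d + Suc n" R G u] Suc.prems(1) by auto
  moreover obtain e where "e \<in> edges G" "ends G e = {y, x}" using y by (auto simp: adj_def)
  ultimately have e: "e \<in> edges (ball_net G u R)" "ends (ball_net G u R) e = {y, x}"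
    by (auto simp: ball_net_vball subnet_def)
  then have "g e \<in> edges (ball_net H w R)" "ends (ball_net H w R) (g e) = f ` {y, x}"
    using iso by (auto simp: graph_iso_def bij_betw_def)
  then have "(f y, f x) \<in> adj H" by (auto simp: adj_def ball_net_vball subnet_def)
  then show ?case using Suc y by auto
qed simp

lemma verts_ball_net: "is_network G \<Longrightarrow> u \<in> verts G \<Longrightarrow> verts (ball_net G u r) = vball G u r"
  using vball_subset[of G u r] by (auto simp: ball_net_vball subnet_def)

text \<open>
  The paths used in the previous lemma can also be pulled back by the inverse isomorphism; hence an
  isomorphism of large balls restricts to balls around vertices other than the root.
\<close>

lemma graph_iso_vball:
  assumes nets: "is_network G" "is_network H" "u \<in> verts G" "f u \<in> verts H"
    and iso: "graph_iso (ball_net G u R) (ball_net H (f u) R) f g"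
    and v: "v \<in> vball G u d" and n: "d + r \<le> R"
  shows "f ` vball G v r = vball H (f v) r"
proof
  show sub: "f ` vball G v r \<subseteq> vball H (f v) r"
    using graph_iso_relpow[OF iso v] n by (fastforce simp: vball_def)
  let ?f = "inv_into (verts (ball_net G u R)) f" and ?g = "inv_into (edges (ball_net G u R)) g"
  have inv: "graph_iso (ball_net H (f u) R) (ball_net G u R) ?f ?g"
    by (rule graph_iso_inverse[OF iso]) (simp add: ball_net_vball wf_ends_subnet nets)
  have ff: "?f (f x) = x" if "x \<in> vball G u R" for x
    using iso that by (simp add: graph_iso_def bij_betw_def verts_ball_net nets)
  have ff': "f (?f y) = y" if "y \<in> vball H (f u) R" for y
    using iso that by (simp add: graph_iso_def bij_betw_def verts_ball_net nets f_inv_into_f)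
  have vR: "v \<in> vball G u R" using v n vball_mono[of d R G u] by auto
  have v': "f v \<in> vball H (f u) d"
    using graph_iso_relpow[OF iso vball_self[of u G 0]] v n by (fastforce simp: vball_def)
  show "vball H (f v) r \<subseteq> f ` vball G v r"
  proof
    fix y assume y: "y \<in> vball H (f v) r"
    then obtain k where k: "k \<le> r" "(f v, y) \<in> adj H ^^ k" by (auto simp: vball_def)
    have "(?f (f v), ?f y) \<in> adj G ^^ k"
      by (rule graph_iso_relpow[OF inv v' _ k(2)]) (use k n in simp)
    then have "?f y \<in> vball G v r" using k ff[OF vR] by (auto simp: vball_def)
    moreover have "y \<in> vball H (f u) R" using vball_shift[OF v' n] y by auto
    ultimately show "y \<in> f ` vball G v r" using ff' by force
  qed
qed

text \<open>
  The root of the second network is not a parameter: it is the image \<^term>\<open>f u\<close>.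
\<close>

definition near :: "nat \<Rightarrow> real \<Rightarrow> 'x::metric_space network \<Rightarrow> nat \<Rightarrow> 'x network \<Rightarrow> (nat \<Rightarrow> nat) \<Rightarrow> (nat \<Rightarrow> nat) \<Rightarrow> bool" where
  "near r \<epsilon> G u H f g \<longleftrightarrow> approx_iso \<epsilon> (ball_net G u r) (ball_net H (f u) r) f g"

lemma subnet_subnet: "W' \<subseteq> W \<Longrightarrow> subnet (subnet G W) W' = subnet G W'"
  by (cases G) (auto simp: subnet_def)

text \<open>
  This is what makes reversing the two roots continuous: a ball around the second root sits inside a
  larger ball around the first one.
\<close>

lemma near_reroot:
  assumes nets: "is_network G" "is_network H" "u \<in> verts G" "f u \<in> verts H"
    and near: "near R \<epsilon> G u H f g"
    and v: "v \<in> vball G u d" and n: "d + r \<le> R"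
  shows "near r \<epsilon> G v H f g"
proof -
  have iso: "graph_iso (ball_net G u R) (ball_net H (f u) R) f g"
    using near by (simp add: near_def approx_iso_def)
  have img: "f ` vball G v r = vball H (f v) r"
    by (rule graph_iso_vball[OF nets iso v n])
  have sub: "vball G v r \<subseteq> vball G u R" by (rule vball_shift[OF v n])
  have "f ` vball G u R = vball H (f u) R"
    by (rule graph_iso_vball[OF nets iso vball_self[of u G 0]]) simp
  then have sub': "vball H (f v) r \<subseteq> vball H (f u) R"
    using image_mono[OF sub, of f] img by simp
  have "approx_iso \<epsilon> (subnet (ball_net G u R) (vball G v r)) (subnet (ball_net H (f u) R) (f ` vball G v r)) f g"
    using near sub unfolding near_def
    by (intro approx_iso_subnet) (auto simp: ball_net_vball wf_ends_subnet nets verts_ball_net[unfolded ball_net_vball])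
  then show ?thesis
    unfolding img near_def using sub sub' by (simp add: ball_net_vball subnet_subnet)
qed

lemma near_network_iso:
  assumes nets: "is_network G" "is_network H" "u \<in> verts G"
    and iso: "network_iso G H f g" and "0 < \<epsilon>"
  shows "near r \<epsilon> G u H f g"
proof -
  have fwd: "(f v, f x) \<in> adj H ^^ n" if path: "(v, x) \<in> adj G ^^ n" and iso: "network_iso G H f g"
    for f g v x n and G H :: "'a network"
  proof -
    have step: "(f y, f z) \<in> adj H" if yz: "(y, z) \<in> adj G" for y z
    proof -
      obtain e where "e \<in> edges G" "ends G e = {y, z}" using yz by (auto simp: adj_def)
      then have "g e \<in> edges H" "ends H (g e) = {f y, f z}"
        using iso by (auto simp: network_iso_def graph_iso_def bij_betw_def)
      then show ?thesis by (auto simp: adj_def)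
    qed
    show ?thesis using path by (induction n arbitrary: x) (auto intro: step)
  qed
  have "f ` vball G u r = vball H (f u) r"
  proof
    show "f ` vball G u r \<subseteq> vball H (f u) r" using fwd[OF _ iso] by (fastforce simp: vball_def)
    show "vball H (f u) r \<subseteq> f ` vball G u r"
    proof
      fix y assume y: "y \<in> vball H (f u) r"
      then obtain n where n: "n \<le> r" "(f u, y) \<in> adj H ^^ n" by (auto simp: vball_def)
      have "f u \<in> verts H" using iso nets by (auto simp: network_iso_def graph_iso_def bij_betw_def)
      then have "y \<in> verts H" using n nets by (auto intro: relpow_adj_verts)
      then have "f (inv_into (verts G) f y) = y"
        using network_iso_bij[OF iso] by (simp add: bij_betw_def f_inv_into_f)
      moreover have "(u, inv_into (verts G) f y) \<in> adj G ^^ n"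
        using fwd[OF n(2) network_iso_sym[OF iso nets(1)]] inv_into_iso_root[OF iso nets(3)] by simp
      ultimately show "y \<in> f ` vball G u r" using n by (force simp: vball_def)
    qed
  qed
  moreover have "approx_iso \<epsilon> (subnet G (vball G u r)) (subnet H (f ` vball G u r)) f g"
    by (intro approx_iso_subnet network_iso_approx wf_ends_network vball_subset assms)
  ultimately show ?thesis by (simp add: near_def ball_net_vball)
qed

lemma near_trans:
  assumes "is_network G" "near r \<epsilon> G u H f g" "near r \<delta> H (f u) K f' g'"
  shows "near r (\<epsilon> + \<delta>) G u K (f' \<circ> f) (g' \<circ> g)"
  using approx_iso_trans[OF _ assms(2,3)[unfolded near_def]] assms(1)
  by (simp add: near_def ball_net_vball wf_ends_subnet)

lemma near_mono_radius:
  assumes "is_network G" "is_network H" "u \<in> verts G" "f u \<in> verts H" "near R \<epsilon> G u H f g" "r \<le> R"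
  shows "near r \<epsilon> G u H f g"
  by (rule near_reroot[OF assms(1-5) vball_self[of u G 0]]) (use assms in simp)

lemma near_mono_eps: "near r \<epsilon> G u H f g \<Longrightarrow> \<epsilon> \<le> \<delta> \<Longrightarrow> near r \<delta> G u H f g"
  unfolding near_def approx_iso_def marks_within_def by (meson less_le_trans)

section \<open>Neighbourhoods in the local topologies\<close>

lemma birooted_representative:
  obtains G u v where "rep_birooted b = (G, u, v)" "is_network G" "u \<in> verts G" "v \<in> verts G"
    "b = bcls G u v"
proof -
  obtain G u v where p: "rep_birooted b = (G, u, v)" by (cases "rep_birooted b")
  have "birooted_eq (G, u, v) (G, u, v)"
    using Quotient3_rep_reflp[OF Quotient3_birooted, of b] p by simp
  moreover have "b = bcls G u v"
    using Quotient3_abs_rep[OF Quotient3_birooted, of b] p by (simp add: bcls_def)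
  ultimately show thesis using p that by (auto simp: birooted_eq_def)
qed

lemma bcls_eqD:
  assumes "is_network G" "u \<in> verts G" "u' \<in> verts G" "is_network H" "v \<in> verts H" "v' \<in> verts H"
    and eq: "bcls G u u' = bcls H v v'"
  obtains f g where "network_iso G H f g" "f u = v" "f u' = v'"
proof -
  have refl: "birooted_eq (K, w, w') (K, w, w')" if "is_network K" "w \<in> verts K" "w' \<in> verts K"
    for K :: "'a network" and w w'
    unfolding birooted_eq_def prod.case using that network_iso_refl[of K]
    by (intro conjI exI[of _ id]) simp_all
  have "birooted_eq (G, u, u') (H, v, v')"
    using eq Quotient3_rel[OF Quotient3_birooted, of "(G, u, u')" "(H, v, v')"]
      refl[OF assms(1-3)] refl[OF assms(4-6)] by (simp add: bcls_def)
  then show thesis using that by (auto simp: birooted_eq_def)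
qed

lemma network_iso_verts: "network_iso G H f g \<Longrightarrow> u \<in> verts G \<Longrightarrow> f u \<in> verts H"
  by (auto simp: network_iso_def graph_iso_def bij_betw_def)

text \<open>
  Passing between a network and the representative chosen for its class costs arbitrarily little
  accuracy; three composed maps share \<open>\<epsilon>\<close> equally.
\<close>

lemma near_network_iso_comp:
  assumes nets: "is_network G" "is_network H" "u \<in> verts G" "f u \<in> verts H"
    and near: "near R \<delta> G u H f g" and r: "r \<le> R" and \<epsilon>: "0 < \<epsilon>" "\<delta> \<le> \<epsilon> / 3"
    and G': "is_network G'" "u' \<in> verts G'" "network_iso G' G a b" "a u' = u"
    and H': "is_network H'" "network_iso H H' p q"
  shows "near r \<epsilon> G' u' H' (p \<circ> f \<circ> a) (q \<circ> g \<circ> b)"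
proof -
  have "near r (\<epsilon> / 3) G' u' G a b" by (rule near_network_iso) (use G' nets \<epsilon> in auto)
  moreover have "near r (\<epsilon> / 3) G (a u') H f g"
    using near_mono_eps[OF near_mono_radius[OF nets near r] \<epsilon>(2)] G'(4) by simp
  ultimately have 1: "near r (\<epsilon> / 3 + \<epsilon> / 3) G' u' H (f \<circ> a) (g \<circ> b)"
    by (rule near_trans[OF G'(1)])
  have "near r (\<epsilon> / 3) H ((f \<circ> a) u') H' p q"
    by (rule near_network_iso) (use H' G' nets \<epsilon> in auto)
  from near_trans[OF G'(1) 1 this] show ?thesis by (simp add: comp_def)
qed

lemma near_vball:
  assumes "is_network G" "is_network H" "u \<in> verts G" "f u \<in> verts H" "near R \<epsilon> G u H f g" "r \<le> R"
  shows "f ` vball G u r = vball H (f u) r"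
proof -
  have "graph_iso (ball_net G u R) (ball_net H (f u) R) f g"
    using assms(5) by (simp add: near_def approx_iso_def)
  from graph_iso_vball[OF assms(1-4) this vball_self[of u G 0]] assms(6) show ?thesis by simp
qed

lemma near_verts:
  assumes "is_network G" "is_network H" "u \<in> verts G" "f u \<in> verts H" "near R \<epsilon> G u H f g"
    "v \<in> vball G u R"
  shows "f v \<in> verts H"
  using near_vball[OF assms(1-5) order_refl] vball_subset[OF assms(2,4), of R] assms(6) by auto

lemma near_inj:
  assumes "is_network G" "u \<in> verts G" "near R \<epsilon> G u H f g"
  shows "inj_on f (vball G u R)"
  using assms(3) verts_ball_net[OF assms(1,2), of R]
  by (simp add: near_def approx_iso_def graph_iso_def bij_betw_def)

lemma eventually_small: "0 < \<epsilon> \<Longrightarrow> \<forall>\<^sub>F n in sequentially. r \<le> n \<and> 1 / Suc n \<le> (\<epsilon>::real)"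
proof -
  assume "0 < \<epsilon>"
  then have "\<forall>\<^sub>F n in sequentially. 1 / Suc n < \<epsilon>"
    using LIMSEQ_inverse_real_of_nat by (auto simp: tendsto_iff dist_real_def divide_inverse)
  with eventually_ge_at_top[of r] show ?thesis by eventually_elim simp
qed

text \<open>
  Open sets are defined through convergent sequences of chosen representatives. The equivalent
  description by neighbourhoods is free of representatives: if no radius and accuracy worked at some
  point of an open set, the counterexamples for radius \<open>d + n\<close>, with \<open>d\<close> at least the distance of the
  two roots, and accuracy \<open>1 / (n + 1)\<close> would converge to this point.
\<close>

lemma open_birooted_iff:
  fixes U :: "'x::metric_space birooted set"
  shows "open U \<longleftrightarrow> (\<forall>G u v. is_network G \<longrightarrow> u \<in> verts G \<longrightarrow> v \<in> verts G \<longrightarrow> bcls G u v \<in> U \<longrightarrow>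
     (\<exists>r. \<exists>\<epsilon>>0. v \<in> vball G u r \<and> (\<forall>H f g. is_network H \<longrightarrow> f u \<in> verts H \<longrightarrow> near r \<epsilon> G u H f g \<longrightarrow>
        bcls H (f u) (f v) \<in> U)))" (is "_ \<longleftrightarrow> ?nbhds")
proof
  assume U: "open U"
  show ?nbhds
  proof (intro allI impI, rule ccontr)
    fix G :: "'x network" and u v
    assume G: "is_network G" "u \<in> verts G" "v \<in> verts G" "bcls G u v \<in> U"
    obtain d where d: "v \<in> vball G u d" using vball_exhausts[OF G(1-3)] by blast
    assume neg: "\<not> (\<exists>r. \<exists>\<epsilon>>0. v \<in> vball G u r \<and> (\<forall>H f g. is_network H \<longrightarrow> f u \<in> verts H \<longrightarrow>
      near r \<epsilon> G u H f g \<longrightarrow> bcls H (f u) (f v) \<in> U))"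
    have "\<exists>H f g. is_network H \<and> f u \<in> verts H \<and> near (d + n) (1 / Suc n) G u H f g \<and>
        bcls H (f u) (f v) \<notin> U" for n
    proof -
      have "v \<in> vball G u (d + n)" using d vball_mono[of d "d + n" G u] by auto
      moreover have "0 < 1 / real (Suc n)" by simp
      ultimately show ?thesis using neg by blast
    qed
    then obtain H f g where H: "\<And>n. is_network (H n)" "\<And>n. f n u \<in> verts (H n)"
        "\<And>n. near (d + n) (1 / Suc n) G u (H n) (f n) (g n)"
        "\<And>n. bcls (H n) (f n u) (f n v) \<notin> U"
      by metis
    have fv: "f n v \<in> verts (H n)" for n
      using d vball_mono[of d "d + n" G u] by (intro near_verts[OF G(1) H(1) G(2) H(2,3)]) auto
    define X where "X n = bcls (H n) (f n u) (f n v)" for n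
    obtain G' u' v' where G': "rep_birooted (bcls G u v) = (G', u', v')" "is_network G'"
        "u' \<in> verts G'" "v' \<in> verts G'" "bcls G u v = bcls G' u' v'"
      by (rule birooted_representative)
    obtain a b where ab: "network_iso G' G a b" "a u' = u" "a v' = v"
      by (rule bcls_eqD[OF G'(2-4) G(1-3) G'(5)[symmetric]])
    have "birooted_conv X (bcls G u v)"
      unfolding birooted_conv_def G'(1) prod.case
    proof (intro allI impI)
      fix r and \<epsilon> :: real assume "0 < \<epsilon>"
      then have ev: "\<forall>\<^sub>F n in sequentially. r \<le> n \<and> 1 / Suc n \<le> \<epsilon> / 3" by (intro eventually_small) simp
      show "\<forall>\<^sub>F n in sequentially. case rep_birooted (X n) of (H, w, w') \<Rightarrow>
          \<exists>f g. graph_iso (ball_net G' u' r) (ball_net H w r) f g \<and>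
            marks_within \<epsilon> (ball_net G' u' r) (ball_net H w r) f g \<and> f u' = w \<and> f v' = w'"
        using ev
      proof eventually_elim
        case (elim n)
        obtain H' w w' where H': "rep_birooted (X n) = (H', w, w')" "is_network H'"
            "w \<in> verts H'" "w' \<in> verts H'" "X n = bcls H' w w'"
          by (rule birooted_representative)
        obtain p q where pq: "network_iso (H n) H' p q" "p (f n u) = w" "p (f n v) = w'"
          by (rule bcls_eqD[OF H(1) H(2) fv H'(2-4) H'(5)[unfolded X_def]])
        have "near r \<epsilon> G' u' H' (p \<circ> f n \<circ> a) (q \<circ> g n \<circ> b)"
          by (rule near_network_iso_comp[OF G(1) H(1) G(2) H(2) H(3)])
            (use elim \<open>0 < \<epsilon>\<close> G' ab H' pq in auto)
        then show ?case
          unfolding H'(1) prod.case using ab pq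
          by (intro exI[of _ "p \<circ> f n \<circ> a"] exI[of _ "q \<circ> g n \<circ> b"])
            (simp add: near_def approx_iso_def)
      qed
    qed
    then have "\<forall>\<^sub>F n in sequentially. X n \<in> U"
      using U G(4) unfolding open_birooted_def by blast
    then show False using H(4) by (simp add: X_def)
  qed
next
  assume nbhds: ?nbhds
  show "open U"
    unfolding open_birooted_def
  proof (intro allI ballI impI)
    fix X and c :: "'x birooted" assume c: "c \<in> U" and conv: "birooted_conv X c"
    obtain G u v where G: "rep_birooted c = (G, u, v)" "is_network G"
        "u \<in> verts G" "v \<in> verts G" "c = bcls G u v"
      by (rule birooted_representative)
    then obtain r \<epsilon> where r: "\<epsilon> > 0" "v \<in> vball G u r"
      "\<And>H f g. is_network H \<Longrightarrow> f u \<in> verts H \<Longrightarrow> near r \<epsilon> G u H f g \<Longrightarrow> bcls H (f u) (f v) \<in> U"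
      using nbhds c by metis
    have "\<forall>\<^sub>F n in sequentially. case rep_birooted (X n) of (H, w, w') \<Rightarrow>
          \<exists>f g. graph_iso (ball_net G u r) (ball_net H w r) f g \<and>
            marks_within \<epsilon> (ball_net G u r) (ball_net H w r) f g \<and> f u = w \<and> f v = w'"
      using conv r(1,2) unfolding birooted_conv_def G(1) prod.case by (simp add: verts_ball_net G)
    then show "\<forall>\<^sub>F n in sequentially. X n \<in> U"
    proof eventually_elim
      case (elim n)
      obtain H w w' where H: "rep_birooted (X n) = (H, w, w')" "is_network H"
          "w \<in> verts H" "w' \<in> verts H" "X n = bcls H w w'"
        by (rule birooted_representative)
      then show ?case
        using elim r(3)[of H] by (auto simp: near_def approx_iso_def)
    qed
  qed
qed

lemma open_rooted_iff:
  fixes U :: "'x::metric_space rooted set"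
  shows "open U \<longleftrightarrow> (\<forall>G u. is_network G \<longrightarrow> u \<in> verts G \<longrightarrow> rcls G u \<in> U \<longrightarrow>
     (\<exists>r. \<exists>\<epsilon>>0. \<forall>H f g. is_network H \<longrightarrow> f u \<in> verts H \<longrightarrow> near r \<epsilon> G u H f g \<longrightarrow>
        rcls H (f u) \<in> U))" (is "_ \<longleftrightarrow> ?nbhds")
proof
  assume U: "open U"
  show ?nbhds
  proof (intro allI impI, rule ccontr)
    fix G :: "'x network" and u
    assume G: "is_network G" "u \<in> verts G" "rcls G u \<in> U"
    assume neg: "\<not> (\<exists>r. \<exists>\<epsilon>>0. \<forall>H f g. is_network H \<longrightarrow> f u \<in> verts H \<longrightarrow>
      near r \<epsilon> G u H f g \<longrightarrow> rcls H (f u) \<in> U)"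
    have "\<exists>H f g. is_network H \<and> f u \<in> verts H \<and> near n (1 / Suc n) G u H f g \<and>
        rcls H (f u) \<notin> U" for n
    proof -
      have "0 < 1 / real (Suc n)" by simp
      then show ?thesis using neg by blast
    qed
    then obtain H f g where H: "\<And>n. is_network (H n)" "\<And>n. f n u \<in> verts (H n)"
        "\<And>n. near n (1 / Suc n) G u (H n) (f n) (g n)"
        "\<And>n. rcls (H n) (f n u) \<notin> U"
      by metis
    define X where "X n = rcls (H n) (f n u)" for n
    obtain G' u' where G': "rep_rooted (rcls G u) = (G', u')" "is_network G'"
        "u' \<in> verts G'" "rcls G u = rcls G' u'"
      by (rule rooted_representative)
    obtain a b where ab: "network_iso G' G a b" "a u' = u"
      using rcls_eq_iff[OF G'(2,3) G(1,2)] G'(4) by auto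
    have "rooted_conv X (rcls G u)"
      unfolding rooted_conv_def G'(1) prod.case
    proof (intro allI impI)
      fix r and \<epsilon> :: real assume "0 < \<epsilon>"
      then have ev: "\<forall>\<^sub>F n in sequentially. r \<le> n \<and> 1 / Suc n \<le> \<epsilon> / 3" by (intro eventually_small) simp
      show "\<forall>\<^sub>F n in sequentially. case rep_rooted (X n) of (H, w) \<Rightarrow>
          \<exists>f g. graph_iso (ball_net G' u' r) (ball_net H w r) f g \<and>
            marks_within \<epsilon> (ball_net G' u' r) (ball_net H w r) f g \<and> f u' = w"
        using ev
      proof eventually_elim
        case (elim n)
        obtain H' w where H': "rep_rooted (X n) = (H', w)" "is_network H'"
            "w \<in> verts H'" "X n = rcls H' w"
          by (rule rooted_representative)
        obtain p q where pq: "network_iso (H n) H' p q" "p (f n u) = w"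
          using rcls_eq_iff[OF H(1) H(2) H'(2,3)] H'(4)[unfolded X_def] by auto
        have "near r \<epsilon> G' u' H' (p \<circ> f n \<circ> a) (q \<circ> g n \<circ> b)"
          by (rule near_network_iso_comp[OF G(1) H(1) G(2) H(2) H(3)])
            (use elim \<open>0 < \<epsilon>\<close> G' ab H' pq in auto)
        then show ?case
          unfolding H'(1) prod.case using ab pq
          by (intro exI[of _ "p \<circ> f n \<circ> a"] exI[of _ "q \<circ> g n \<circ> b"])
            (simp add: near_def approx_iso_def)
      qed
    qed
    then have "\<forall>\<^sub>F n in sequentially. X n \<in> U"
      using U G(3) unfolding open_rooted_def by blast
    then show False using H(4) by (simp add: X_def)
  qed
next
  assume nbhds: ?nbhds
  show "open U"
    unfolding open_rooted_def
  proof (intro allI ballI impI)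
    fix X and c :: "'x rooted" assume c: "c \<in> U" and conv: "rooted_conv X c"
    obtain G u where G: "rep_rooted c = (G, u)" "is_network G" "u \<in> verts G" "c = rcls G u"
      by (rule rooted_representative)
    then obtain r \<epsilon> where r: "\<epsilon> > 0"
      "\<And>H f g. is_network H \<Longrightarrow> f u \<in> verts H \<Longrightarrow> near r \<epsilon> G u H f g \<Longrightarrow> rcls H (f u) \<in> U"
      using nbhds c by metis
    have "\<forall>\<^sub>F n in sequentially. case rep_rooted (X n) of (H, w) \<Rightarrow>
          \<exists>f g. graph_iso (ball_net G u r) (ball_net H w r) f g \<and>
            marks_within \<epsilon> (ball_net G u r) (ball_net H w r) f g \<and> f u = w"
      using conv r(1) unfolding rooted_conv_def G(1) prod.case by simp
    then show "\<forall>\<^sub>F n in sequentially. X n \<in> U"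
    proof eventually_elim
      case (elim n)
      obtain H w where H: "rep_rooted (X n) = (H, w)" "is_network H" "w \<in> verts H" "X n = rcls H w"
        by (rule rooted_representative)
      then show ?case
        using elim r(2)[of H] by (auto simp: near_def approx_iso_def)
    qed
  qed
qed

section \<open>Source, target and reversal\<close>

definition src :: "'x birooted \<Rightarrow> 'x rooted" where
  "src b = (case rep_birooted b of (G, u, v) \<Rightarrow> rcls G u)"

definition flip :: "'x birooted \<Rightarrow> 'x birooted" where
  "flip b = (case rep_birooted b of (G, u, v) \<Rightarrow> bcls G v u)"

definition tgt :: "'x birooted \<Rightarrow> 'x rooted" where
  "tgt b = src (flip b)"

lemma src_bcls [simp]:
  assumes "is_network G" "u \<in> verts G" "v \<in> verts G"
  shows "src (bcls G u v) = rcls G u"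
proof -
  obtain G' u' v' where G': "rep_birooted (bcls G u v) = (G', u', v')" "is_network G'"
      "u' \<in> verts G'" "v' \<in> verts G'" "bcls G u v = bcls G' u' v'"
    by (rule birooted_representative)
  obtain f g where "network_iso G G' f g" "f u = u'"
    by (rule bcls_eqD[OF assms G'(2-5)])
  then show ?thesis using G' rcls_iso[OF assms(1) G'(2) assms(2), of f g] by (simp add: src_def)
qed

lemma flip_bcls [simp]:
  assumes "is_network G" "u \<in> verts G" "v \<in> verts G"
  shows "flip (bcls G u v) = bcls G v u"
proof -
  obtain G' u' v' where G': "rep_birooted (bcls G u v) = (G', u', v')" "is_network G'"
      "u' \<in> verts G'" "v' \<in> verts G'" "bcls G u v = bcls G' u' v'"
    by (rule birooted_representative)
  obtain f g where "network_iso G G' f g" "f u = u'" "f v = v'"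
    by (rule bcls_eqD[OF assms G'(2-5)])
  then show ?thesis using G' bcls_eqI[OF assms(1) G'(2) assms(3,2), of f g] by (simp add: flip_def)
qed

lemma tgt_bcls [simp]:
  "is_network G \<Longrightarrow> u \<in> verts G \<Longrightarrow> v \<in> verts G \<Longrightarrow> tgt (bcls G u v) = rcls G v"
  by (simp add: tgt_def)

lemma birooted_cases:
  obtains G u v where "is_network G" "u \<in> verts G" "v \<in> verts G" "b = bcls G u v"
  using birooted_representative by metis

lemma rooted_cases:
  obtains G u where "is_network G" "u \<in> verts G" "c = rcls G u"
  using rooted_representative by metis

lemma flip_flip [simp]: "flip (flip b) = b"
  by (cases b rule: birooted_cases) simp

lemma src_flip [simp]: "src (flip b) = tgt b" and tgt_flip [simp]: "tgt (flip b) = src b"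
  by (simp_all add: tgt_def)

lemma measurable_src [measurable]: "src \<in> borel \<rightarrow>\<^sub>M borel"
proof (rule borel_measurableI)
  fix U :: "'x::metric_space rooted set" assume U: "open U"
  have "open (src -` U)"
    unfolding open_birooted_iff
  proof (intro allI impI)
    fix G u v assume G: "is_network G" "u \<in> verts G" "v \<in> verts G" "bcls G u v \<in> src -` U"
    then obtain r \<epsilon> where r: "\<epsilon> > 0"
      "\<And>H f g. is_network H \<Longrightarrow> f u \<in> verts H \<Longrightarrow> near r \<epsilon> G u H f g \<Longrightarrow> rcls H (f u) \<in> U"
      using U unfolding open_rooted_iff by (metis src_bcls vimage_eq)
    obtain d where d: "v \<in> vball G u d" using vball_exhausts[OF G(1-3)] by blast
    show "\<exists>r. \<exists>\<epsilon>>0. v \<in> vball G u r \<and> (\<forall>H f g. is_network H \<longrightarrow> f u \<in> verts H \<longrightarrow>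
        near r \<epsilon> G u H f g \<longrightarrow> bcls H (f u) (f v) \<in> src -` U)"
    proof (intro exI[of _ "max d r"] exI[of _ \<epsilon>] conjI allI impI r(1))
      show dr: "v \<in> vball G u (max d r)" using d vball_mono[of d "max d r" G u] by auto
      fix H f g assume H: "is_network H" "f u \<in> verts H" "near (max d r) \<epsilon> G u H f g"
      have "near r \<epsilon> G u H f g" by (rule near_mono_radius[OF G(1) H(1) G(2) H(2,3)]) simp
      moreover have "f v \<in> verts H"
        using near_verts[OF G(1) H(1) G(2) H(2,3) dr] .
      ultimately show "bcls H (f u) (f v) \<in> src -` U" using H r(2) by simp
    qed
  qed
  then show "src -` U \<inter> space borel \<in> sets borel" by simp
qed

lemma measurable_flip [measurable]: "flip \<in> borel \<rightarrow>\<^sub>M borel"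
proof (rule borel_measurableI)
  fix U :: "'x::metric_space birooted set" assume U: "open U"
  have "open (flip -` U)"
    unfolding open_birooted_iff
  proof (intro allI impI)
    fix G u v assume G: "is_network G" "u \<in> verts G" "v \<in> verts G" "bcls G u v \<in> flip -` U"
    then have "bcls G v u \<in> U" by simp
    then obtain r \<epsilon> where r: "\<epsilon> > 0"
      "\<And>H f g. is_network H \<Longrightarrow> f v \<in> verts H \<Longrightarrow> near r \<epsilon> G v H f g \<Longrightarrow> bcls H (f v) (f u) \<in> U"
      using U G(1-3) unfolding open_birooted_iff by metis
    obtain d where d: "v \<in> vball G u d" using vball_exhausts[OF G(1-3)] by blast
    show "\<exists>r. \<exists>\<epsilon>>0. v \<in> vball G u r \<and> (\<forall>H f g. is_network H \<longrightarrow> f u \<in> verts H \<longrightarrow>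
        near r \<epsilon> G u H f g \<longrightarrow> bcls H (f u) (f v) \<in> flip -` U)"
    proof (intro exI[of _ "d + r"] exI[of _ \<epsilon>] conjI allI impI r(1))
      show dr: "v \<in> vball G u (d + r)" using d vball_mono[of d "d + r" G u] by auto
      fix H f g assume H: "is_network H" "f u \<in> verts H" "near (d + r) \<epsilon> G u H f g"
      have "near r \<epsilon> G v H f g" by (rule near_reroot[OF G(1) H(1) G(2) H(2,3) d]) simp
      moreover have "f v \<in> verts H"
        using near_verts[OF G(1) H(1) G(2) H(2,3) dr] .
      ultimately show "bcls H (f u) (f v) \<in> flip -` U" using H r(2) by simp
    qed
  qed
  then show "flip -` U \<inter> space borel \<in> sets borel" by simp
qed

lemma measurable_tgt [measurable]: "tgt \<in> borel \<rightarrow>\<^sub>M borel"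
  unfolding tgt_def[abs_def] by measurable

section \<open>Sums over the second root\<close>

text \<open>
  For a transport \<open>g\<close> this is the mass \<open>g\<^sup>+(o)\<close> sent by the root; the mass received is the sum of
  \<open>g \<circ> flip\<close>. Values in \<^typ>\<open>ennreal\<close> avoid all summability conditions.
\<close>

definition osum :: "('x birooted \<Rightarrow> ennreal) \<Rightarrow> 'x rooted \<Rightarrow> ennreal" where
  "osum g = at_root (\<lambda>G u. \<integral>\<^sup>+ v. g (bcls G u v) \<partial>count_space (verts G))"

lemma osum_rcls:
  assumes "is_network G" "u \<in> verts G"
  shows "osum g (rcls G u) = (\<integral>\<^sup>+ v. g (bcls G u v) \<partial>count_space (verts G))"
  unfolding osum_def
proof (rule at_root_rcls[OF assms])
  fix H f k assume H: "is_network H" "network_iso G H f k"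
  have "(\<integral>\<^sup>+ v. g (bcls H (f u) v) \<partial>count_space (verts H)) =
      (\<integral>\<^sup>+ v. g (bcls H (f u) (f v)) \<partial>count_space (verts G))"
    by (rule nn_integral_bij_count_space[OF network_iso_bij[OF H(2)], symmetric])
  also have "\<dots> = (\<integral>\<^sup>+ v. g (bcls G u v) \<partial>count_space (verts G))"
    using bcls_eqI[OF assms(1) H(1) assms(2) _ H(2)] by (intro nn_integral_cong) simp
  finally show "(\<integral>\<^sup>+ v. g (bcls H (f u) v) \<partial>count_space (verts H)) =
      (\<integral>\<^sup>+ v. g (bcls G u v) \<partial>count_space (verts G))" .
qed

lemma osum_cong: "(\<And>b. src b = c \<Longrightarrow> g b = g' b) \<Longrightarrow> osum g c = osum g' c"
  by (cases c rule: rooted_cases) (auto simp: osum_rcls intro!: nn_integral_cong)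

lemma osum_mono: "(\<And>b. src b = c \<Longrightarrow> g b \<le> g' b) \<Longrightarrow> osum g c \<le> osum g' c"
  by (cases c rule: rooted_cases) (auto simp: osum_rcls intro!: nn_integral_mono)

lemma osum_add: "osum (\<lambda>b. g b + g' b) c = osum g c + osum g' c"
  by (cases c rule: rooted_cases) (auto simp: osum_rcls nn_integral_add)

lemma osum_cmult: "osum (\<lambda>b. a * g b) c = a * osum g c"
  by (cases c rule: rooted_cases) (auto simp: osum_rcls nn_integral_cmult)

lemma osum_src_mult: "osum (\<lambda>b. \<phi> (src b) * g b) c = \<phi> c * osum g c"
  using osum_cong[of c "\<lambda>b. \<phi> (src b) * g b" "\<lambda>b. \<phi> c * g b"] by (simp add: osum_cmult)

lemma osum_suminf: "osum (\<lambda>b. \<Sum>n. g n b) c = (\<Sum>n. osum (g n) c)"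
  by (cases c rule: rooted_cases) (auto simp: osum_rcls nn_integral_suminf)

lemma osum_SUP: "incseq g \<Longrightarrow> osum (\<lambda>b. SUP n. g n b) c = (SUP n. osum (g n) c)"
  by (cases c rule: rooted_cases)
    (auto simp: osum_rcls incseq_def le_fun_def intro!: nn_integral_monotone_convergence_SUP)

lemma osum_ge: "src b = c \<Longrightarrow> g b \<le> osum g c"
proof -
  assume "src b = c"
  obtain G u v where b: "is_network G" "u \<in> verts G" "v \<in> verts G" "b = bcls G u v"
    by (rule birooted_cases)
  have "g (bcls G u v) = (\<integral>\<^sup>+ w. g (bcls G u w) * indicator {v} w \<partial>count_space (verts G))"
    using b by (subst nn_integral_indicator_singleton) auto
  also have "\<dots> \<le> osum g (rcls G u)"
    unfolding osum_rcls[OF b(1,2)] by (intro nn_integral_mono) (auto split: split_indicator)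
  finally show ?thesis using b \<open>src b = c\<close> by simp
qed

lemma osum_eq_0_iff: "osum g c = 0 \<longleftrightarrow> (\<forall>b. src b = c \<longrightarrow> g b = 0)"
proof
  show "osum g c = 0 \<Longrightarrow> \<forall>b. src b = c \<longrightarrow> g b = 0"
    using osum_ge[of _ c g] by (metis le_zero_eq)
  show "\<forall>b. src b = c \<longrightarrow> g b = 0 \<Longrightarrow> osum g c = 0"
    using osum_cong[of c g "\<lambda>_. 0 * 0"] by (simp only: osum_cmult) simp
qed

text \<open>
  Both sides are the sum of \<open>\<phi>\<close> over all vertices of one network. This is the source of
  root-independent measurable functions.
\<close>

lemma osum_tgt: "osum (\<lambda>b. \<phi> (tgt b)) (src b') = osum (\<lambda>b. \<phi> (tgt b)) (tgt b')"
  by (cases b' rule: birooted_cases)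
    (auto simp: osum_rcls intro!: nn_integral_cong)

lemma osum_indicator:
  assumes "is_network G" "u \<in> verts G"
  shows "osum (indicator A) (rcls G u) = emeasure (count_space (verts G)) {v \<in> verts G. bcls G u v \<in> A}"
proof -
  have "osum (indicator A) (rcls G u) =
      (\<integral>\<^sup>+ v. indicator {v \<in> verts G. bcls G u v \<in> A} v \<partial>count_space (verts G))"
    unfolding osum_rcls[OF assms] by (intro nn_integral_cong) (auto split: split_indicator)
  then show ?thesis by simp
qed

text \<open>
  Finitely many second roots can be controlled by one ball, because radius and accuracy may be taken
  as the maximum and the minimum of the individual ones.
\<close>

lemma finite_open_birooted:
  fixes U :: "'x::metric_space birooted set"
  assumes G: "is_network G" "u \<in> verts G" and U: "open U"
    and F: "finite F" "F \<subseteq> {v \<in> verts G. bcls G u v \<in> U}"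
  shows "\<exists>R. \<exists>\<epsilon>>0. F \<subseteq> vball G u R \<and> (\<forall>H f g. is_network H \<longrightarrow> f u \<in> verts H \<longrightarrow> near R \<epsilon> G u H f g \<longrightarrow>
    (\<forall>v\<in>F. bcls H (f u) (f v) \<in> U))"
  using F
proof (induction F rule: finite_induct)
  case empty
  show ?case by (intro exI[of _ 0] exI[of _ "1::real"]) simp
next
  case (insert v F)
  have "F \<subseteq> {v \<in> verts G. bcls G u v \<in> U}" using insert.prems by simp
  from insert.IH[OF this] obtain R \<epsilon> where R: "\<epsilon> > 0" "F \<subseteq> vball G u R"
    "\<And>H f g. is_network H \<Longrightarrow> f u \<in> verts H \<Longrightarrow> near R \<epsilon> G u H f g \<Longrightarrow> \<forall>v\<in>F. bcls H (f u) (f v) \<in> U"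
    by blast
  have v: "v \<in> verts G" "bcls G u v \<in> U" using insert.prems by auto
  obtain r \<delta> where r: "\<delta> > 0" "v \<in> vball G u r"
    "\<And>H f g. is_network H \<Longrightarrow> f u \<in> verts H \<Longrightarrow> near r \<delta> G u H f g \<Longrightarrow> bcls H (f u) (f v) \<in> U"
    using U[unfolded open_birooted_iff, rule_format, OF G v] by blast
  have near: "near R \<epsilon> G u H f g" "near r \<delta> G u H f g"
    if "is_network H" "f u \<in> verts H" "near (max R r) (min \<epsilon> \<delta>) G u H f g" for H f g
  proof -
    have "near R (min \<epsilon> \<delta>) G u H f g" "near r (min \<epsilon> \<delta>) G u H f g"
      using near_mono_radius[OF G(1) that(1) G(2) that(2,3)] by simp_all
    then show "near R \<epsilon> G u H f g" "near r \<delta> G u H f g"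
      by (auto elim: near_mono_eps)
  qed
  show ?case
  proof (intro exI[of _ "max R r"] exI[of _ "min \<epsilon> \<delta>"] conjI allI impI)
    show "0 < min \<epsilon> \<delta>" using R(1) r(1) by simp
    show "insert v F \<subseteq> vball G u (max R r)"
      using R(2) r(2) vball_mono[of R "max R r" G u] vball_mono[of r "max R r" G u] by auto
    fix H f g assume H: "is_network H" "f u \<in> verts H" "near (max R r) (min \<epsilon> \<delta>) G u H f g"
    show "\<forall>w\<in>insert v F. bcls H (f u) (f w) \<in> U"
      using R(3)[OF H(1,2) near(1)[OF H]] r(3)[OF H(1,2) near(2)[OF H]] by blast
  qed
qed

text \<open>
  Lower semicontinuity: finitely many second roots that witness a sum above \<open>q\<close> are carried injectively
  to witnesses in every network with a sufficiently similar ball.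
\<close>

lemma open_osum_gt:
  fixes U :: "'x::metric_space birooted set"
  assumes U: "open U"
  shows "open {c. q < osum (indicator U) c}"
  unfolding open_rooted_iff
proof (intro allI impI)
  fix G :: "'x network" and u
  assume G: "is_network G" "u \<in> verts G" and "rcls G u \<in> {c. q < osum (indicator U) c}"
  let ?V = "{v \<in> verts G. bcls G u v \<in> U}"
  have q: "q < emeasure (count_space (verts G)) ?V"
    using \<open>rcls G u \<in> _\<close> by (simp add: osum_indicator G)
  have "\<exists>F \<subseteq> ?V. finite F \<and> q < of_nat (card F)"
  proof (cases "finite ?V")
    case True then show ?thesis using q by (intro exI[of _ ?V]) simp
  next
    case False
    have "q < top" using q by (rule less_le_trans) simp
    then obtain n where "q < of_nat n" using ennreal_Ex_less_of_nat by blast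
    then show ?thesis using infinite_arbitrarily_large[OF False, of n] by blast
  qed
  then obtain F where F: "F \<subseteq> ?V" "finite F" "q < of_nat (card F)" by blast
  obtain R \<epsilon> where R: "\<epsilon> > 0" "F \<subseteq> vball G u R"
    "\<And>H f g. is_network H \<Longrightarrow> f u \<in> verts H \<Longrightarrow> near R \<epsilon> G u H f g \<Longrightarrow> \<forall>v\<in>F. bcls H (f u) (f v) \<in> U"
    using finite_open_birooted[OF G U F(2,1)] by blast
  show "\<exists>r. \<exists>\<epsilon>>0. \<forall>H f g. is_network H \<longrightarrow> f u \<in> verts H \<longrightarrow> near r \<epsilon> G u H f g \<longrightarrow>
      rcls H (f u) \<in> {c. q < osum (indicator U) c}"
  proof (intro exI[of _ R] exI[of _ \<epsilon>] conjI allI impI R(1))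
    fix H f g assume H: "is_network H" "f u \<in> verts H" "near R \<epsilon> G u H f g"
    have inj: "inj_on f F" using near_inj[OF G H(3)] R(2) by (rule inj_on_subset)
    have "f ` F \<subseteq> {w \<in> verts H. bcls H (f u) w \<in> U}"
      using R(3)[OF H] near_verts[OF G(1) H(1) G(2) H(2,3)] R(2) by auto
    then have "emeasure (count_space (verts H)) (f ` F) \<le> osum (indicator U) (rcls H (f u))"
      unfolding osum_indicator[OF H(1,2)] by (intro emeasure_mono) auto
    moreover have "emeasure (count_space (verts H)) (f ` F) = of_nat (card F)"
      using F(2) near_verts[OF G(1) H(1) G(2) H(2,3)] R(2) inj
      by (subst emeasure_count_space_finite) (auto simp: card_image)
    ultimately show "rcls H (f u) \<in> {c. q < osum (indicator U) c}" using F(3) by auto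
  qed
qed

text \<open>
  Counts of second roots at bounded distance are finite, so that complements can be handled by
  subtraction.
\<close>

definition reach :: "nat \<Rightarrow> 'x birooted set" where
  "reach r = {b. \<exists>G u v. is_network G \<and> u \<in> verts G \<and> v \<in> vball G u r \<and> b = bcls G u v}"

lemma bcls_reach:
  fixes G :: "'x::metric_space network"
  assumes "is_network G" "u \<in> verts G" "v \<in> verts G"
  shows "bcls G u v \<in> reach r \<longleftrightarrow> v \<in> vball G u r"
proof
  assume "bcls G u v \<in> reach r"
  then obtain H u' v' where H: "is_network H" "u' \<in> verts H" "v' \<in> vball H u' r" "bcls G u v = bcls H u' v'"
    by (auto simp: reach_def)
  have v': "v' \<in> verts H" using vball_subset[OF H(1,2)] H(3) by auto
  obtain f g where f: "network_iso H G f g" "f u' = u" "f v' = v"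
    by (rule bcls_eqD[OF H(1,2) v' assms H(4)[symmetric]])
  have "near r 1 H u' G f g" by (rule near_network_iso) (use H assms f in auto)
  then have "f ` vball H u' r = vball G (f u') r"
    by (intro near_vball[of H G u' f r 1 g r]) (use H assms f in auto)
  then show "v \<in> vball G u r" using H(3) f by auto
qed (use assms in \<open>auto simp: reach_def\<close>)

lemma open_reach: "open (reach r :: 'x::metric_space birooted set)"
  unfolding open_birooted_iff
proof (intro allI impI)
  fix G :: "'x network" and u v
  assume G: "is_network G" "u \<in> verts G" "v \<in> verts G" "bcls G u v \<in> reach r"
  then have v: "v \<in> vball G u r" by (simp add: bcls_reach)
  show "\<exists>r'. \<exists>\<epsilon>>0. v \<in> vball G u r' \<and> (\<forall>H f g. is_network H \<longrightarrow> f u \<in> verts H \<longrightarrow>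
      near r' \<epsilon> G u H f g \<longrightarrow> bcls H (f u) (f v) \<in> reach r)"
  proof (intro exI[of _ r] exI[of _ 1] conjI allI impI v)
    fix H f g assume H: "is_network H" "f u \<in> verts H" "near r 1 G u H f g"
    have "f v \<in> vball H (f u) r" using near_vball[OF G(1) H(1) G(2) H(2,3) order_refl] v by auto
    then show "bcls H (f u) (f v) \<in> reach r" using H by (auto simp: reach_def)
  qed simp
qed

lemma sets_reach [measurable]: "reach r \<in> sets borel"
  by (rule borel_open[OF open_reach])

lemma reach_mono: "r \<le> R \<Longrightarrow> reach r \<subseteq> reach R"
  unfolding reach_def using vball_mono by blast

lemma reach_exhausts: "\<exists>r. (b :: 'x::metric_space birooted) \<in> reach r"
  by (cases b rule: birooted_cases) (use vball_exhausts in \<open>auto simp: bcls_reach\<close>)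

lemma osum_reach_finite: "osum (indicator (reach r)) (c :: 'x::metric_space rooted) < \<infinity>"
proof -
  obtain G u where c: "is_network G" "u \<in> verts G" "c = rcls G u" by (rule rooted_cases)
  have eq: "{v \<in> verts G. bcls G u v \<in> reach r} = vball G u r"
    using bcls_reach[OF c(1,2)] vball_subset[OF c(1,2), of r] by blast
  show ?thesis
    unfolding c(3) osum_indicator[OF c(1,2)] eq
    using vball_finite[OF c(1,2)] vball_subset[OF c(1,2)] by (subst emeasure_count_space_finite) (auto simp: of_nat_less_top)
qed

lemma measurable_osum_open: "open U \<Longrightarrow> osum (indicator U) \<in> borel_measurable borel"
  using open_osum_gt by (intro borel_measurableI_greater) (auto intro: borel_open)

text \<open>
  Open sets form a generating class stable under intersections. The counts restricted to
  \<^term>\<open>reach r\<close> are finite, so the good sets form a Dynkin system, and \<open>r\<close> tends to infinity at the end.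
\<close>

lemma measurable_osum_indicator:
  fixes A :: "'x::metric_space birooted set"
  assumes "A \<in> sets borel"
  shows "osum (indicator A) \<in> borel_measurable borel"
proof -
  have fin: "osum (indicator (A \<inter> reach r)) \<in> borel_measurable borel" for r
  proof -
    have "Int_stable {S :: 'x birooted set. open S}" by (auto simp: Int_stable_def)
    moreover have "{S :: 'x birooted set. open S} \<subseteq> Pow UNIV" by simp
    moreover have "A \<in> sigma_sets UNIV {S. open S}" using assms by (simp add: borel_def)
    ultimately show ?thesis
    proof (induction A rule: sigma_sets_induct_disjoint)
      case (basic A)
      then show ?case by (intro measurable_osum_open open_Int open_reach) simp
    next
      case empty
      have "osum (indicator ({} \<inter> reach r)) = (\<lambda>c :: 'x rooted. 0)"
        by (rule ext) (simp add: osum_eq_0_iff)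
      then show ?case by (simp only: borel_measurable_const)
    next
      case (compl A)
      have "osum (indicator ((UNIV - A) \<inter> reach r)) c =
          osum (indicator (reach r)) c - osum (indicator (A \<inter> reach r)) c" for c :: "'x rooted"
      proof -
        have "osum (indicator (reach r)) c =
            osum (indicator ((UNIV - A) \<inter> reach r)) c + osum (indicator (A \<inter> reach r)) c"
          unfolding osum_add[symmetric] by (intro osum_cong) (auto split: split_indicator)
        moreover have "osum (indicator (A \<inter> reach r)) c \<le> osum (indicator (reach r)) c"
          by (intro osum_mono) (auto split: split_indicator)
        moreover have "osum (indicator (A \<inter> reach r)) c \<noteq> top"
          using calculation osum_reach_finite[of r c] by (auto simp: top_unique)
        ultimately show ?thesis by simp
      qed
      then show ?case
        using borel_measurable_minus_ennreal[OF measurable_osum_open[OF open_reach, of r] compl(2)] by simp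
    next
      case (union A)
      have "osum (indicator ((\<Union>i. A i) \<inter> reach r)) c = (\<Sum>i. osum (indicator (A i \<inter> reach r)) c)"
        for c :: "'x rooted"
      proof -
        have "(\<Sum>i. indicator (A i \<inter> reach r) b) = (indicator ((\<Union>i. A i) \<inter> reach r) b :: ennreal)" for b
        proof -
          have "disjoint_family (\<lambda>i. A i \<inter> reach r)" using union(1) by (auto simp: disjoint_family_on_def)
          from suminf_indicator[OF this, of b] show ?thesis by simp
        qed
        then show ?thesis by (simp add: osum_suminf[symmetric])
      qed
      then have "osum (indicator ((\<Union>i. A i) \<inter> reach r)) = (\<lambda>c. \<Sum>i. osum (indicator (A i \<inter> reach r)) c)"
        by (simp add: fun_eq_iff)
      then show ?case using union(3) by simp
    qed
  qed
  have "osum (indicator A) c = (SUP r. osum (indicator (A \<inter> reach r)) c)" for c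
  proof -
    have "(SUP r. indicator (A \<inter> reach r) b) = (indicator A b :: ennreal)" for b
    proof -
      obtain r where "b \<in> reach r" using reach_exhausts by blast
      then show ?thesis
        by (intro antisym SUP_least SUP_upper2[of r]) (auto split: split_indicator)
    qed
    moreover have "incseq (\<lambda>r. indicator (A \<inter> reach r) :: _ \<Rightarrow> ennreal)"
      using reach_mono by (auto simp: incseq_def le_fun_def split: split_indicator)
    ultimately show ?thesis by (simp add: osum_SUP[symmetric])
  qed
  then have "osum (indicator A) = (\<lambda>c. SUP r. osum (indicator (A \<inter> reach r)) c)" by (simp add: fun_eq_iff)
  then show ?thesis using fin by simp
qed

lemma measurable_osum [measurable]:
  fixes g :: "'x::metric_space birooted \<Rightarrow> ennreal"
  assumes "g \<in> borel_measurable borel"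
  shows "osum g \<in> borel_measurable borel"
  using assms
proof (induction g rule: borel_measurable_induct)
  case (cong f g)
  then show ?case by (metis UNIV_I ext space_borel)
next
  case (set A) then show ?case by (rule measurable_osum_indicator)
next
  case (mult u c) then show ?case by (simp add: osum_cmult[abs_def])
next
  case (add u v) then show ?case by (simp add: osum_add[abs_def])
next
  case (seq U)
  have eq: "(SUP i. U i) = (\<lambda>b. SUP i. U i b)" by (rule ext) (simp add: image_comp)
  have "osum (SUP i. U i) = (\<lambda>c. SUP i. osum (U i) c)"
    unfolding eq by (rule ext) (rule osum_SUP[OF seq(3)])
  then show ?case using seq by (simp only:) (auto intro!: borel_measurable_SUP)
qed

text \<open>
  Choosing a radius \<open>n\<close> with probability \<open>2^-(n+1)\<close> and then a uniform vertex of the ball of that radius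
  gives a positive kernel with row sums 1; the minimum with its reversal bounds the column sums as well.
\<close>

lemma positive_substochastic_kernel:
  obtains h :: "'x::metric_space birooted \<Rightarrow> ennreal" where
    "h \<in> borel_measurable borel" "\<And>b. 0 < h b" "\<And>c. osum h c \<le> 1" "\<And>c. osum (\<lambda>b. h (flip b)) c \<le> 1"
proof -
  define B :: "nat \<Rightarrow> 'x rooted \<Rightarrow> ennreal" where "B n = osum (indicator (reach n))" for n
  have [measurable]: "B n \<in> borel_measurable borel" for n unfolding B_def by measurable
  define a :: "'x birooted \<Rightarrow> ennreal" where
    "a b = (\<Sum>n. inverse (B n (src b)) * (ennreal ((1/2) ^ Suc n) * indicator (reach n) b))" for b
  have [measurable]: "a \<in> borel_measurable borel" unfolding a_def[abs_def] by measurable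
  have B_fin: "B n c < \<infinity>" for n c unfolding B_def by (rule osum_reach_finite)
  have a_pos: "0 < a b" for b
  proof -
    obtain n where "b \<in> reach n" using reach_exhausts by blast
    then have "0 < inverse (B n (src b)) * (ennreal ((1/2) ^ Suc n) * indicator (reach n) b)"
      using B_fin[of n "src b"] by (simp add: ennreal_zero_less_mult_iff ennreal_inverse_positive)
    also have "\<dots> \<le> a b" unfolding a_def
      using sum_le_suminf[of "\<lambda>n. inverse (B n (src b)) * (ennreal ((1/2) ^ Suc n) * indicator (reach n) b)" "{n}"] by simp
    finally show ?thesis .
  qed
  have a_sum: "osum a c \<le> 1" for c
  proof -
    have "osum a c = (\<Sum>n. inverse (B n c) * (ennreal ((1/2) ^ Suc n) * B n c))"
      unfolding a_def[abs_def] osum_suminf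
      by (simp only: osum_src_mult[of "\<lambda>c. inverse (B n c)" for n] osum_cmult B_def[symmetric])
    also have "\<dots> \<le> (\<Sum>n. ennreal ((1/2) ^ Suc n))"
    proof (intro suminf_le allI)
      fix n
      have "inverse (B n c) * B n c \<le> 1"
        using B_fin[of n c] ennreal_divide_self[of "B n c"]
        by (cases "B n c = 0") (auto simp: divide_ennreal_def mult.commute)
      from mult_left_mono[OF this, of "ennreal ((1/2) ^ Suc n)"]
      show "inverse (B n c) * (ennreal ((1/2) ^ Suc n) * B n c) \<le> ennreal ((1/2) ^ Suc n)" by (simp add: ac_simps)
    qed auto
    also have "\<dots> = ennreal 1" by (rule suminf_ennreal_eq[OF _ power_half_series]) simp
    finally show ?thesis by simp
  qed
  show thesis
  proof (rule that[of "\<lambda>b. min (a b) (a (flip b))"])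
    show "osum (\<lambda>b. min (a b) (a (flip b))) c \<le> 1" for c
      by (rule order_trans[OF osum_mono a_sum]) simp
    show "osum (\<lambda>b. min (a (flip b)) (a (flip (flip b)))) c \<le> 1" for c
      by (rule order_trans[OF osum_mono a_sum]) simp
  qed (use a_pos in simp_all)
qed

section \<open>Mass transport and invariance\<close>

lemma at_root_out_mass_osum: "at_root (out_mass g) = osum (\<lambda>b. ennreal (g b))"
  by (simp add: osum_def out_mass_def[abs_def])

lemma at_root_in_mass_osum: "at_root (in_mass g) = osum (\<lambda>b. ennreal (g (flip b)))"
proof
  fix c :: "'a rooted"
  obtain G u where c: "is_network G" "u \<in> verts G" "c = rcls G u" by (rule rooted_cases)
  show "at_root (in_mass g) c = osum (\<lambda>b. ennreal (g (flip b))) c"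
    using c by (auto simp: at_root_in_mass osum_rcls in_mass_def intro!: nn_integral_cong)
qed

text \<open>
  Mass transport is assumed for real-valued transports only. Truncation at \<open>n\<close> and monotone convergence
  extend it to infinite values, which lets it be applied to products with densities. The weight \<open>k\<close>
  will be the indicator of the target lying in \<open>S\<close>.
\<close>

lemma osum_transport_ennreal:
  fixes N :: "'x::metric_space rooted measure"
  assumes sets: "sets N = sets borel" and [measurable]: "k \<in> borel_measurable borel"
    and real: "\<And>g. transport g \<Longrightarrow> (\<integral>\<^sup>+ c. osum (\<lambda>b. k b * ennreal (g b)) c \<partial>N) =
      (\<integral>\<^sup>+ c. osum (\<lambda>b. k b * ennreal (g (flip b))) c \<partial>N)"
    and [measurable]: "g \<in> borel_measurable borel"
  shows "(\<integral>\<^sup>+ c. osum (\<lambda>b. k b * g b) c \<partial>N) = (\<integral>\<^sup>+ c. osum (\<lambda>b. k b * g (flip b)) c \<partial>N)"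
proof -
  note sets[measurable_cong]
  define t where "t n b = enn2real (min (g b) (of_nat n))" for n b
  have t: "ennreal (t n b) = min (g b) (of_nat n)" for n b
    unfolding t_def by (rule ennreal_enn2real) (simp add: min_less_iff_disj of_nat_less_top)
  have [measurable]: "t n \<in> borel_measurable borel" for n unfolding t_def[abs_def] by measurable
  have tr: "transport (t n)" for n by (simp add: transport_def t_def)
  have sup: "(SUP n. ennreal (t n b)) = g b" for b
  proof -
    have "(SUP n. min (g b) (of_nat n)) = min (g b) (SUP n. of_nat n)"
      using inf_SUP[of "g b" "of_nat :: nat \<Rightarrow> ennreal" UNIV] by (simp add: inf_min)
    then show ?thesis by (simp add: t ennreal_SUP_of_nat_eq_top)
  qed
  have mono: "incseq (\<lambda>n b. k b * ennreal (t n (\<sigma> b)))" for \<sigma>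
    unfolding incseq_def le_fun_def t by (auto intro!: mult_left_mono min.mono of_nat_mono)
  have lim: "(\<integral>\<^sup>+ c. osum (\<lambda>b. k b * g (\<sigma> b)) c \<partial>N) =
      (SUP n. \<integral>\<^sup>+ c. osum (\<lambda>b. k b * ennreal (t n (\<sigma> b))) c \<partial>N)"
    if [measurable]: "\<sigma> \<in> borel \<rightarrow>\<^sub>M borel" for \<sigma>
  proof -
    have "osum (\<lambda>b. k b * g (\<sigma> b)) c = (SUP n. osum (\<lambda>b. k b * ennreal (t n (\<sigma> b))) c)" for c
      unfolding osum_SUP[OF mono, symmetric] sup[symmetric] SUP_mult_left_ennreal ..
    then have "(\<integral>\<^sup>+ c. osum (\<lambda>b. k b * g (\<sigma> b)) c \<partial>N) =
        (\<integral>\<^sup>+ c. (SUP n. osum (\<lambda>b. k b * ennreal (t n (\<sigma> b))) c) \<partial>N)" by simp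
    also have "\<dots> = (SUP n. \<integral>\<^sup>+ c. osum (\<lambda>b. k b * ennreal (t n (\<sigma> b))) c \<partial>N)"
    proof (rule nn_integral_monotone_convergence_SUP)
      show "incseq (\<lambda>n. osum (\<lambda>b. k b * ennreal (t n (\<sigma> b))))"
        using mono by (auto simp: incseq_def le_fun_def intro!: osum_mono)
    qed measurable
    finally show ?thesis .
  qed
  show ?thesis
    using lim[of "\<lambda>b. b"] lim[of flip] real[OF tr] by simp
qed

lemma unimodular_transport:
  assumes "unimodular N" "g \<in> borel_measurable borel"
  shows "(\<integral>\<^sup>+ c. osum g c \<partial>N) = (\<integral>\<^sup>+ c. osum (\<lambda>b. g (flip b)) c \<partial>N)"
  using osum_transport_ennreal[of N "\<lambda>_. 1" g] assms
  by (simp add: unimodular_def random_rooted_network_def at_root_out_mass_osum at_root_in_mass_osum)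

lemma in_invariant_field_iff:
  "A \<in> sets invariant_field \<longleftrightarrow> A \<in> sets borel \<and> (\<forall>b. src b \<in> A \<longrightarrow> tgt b \<in> A)"
proof -
  have "(\<forall>b. src b \<in> A \<longrightarrow> tgt b \<in> A) \<longleftrightarrow> (\<forall>G u v. is_network G \<longrightarrow> u \<in> verts G \<longrightarrow> v \<in> verts G \<longrightarrow>
        rcls G u \<in> A \<longrightarrow> rcls G v \<in> A)"
    by (metis birooted_cases src_bcls tgt_bcls)
  then show ?thesis by (simp add: sets_invariant_field)
qed

lemma root_independent_iff: "root_independent w \<longleftrightarrow> (\<forall>b. w (src b) = w (tgt b))"
  unfolding root_independent_def by (metis birooted_cases src_bcls tgt_bcls)

lemma root_independent_tgt: "root_independent w \<Longrightarrow> w (tgt b) = w (src b)"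
  by (simp add: root_independent_iff)

text \<open>
  The weakest root-independent property that implies \<open>Q\<close>.
\<close>

definition everywhere :: "('x rooted \<Rightarrow> bool) \<Rightarrow> 'x rooted \<Rightarrow> bool" where
  "everywhere Q c \<longleftrightarrow> (\<forall>b. src b = c \<longrightarrow> Q (tgt b))"

lemma everywhere_iff_osum: "everywhere Q c \<longleftrightarrow> osum (\<lambda>b. indicator {d. \<not> Q d} (tgt b)) c = 0"
  by (auto simp: everywhere_def osum_eq_0_iff indicator_eq_0_iff)

lemma everywhere_root_independent: "root_independent (everywhere Q)"
  unfolding root_independent_iff everywhere_iff_osum by (simp only: osum_tgt simp_thms)

lemma everywhereD: "everywhere Q c \<Longrightarrow> Q c"
proof -
  obtain G u where c: "is_network G" "u \<in> verts G" "c = rcls G u" by (rule rooted_cases)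
  then show "everywhere Q c \<Longrightarrow> Q c" unfolding everywhere_def by (metis src_bcls tgt_bcls)
qed

lemma everywhere_tgt: "everywhere Q (src b) \<Longrightarrow> Q (tgt b)"
  by (auto simp: everywhere_def)

lemma sets_everywhere [measurable]:
  fixes Q :: "'x::metric_space rooted \<Rightarrow> bool"
  assumes [measurable]: "Measurable.pred borel Q"
  shows "Measurable.pred borel (everywhere Q)"
  unfolding everywhere_iff_osum[abs_def] by measurable

section \<open>The root-independent density\<close>

text \<open>
  The situation of the theorem without the subset \<open>S\<close> itself: \<open>R\<close> is the event that the root belongs
  to \<open>S\<close>, and \<open>M\<close> and \<open>M'\<close> are the laws of the extension and of a unimodularization. Mutual absolute
  continuity of the laws of the unrooted networks becomes the statement that both measures have the
  same invariant null events.
\<close>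

locale unimodular_pair =
  fixes M M' :: "'x::metric_space rooted measure" and R :: "'x rooted set"
  assumes unimodular: "unimodular M'"
    and random: "random_rooted_network M"
    and R [measurable]: "R \<in> sets borel"
    and AE_R: "AE c in M. c \<in> R"
    and transport_R: "\<And>g. g \<in> borel_measurable borel \<Longrightarrow>
      (\<integral>\<^sup>+ c. osum (\<lambda>b. indicator R (tgt b) * g b) c \<partial>M) =
      (\<integral>\<^sup>+ c. osum (\<lambda>b. indicator R (tgt b) * g (flip b)) c \<partial>M)"
    and equivalent: "\<And>A. A \<in> sets invariant_field \<Longrightarrow> emeasure M A = 0 \<longleftrightarrow> emeasure M' A = 0"
begin

lemma sets_M [measurable_cong]: "sets M = sets borel" and sets_M' [measurable_cong]: "sets M' = sets borel"
  using unimodular random by (auto simp: unimodular_def random_rooted_network_def)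

lemma space_M [simp]: "space M = UNIV" and space_M' [simp]: "space M' = UNIV"
  using sets_eq_imp_space_eq[OF sets_M] sets_eq_imp_space_eq[OF sets_M'] by simp_all

sublocale M: prob_space M
  using random by (simp add: random_rooted_network_def)

sublocale M': prob_space M'
  using unimodular by (simp add: unimodular_def random_rooted_network_def)

lemma mass_transport: "g \<in> borel_measurable borel \<Longrightarrow>
    (\<integral>\<^sup>+ c. osum g c \<partial>M') = (\<integral>\<^sup>+ c. osum (\<lambda>b. g (flip b)) c \<partial>M')"
  by (rule unimodular_transport[OF unimodular])

text \<open>
  Every vertex sends mass 1 to each vertex where \<open>Q\<close> fails. The mass sent equals in expectation the
  mass received, and almost surely the root receives none.
\<close>

lemma AE_everywhere:
  assumes [measurable]: "Measurable.pred borel Q" and Q: "AE c in M'. Q c"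
  shows "AE c in M'. everywhere Q c"
proof -
  let ?N = "{d. \<not> Q d}"
  have "(\<integral>\<^sup>+ c. osum (\<lambda>b. indicator ?N (tgt b)) c \<partial>M') = (\<integral>\<^sup>+ c. osum (\<lambda>b. indicator ?N (src b) * 1) c \<partial>M')"
    using mass_transport[of "\<lambda>b. indicator ?N (tgt b)"] by simp
  also have "\<dots> = (\<integral>\<^sup>+ c. indicator ?N c * osum (\<lambda>b. 1) c \<partial>M')"
    by (simp only: osum_src_mult[of "indicator ?N"])
  also have "\<dots> = (\<integral>\<^sup>+ c. 0 \<partial>M')"
    using Q by (intro nn_integral_cong_AE) (auto elim!: eventually_mono)
  finally have "(\<integral>\<^sup>+ c. osum (\<lambda>b. indicator ?N (tgt b)) c \<partial>M') = 0" by simp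
  then have "AE c in M'. osum (\<lambda>b. indicator ?N (tgt b)) c = 0"
    by (rule nn_integral_0_iff_AE[THEN iffD1, rotated]) measurable
  then show ?thesis by (simp add: everywhere_iff_osum)
qed

text \<open>
  The link between \<open>M\<close> and \<open>M'\<close>. Combined with \<^const>\<open>everywhere\<close>, it carries every
  measurable property that is almost sure under \<open>M'\<close> over to \<open>M\<close>.
\<close>

lemma AE_transfer:
  assumes [measurable]: "Measurable.pred borel Q" and Q: "root_independent Q"
  shows "(AE c in M. Q c) \<longleftrightarrow> (AE c in M'. Q c)"
proof -
  have "{c. \<not> Q c} \<in> sets invariant_field"
    using Q by (auto simp: in_invariant_field_iff root_independent_iff)
  then have "emeasure M {c. \<not> Q c} = 0 \<longleftrightarrow> emeasure M' {c. \<not> Q c} = 0" by (rule equivalent)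
  then show ?thesis by (subst (1 2) AE_iff_measurable[OF _ refl]) simp_all
qed

lemma AE_everywhere_iff:
  assumes [measurable]: "Measurable.pred borel Q"
  shows "(AE c in M. everywhere Q c) \<longleftrightarrow> (AE c in M'. everywhere Q c)"
  by (rule AE_transfer) (simp_all add: everywhere_root_independent)

lemma AE_M_everywhere:
  assumes "Measurable.pred borel Q" and "AE c in M'. Q c"
  shows "AE c in M. everywhere Q c"
  using AE_everywhere_iff[OF assms(1)] AE_everywhere[OF assms] by simp

lemma absolutely_continuous: "absolutely_continuous M' M"
  unfolding absolutely_continuous_def
proof
  fix N assume N: "N \<in> null_sets M'"
  then have [measurable]: "N \<in> sets borel" by (auto simp: null_sets_def sets_M')
  have "AE c in M. everywhere (\<lambda>c. c \<notin> N) c"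
    using N by (intro AE_M_everywhere AE_not_in) auto
  then have "AE c in M. c \<notin> N" by (auto elim!: eventually_mono dest: everywhereD)
  then show "N \<in> null_sets M" by (subst (asm) AE_iff_null_sets[symmetric]) (auto simp: sets_M)
qed

text \<open>
  The transport along pairs on which the Radon-Nikodym density \<open>f\<close> of \<open>M\<close> decreases shows that \<open>f\<close> is
  constant on the vertices in \<open>R\<close>. Reading off this constant from any vertex gives a root-independent
  function; it is positive and finite almost surely under \<open>M\<close>, hence also under \<open>M'\<close>.
\<close>

lemma root_independent_density:
  obtains \<rho> :: "'x rooted \<Rightarrow> ennreal" where "\<rho> \<in> borel_measurable borel" "root_independent \<rho>"
    "\<And>c. 0 < \<rho> c" "\<And>c. \<rho> c < \<infinity>" "M = density M' (\<lambda>c. indicator R c * \<rho> c)"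
proof -
  define f where "f = RN_deriv M' M"
  have f [measurable]: "f \<in> borel_measurable borel"
    using borel_measurable_RN_deriv[of M' M] unfolding f_def by simp
  have M: "density M' f = M"
    unfolding f_def using absolutely_continuous by (intro M'.density_RN_deriv) (simp_all add: sets_M sets_M')
  have int_M: "(\<integral>\<^sup>+ c. g c \<partial>M) = (\<integral>\<^sup>+ c. f c * g c \<partial>M')" if "g \<in> borel_measurable borel" for g
    using that by (subst M[symmetric]) (simp add: nn_integral_density)
  have int_f: "(\<integral>\<^sup>+ c. f c \<partial>M') = 1"
    using int_M[of "\<lambda>_. 1"] M.emeasure_space_1 by simp
  have f_fin: "AE c in M'. f c \<noteq> \<infinity>"
    by (rule nn_integral_PInf_AE) (simp_all add: int_f)
  have off_R: "AE c in M'. c \<notin> R \<longrightarrow> f c = 0"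
  proof -
    have "AE c in density M' f. c \<in> R" unfolding M by (rule AE_R)
    then have "AE c in M'. 0 < f c \<longrightarrow> c \<in> R" by (subst (asm) AE_density) simp_all
    then show ?thesis by (auto elim!: eventually_mono)
  qed
  obtain h :: "'x birooted \<Rightarrow> ennreal" where h [measurable]: "h \<in> borel_measurable borel"
    and h_pos: "\<And>b. 0 < h b" and h_sum: "\<And>c. osum h c \<le> 1"
    by (rule positive_substochastic_kernel) blast
  \<comment> \<open>Applied at every root, \<open>Q\<close> says that \<open>f\<close> is constant on the vertices in \<open>R\<close>.\<close>
  define Q where "Q c \<longleftrightarrow> (\<forall>b. src b = c \<longrightarrow> src b \<in> R \<longrightarrow> tgt b \<in> R \<longrightarrow> f (src b) \<le> f (tgt b))" for c
  define B where "B = {b. src b \<in> R \<and> tgt b \<in> R \<and> f (tgt b) < f (src b)}"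
  have [measurable]: "B \<in> sets borel" unfolding B_def by measurable
  have Q_iff: "Q c \<longleftrightarrow> osum (indicator B) c = 0" for c
    by (auto simp: Q_def osum_eq_0_iff B_def indicator_eq_0_iff)
  have [measurable]: "Measurable.pred borel Q" unfolding Q_iff[abs_def] by measurable
  have "AE c in M'. Q c"
  proof -
    \<comment> \<open>The transport along pairs with \<open>f\<close> larger at the source; its cost at the source and at the
      target agree by the two transport principles, although the former is larger pointwise.\<close>
    define k where "k b = h b * indicator B b" for b
    have [measurable]: "k \<in> borel_measurable borel" unfolding k_def[abs_def] by measurable
    define I where "I a = (\<integral>\<^sup>+ c. osum (\<lambda>b. a b * k b) c \<partial>M')" for a
    have "I (\<lambda>b. f (src b)) = (\<integral>\<^sup>+ c. f c * osum k c \<partial>M')"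
      unfolding I_def osum_src_mult ..
    also have "\<dots> = (\<integral>\<^sup>+ c. osum k c \<partial>M)" by (simp add: int_M)
    also have "\<dots> = (\<integral>\<^sup>+ c. osum (\<lambda>b. indicator R (tgt b) * k b) c \<partial>M)"
      by (intro nn_integral_cong osum_cong) (auto simp: k_def B_def split: split_indicator)
    also have "\<dots> = (\<integral>\<^sup>+ c. osum (\<lambda>b. indicator R (tgt b) * k (flip b)) c \<partial>M)"
      by (rule transport_R) measurable
    also have "\<dots> = (\<integral>\<^sup>+ c. osum (\<lambda>b. k (flip b)) c \<partial>M)"
      by (intro nn_integral_cong osum_cong) (auto simp: k_def B_def split: split_indicator)
    also have "\<dots> = (\<integral>\<^sup>+ c. osum (\<lambda>b. f (src b) * k (flip b)) c \<partial>M')"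
      unfolding osum_src_mult[of f "\<lambda>b. k (flip b)"] by (rule int_M) measurable
    also have "\<dots> = I (\<lambda>b. f (tgt b))"
      unfolding I_def by (subst (2) mass_transport) simp_all
    finally have eq: "I (\<lambda>b. f (src b)) = I (\<lambda>b. f (tgt b))" .
    have "I (\<lambda>b. f (src b)) \<le> (\<integral>\<^sup>+ c. f c \<partial>M')"
      unfolding I_def osum_src_mult
    proof (intro nn_integral_mono)
      fix c
      have "osum k c \<le> osum h c" by (intro osum_mono) (auto simp: k_def split: split_indicator)
      then have "osum k c \<le> 1" using h_sum[of c] by simp
      then show "f c * osum k c \<le> f c" using mult_left_mono[of "osum k c" 1 "f c"] by simp
    qed
    then have fin: "I (\<lambda>b. f (src b)) \<noteq> top" by (auto simp: int_f top_unique)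
    have "I (\<lambda>b. f (src b)) = I (\<lambda>b. f (tgt b)) + I (\<lambda>b. f (src b) - f (tgt b))"
      unfolding I_def
      by (subst nn_integral_add[symmetric]) (auto intro!: nn_integral_cong osum_cong
        simp: osum_add[symmetric] distrib_right[symmetric] k_def B_def add_diff_inverse_ennreal split: split_indicator)
    then have "I (\<lambda>b. f (src b) - f (tgt b)) = 0"
      using eq fin ennreal_add_left_cancel[of "I (\<lambda>b. f (tgt b))" "I (\<lambda>b. f (src b) - f (tgt b))" 0] by simp
    then have "AE c in M'. osum (\<lambda>b. (f (src b) - f (tgt b)) * k b) c = 0"
      unfolding I_def by (subst (asm) nn_integral_0_iff_AE) simp_all
    then show ?thesis
    proof eventually_elim
      case (elim c)
      show ?case
        unfolding Q_def
      proof (intro allI impI, rule ccontr)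
        fix b assume b: "src b = c" "src b \<in> R" "tgt b \<in> R" "\<not> f (src b) \<le> f (tgt b)"
        then have "(f (src b) - f (tgt b)) * h b = 0"
          using elim by (force simp: osum_eq_0_iff k_def B_def)
        then show False
          using b(4) h_pos[of b] by (simp add: diff_eq_0_iff_ennreal)
      qed
    qed
  qed
  then have ev_Q: "AE c in M'. everywhere Q c" by (rule AE_everywhere[rotated]) measurable
  \<comment> \<open>The common value of \<open>f\<close> on the vertices in \<open>R\<close>, defined so that it is root-independent everywhere.\<close>
  define \<rho>\<^sub>0 where "\<rho>\<^sub>0 c = (SUP b\<in>{b. src b = c \<and> tgt b \<in> R}. f (tgt b))" for c
  have less: "q < \<rho>\<^sub>0 c \<longleftrightarrow> osum (\<lambda>b. indicator {d \<in> R. q < f d} (tgt b)) c \<noteq> 0" for q c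
    by (auto simp: \<rho>\<^sub>0_def less_SUP_iff osum_eq_0_iff indicator_eq_0_iff)
  have [measurable]: "\<rho>\<^sub>0 \<in> borel_measurable borel"
  proof (rule borel_measurableI_greater)
    show "{c \<in> space borel. q < \<rho>\<^sub>0 c} \<in> sets borel" for q unfolding less by measurable
  qed
  have \<rho>\<^sub>0: "root_independent \<rho>\<^sub>0"
    unfolding root_independent_iff
  proof
    fix b
    have "q < \<rho>\<^sub>0 (src b) \<longleftrightarrow> q < \<rho>\<^sub>0 (tgt b)" for q unfolding less by (simp only: osum_tgt)
    then show "\<rho>\<^sub>0 (src b) = \<rho>\<^sub>0 (tgt b)" by (meson linorder_less_linear order_less_irrefl)
  qed
  have \<rho>\<^sub>0_eq: "\<rho>\<^sub>0 c = f c" if "everywhere Q c" "c \<in> R" for c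
  proof (rule antisym)
    show "\<rho>\<^sub>0 c \<le> f c"
      unfolding \<rho>\<^sub>0_def
    proof (rule SUP_least)
      fix b assume "b \<in> {b. src b = c \<and> tgt b \<in> R}"
      then have "src b = c" "tgt b \<in> R" "Q (tgt b)" using everywhere_tgt[of Q b] that by auto
      then show "f (tgt b) \<le> f c" using that unfolding Q_def by (metis src_flip tgt_flip)
    qed
    have "everywhere (\<lambda>d. d \<in> R \<longrightarrow> f d \<le> \<rho>\<^sub>0 c) c"
      unfolding everywhere_def \<rho>\<^sub>0_def by (auto intro: SUP_upper)
    then show "f c \<le> \<rho>\<^sub>0 c" using that everywhereD by blast
  qed
  have "AE c in M. 0 < \<rho>\<^sub>0 c \<and> \<rho>\<^sub>0 c < \<infinity>"
  proof -
    have "AE c in M'. f c \<noteq> 0 \<longrightarrow> 0 < \<rho>\<^sub>0 c \<and> \<rho>\<^sub>0 c < \<infinity>"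
      using ev_Q f_fin off_R
    proof eventually_elim
      case (elim c)
      then show ?case using \<rho>\<^sub>0_eq[of c] by (auto simp: less_top zero_less_iff_neq_zero)
    qed
    then have "AE c in density M' f. 0 < \<rho>\<^sub>0 c \<and> \<rho>\<^sub>0 c < \<infinity>"
      by (subst AE_density) (auto simp: zero_less_iff_neq_zero)
    then show ?thesis unfolding M .
  qed
  then have pos_fin: "AE c in M'. 0 < \<rho>\<^sub>0 c \<and> \<rho>\<^sub>0 c < \<infinity>"
    using \<rho>\<^sub>0 by (subst (asm) AE_transfer) (auto simp: root_independent_iff)
  define \<rho> where "\<rho> c = (if 0 < \<rho>\<^sub>0 c \<and> \<rho>\<^sub>0 c < \<infinity> then \<rho>\<^sub>0 c else 1)" for c
  have [measurable]: "\<rho> \<in> borel_measurable borel" unfolding \<rho>_def[abs_def] by measurable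
  show thesis
  proof (rule that[of \<rho>])
    show "root_independent \<rho>" using \<rho>\<^sub>0 by (simp add: root_independent_iff \<rho>_def)
    show "0 < \<rho> c" "\<rho> c < \<infinity>" for c by (auto simp: \<rho>_def)
    have "AE c in M'. f c = indicator R c * \<rho> c"
      using pos_fin ev_Q off_R
    proof eventually_elim
      case (elim c)
      then show ?case using \<rho>\<^sub>0_eq[of c] by (auto simp: \<rho>_def split: split_indicator)
    qed
    then show "M = density M' (\<lambda>c. indicator R c * \<rho> c)"
      using M density_cong[of f M' "\<lambda>c. indicator R c * \<rho> c"] by simp
  qed measurable
qed

end

section \<open>Greedy transport\<close>

text \<open>
  The pair \<open>p\<close> holds the remaining supply and the remaining capacity at each vertex.
\<close>

definition offer ::
  "('x birooted \<Rightarrow> ennreal) \<Rightarrow> ('x rooted \<Rightarrow> ennreal) \<times> ('x rooted \<Rightarrow> ennreal) \<Rightarrow> 'x birooted \<Rightarrow> ennreal" where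
  "offer h p b = h b * min (fst p (src b)) (snd p (tgt b))"

definition shipped ::
  "('x birooted \<Rightarrow> ennreal) \<Rightarrow> ('x rooted \<Rightarrow> ennreal) \<times> ('x rooted \<Rightarrow> ennreal) \<Rightarrow>
   ('x rooted \<Rightarrow> ennreal) \<times> ('x rooted \<Rightarrow> ennreal)" where
  "shipped h p = (\<lambda>c. fst p c - osum (offer h p) c, \<lambda>c. snd p c - osum (\<lambda>b. offer h p (flip b)) c)"

lemma osum_offer_le:
  assumes "\<And>c. osum h c \<le> 1"
  shows "osum (offer h p) c \<le> fst p c"
proof -
  have "osum (offer h p) c \<le> osum (\<lambda>b. fst p (src b) * h b) c"
    by (intro osum_mono) (auto simp: offer_def mult.commute intro!: mult_left_mono)
  also have "\<dots> = fst p c * osum h c" by (rule osum_src_mult)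
  also have "\<dots> \<le> fst p c" using mult_left_mono[OF assms, of "fst p c" c] by simp
  finally show ?thesis .
qed

lemma osum_offer_flip_le:
  assumes "\<And>c. osum (\<lambda>b. h (flip b)) c \<le> 1"
  shows "osum (\<lambda>b. offer h p (flip b)) c \<le> snd p c"
proof -
  have "osum (\<lambda>b. offer h p (flip b)) c \<le> osum (\<lambda>b. snd p (src b) * h (flip b)) c"
    by (intro osum_mono) (auto simp: offer_def mult.commute intro!: mult_left_mono)
  also have "\<dots> = snd p c * osum (\<lambda>b. h (flip b)) c" by (rule osum_src_mult)
  also have "\<dots> \<le> snd p c" using mult_left_mono[OF assms, of "snd p c" c] by simp
  finally show ?thesis .
qed

lemma decreasing_remainder:
  fixes s m :: "nat \<Rightarrow> ennreal"
  assumes "\<And>n. s (Suc n) + m n = s n"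
  shows "(\<Sum>n. m n) + (INF n. s n) = s 0"
proof -
  have sum: "(\<Sum>k<n. m k) + s n = s 0" for n
  proof (induction n)
    case (Suc n)
    have "(\<Sum>k<Suc n. m k) + s (Suc n) = (\<Sum>k<n. m k) + (s (Suc n) + m n)" by (simp add: ac_simps)
    then show ?case using Suc assms by simp
  qed simp
  have "s (Suc n) \<le> s n" for n using assms[of n] by (metis le_iff_add)
  then have "decseq s" by (rule decseq_SucI)
  then have "(\<lambda>n. (\<Sum>k<n. m k) + s n) \<longlonglongrightarrow> (\<Sum>n. m n) + (INF n. s n)"
    by (intro tendsto_add LIMSEQ_INF summable_LIMSEQ summableI)
  then show ?thesis unfolding sum by (simp add: LIMSEQ_const_iff)
qed

lemma suminf_const_ennreal: "0 < (e::ennreal) \<Longrightarrow> (\<Sum>n::nat. e) = top"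
  by (simp add: nn_integral_count_space_nat[symmetric] ennreal_mult_top)

text \<open>
  Since \<open>h\<close> has row and column sums at most 1, no round exceeds what is left. If \<open>x\<close> had supply and \<open>y\<close>
  had capacity left in the limit, then every round would move at least a fixed positive amount from
  \<open>x\<close> to \<open>y\<close>, contradicting the finite initial supply at \<open>x\<close>.
\<close>

lemma greedy_transport:
  fixes h :: "'x::metric_space birooted \<Rightarrow> ennreal" and s0 c0 :: "'x rooted \<Rightarrow> ennreal"
  assumes [measurable]: "h \<in> borel_measurable borel" "s0 \<in> borel_measurable borel" "c0 \<in> borel_measurable borel"
    and h: "\<And>b. 0 < h b" "\<And>c. osum h c \<le> 1" "\<And>c. osum (\<lambda>b. h (flip b)) c \<le> 1"
    and s0: "\<And>c. s0 c < top"
  obtains t s\<^sub>r c\<^sub>r where "t \<in> borel_measurable borel" "s\<^sub>r \<in> borel_measurable borel" "c\<^sub>r \<in> borel_measurable borel"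
    "\<And>c. osum t c + s\<^sub>r c = s0 c" "\<And>c. osum (\<lambda>b. t (flip b)) c + c\<^sub>r c = c0 c"
    "\<And>b. s\<^sub>r (src b) = 0 \<or> c\<^sub>r (tgt b) = 0"
proof -
  define p where "p n = (shipped h ^^ n) (s0, c0)" for n
  have p_Suc: "p (Suc n) = shipped h (p n)" for n by (simp add: p_def)
  have p_0: "p 0 = (s0, c0)" by (simp add: p_def)
  have meas: "fst (p n) \<in> borel_measurable borel \<and> snd (p n) \<in> borel_measurable borel" for n
  proof (induction n)
    case 0 show ?case by (simp add: p_0)
  next
    case (Suc n)
    then have [measurable]: "fst (p n) \<in> borel_measurable borel" "snd (p n) \<in> borel_measurable borel" by auto
    show ?case unfolding p_Suc shipped_def offer_def[abs_def] by simp
  qed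
  then have [measurable]: "fst (p n) \<in> borel_measurable borel" "snd (p n) \<in> borel_measurable borel" for n
    by auto
  define m where "m n = offer h (p n)" for n
  have [measurable]: "m n \<in> borel_measurable borel" for n unfolding m_def offer_def[abs_def] by measurable
  define t where "t b = (\<Sum>n. m n b)" for b
  define s\<^sub>r where "s\<^sub>r c = (INF n. fst (p n) c)" for c
  define c\<^sub>r where "c\<^sub>r c = (INF n. snd (p n) c)" for c
  have row: "osum t c + s\<^sub>r c = s0 c" for c
  proof -
    have "fst (p (Suc n)) c + osum (m n) c = fst (p n) c" for n
      unfolding p_Suc shipped_def m_def
      using diff_add_cancel_ennreal[OF osum_offer_le[OF h(2), of "p n" c]] by simp
    from decreasing_remainder[of "\<lambda>n. fst (p n) c", OF this]
    show ?thesis by (simp add: t_def[abs_def] s\<^sub>r_def osum_suminf p_0)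
  qed
  have col: "osum (\<lambda>b. t (flip b)) c + c\<^sub>r c = c0 c" for c
  proof -
    have "snd (p (Suc n)) c + osum (\<lambda>b. m n (flip b)) c = snd (p n) c" for n
      unfolding p_Suc shipped_def m_def
      using diff_add_cancel_ennreal[OF osum_offer_flip_le[OF h(3), of "p n" c]] by simp
    from decreasing_remainder[of "\<lambda>n. snd (p n) c", OF this]
    show ?thesis by (simp add: t_def[abs_def] c\<^sub>r_def osum_suminf p_0)
  qed
  have excl: "s\<^sub>r (src b) = 0 \<or> c\<^sub>r (tgt b) = 0" for b
  proof (rule ccontr)
    assume neg: "\<not> ?thesis"
    let ?e = "h b * min (s\<^sub>r (src b)) (c\<^sub>r (tgt b))"
    have "0 < ?e" using neg h(1)[of b] by (auto simp: zero_less_iff_neq_zero min_def)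
    then have "top = (\<Sum>n::nat. ?e)" by (rule suminf_const_ennreal[symmetric])
    also have "\<dots> \<le> (\<Sum>n. m n b)"
    proof (intro suminf_le allI summableI)
      show "?e \<le> m n b" for n
        unfolding m_def offer_def s\<^sub>r_def c\<^sub>r_def by (intro mult_left_mono min.mono INF_lower) auto
    qed
    also have "\<dots> = t b" by (simp add: t_def)
    also have "\<dots> \<le> osum t (src b)" by (rule osum_ge) simp
    also have "\<dots> \<le> s0 (src b)" using row[of "src b"] by (metis le_iff_add)
    finally show False using s0[of "src b"] by (simp add: top_unique)
  qed
  show thesis
  proof (rule that[OF _ _ _ row col excl])
    show "t \<in> borel_measurable borel" unfolding t_def[abs_def] by measurable
    show "s\<^sub>r \<in> borel_measurable borel" unfolding s\<^sub>r_def[abs_def] by measurable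
    show "c\<^sub>r \<in> borel_measurable borel" unfolding c\<^sub>r_def[abs_def] by measurable
  qed
qed

section \<open>A balanced kernel\<close>

lemma measurable_invariant_field_iff:
  fixes w :: "'x::metric_space rooted \<Rightarrow> ennreal"
  shows "w \<in> borel_measurable invariant_field \<longleftrightarrow> w \<in> borel_measurable borel \<and> root_independent w"
proof -
  have space: "space (invariant_field :: 'x rooted measure) = UNIV"
    unfolding invariant_field_def by (rule space_measure_of) simp
  show ?thesis
  proof (intro iffI conjI)
    assume w: "w \<in> borel_measurable invariant_field"
    have *: "w -` A \<in> sets invariant_field" if "A \<in> sets borel" for A
      using measurable_sets[OF w that] by (simp add: space)
    then show "w \<in> borel_measurable borel"
      by (intro measurableI) (auto simp: in_invariant_field_iff)
    show "root_independent w"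
      unfolding root_independent_iff
    proof
      fix b
      have "w -` {w (src b)} \<in> sets invariant_field" by (rule *) simp
      then show "w (src b) = w (tgt b)" by (auto simp: in_invariant_field_iff)
    qed
  next
    assume "w \<in> borel_measurable borel \<and> root_independent w"
    then show "w \<in> borel_measurable invariant_field"
      using measurable_sets[of w borel borel]
      by (intro measurableI) (auto simp: in_invariant_field_iff space root_independent_iff)
  qed
qed

lemma ennreal_inverse_mult_self: "0 < x \<Longrightarrow> x < top \<Longrightarrow> x * inverse x = (1::ennreal)"
  using ennreal_divide_self[of x] by (simp add: divide_ennreal_def)

context unimodular_pair
begin

text \<open>
  Admissibility of a kernel, expressed by sums over the second root.
\<close>

definition kernel :: "('x birooted \<Rightarrow> ennreal) \<Rightarrow> bool" where
  "kernel t \<longleftrightarrow> t \<in> borel_measurable borel \<and>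
     (AE c in M. everywhere (\<lambda>d. osum t d = 1 \<and> osum (\<lambda>b. indicator (- R) (tgt b) * t b) d = 0) c)"

sublocale M: finite_measure_subalgebra M invariant_field
  by unfold_locales (rule subalgebra_invariant_field[OF random])

sublocale M': finite_measure_subalgebra M' invariant_field
  by unfold_locales
    (use unimodular subalgebra_invariant_field in \<open>auto simp: unimodular_def\<close>)

text \<open>
  With \<open>p = P'(o \<in> S | I)\<close>, supply 1 everywhere and capacity \<open>1 / p\<close> on \<open>S\<close> have equal expectation on
  every invariant event. So the leftovers \<open>s\<^sub>r\<close> and \<open>c\<^sub>r\<close> have equal expectation there too. On the
  invariant event that some vertex has supply left, no capacity is left, hence no supply is left in
  expectation; and then no capacity is left either.
\<close>

lemma balanced_kernel:
  obtains t C where "t \<in> borel_measurable borel" "\<And>b. t b < top" "\<And>b. tgt b \<notin> R \<Longrightarrow> t b = 0"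
    "C \<in> borel_measurable borel" "root_independent C"
    "AE c in M'. osum t c = 1 \<and> osum (\<lambda>b. t (flip b)) c = indicator R c * C c"
proof -
  define p where "p = nn_cond_exp M' invariant_field (indicator R)"
  have p [measurable]: "p \<in> borel_measurable borel" and p_ri: "root_independent p"
    using borel_measurable_nn_cond_exp[of M' invariant_field "indicator R"]
    unfolding p_def measurable_invariant_field_iff by auto
  have p_int: "(\<integral>\<^sup>+ c. \<psi> c * p c \<partial>M') = (\<integral>\<^sup>+ c. \<psi> c * indicator R c \<partial>M')"
    if "\<psi> \<in> borel_measurable borel" "root_independent \<psi>" for \<psi>
    unfolding p_def using that by (intro M'.nn_cond_exp_intg) (auto simp: measurable_invariant_field_iff)
  have "AE c in M'. p c \<noteq> \<infinity>"
  proof (rule nn_integral_PInf_AE)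
    have "(\<integral>\<^sup>+ c. p c \<partial>M') = (\<integral>\<^sup>+ c. indicator R c \<partial>M')"
      using p_int[of "\<lambda>_. 1"] by (simp add: root_independent_iff)
    then show "(\<integral>\<^sup>+ c. p c \<partial>M') \<noteq> \<infinity>" by simp
  qed measurable
  moreover have "AE c in M'. p c \<noteq> 0"
  proof -
    \<comment> \<open>Where \<open>p = 0\<close> the root is almost surely outside \<open>R\<close>, and then so is every vertex; under \<open>M\<close>
      this is impossible.\<close>
    have "(\<integral>\<^sup>+ c. indicator {c. p c = 0} c * indicator R c \<partial>M') = (\<integral>\<^sup>+ c. indicator {c. p c = 0} c * p c \<partial>M')"
      using p_ri by (intro p_int[symmetric]) (auto simp: root_independent_iff indicator_def)
    also have "\<dots> = (\<integral>\<^sup>+ c. 0 \<partial>M')" by (intro nn_integral_cong) (auto split: split_indicator)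
    finally have "(\<integral>\<^sup>+ c. indicator {c. p c = 0} c * indicator R c \<partial>M') = 0" by simp
    then have "AE c in M'. indicator {c. p c = 0} c * indicator R c = (0::ennreal)"
      by (rule nn_integral_0_iff_AE[THEN iffD1, rotated]) measurable
    then have "AE c in M'. p c = 0 \<longrightarrow> c \<notin> R" by (auto elim!: eventually_mono simp: indicator_def)
    then have "AE c in M. everywhere (\<lambda>c. p c = 0 \<longrightarrow> c \<notin> R) c" by (rule AE_M_everywhere[rotated]) measurable
    with AE_R have "AE c in M. p c \<noteq> 0" by eventually_elim (blast dest: everywhereD)
    then show ?thesis using p_ri by (subst (asm) AE_transfer) (auto simp: root_independent_iff)
  qed
  ultimately have p_inv: "AE c in M'. inverse (p c) * p c = 1"
    by eventually_elim
      (metis ennreal_inverse_mult_self infinity_ennreal_def mult.commute not_gr_zero top.not_eq_extremum)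
  define C where "C c = inverse (p c)" for c
  have C [measurable]: "C \<in> borel_measurable borel" unfolding C_def[abs_def] by measurable
  have C_ri: "root_independent C" using p_ri by (simp add: C_def root_independent_iff)
  obtain h :: "'x birooted \<Rightarrow> ennreal" where h: "h \<in> borel_measurable borel" "\<And>b. 0 < h b"
      "\<And>c. osum h c \<le> 1" "\<And>c. osum (\<lambda>b. h (flip b)) c \<le> 1"
    by (rule positive_substochastic_kernel) blast
  obtain t s\<^sub>r c\<^sub>r where [measurable]: "t \<in> borel_measurable borel" "s\<^sub>r \<in> borel_measurable borel"
      "c\<^sub>r \<in> borel_measurable borel"
    and row: "\<And>c. osum t c + s\<^sub>r c = 1" and col: "\<And>c. osum (\<lambda>b. t (flip b)) c + c\<^sub>r c = indicator R c * C c"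
    and excl: "\<And>b. s\<^sub>r (src b) = 0 \<or> c\<^sub>r (tgt b) = 0"
    by (rule greedy_transport[OF h(1) _ _ h(2-4), of "\<lambda>_. 1" "\<lambda>c. indicator R c * C c"]) auto
  have t_le: "t b \<le> 1" for b
    using osum_ge[of b "src b" t] row[of "src b"] by (metis le_iff_add order_trans)
  have t_R: "t b = 0" if "tgt b \<notin> R" for b
    using osum_ge[of "flip b" "tgt b" "\<lambda>b. t (flip b)"] col[of "tgt b"] that by simp
  have remainder: "(\<integral>\<^sup>+ c. \<psi> c * s\<^sub>r c \<partial>M') = (\<integral>\<^sup>+ c. \<psi> c * c\<^sub>r c \<partial>M')"
    if [measurable]: "\<psi> \<in> borel_measurable borel" and \<psi>: "root_independent \<psi>" "\<And>c. \<psi> c \<le> 1" for \<psi>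
  proof -
    let ?t = "\<integral>\<^sup>+ c. \<psi> c * osum t c \<partial>M'"
    have "?t = (\<integral>\<^sup>+ c. osum (\<lambda>b. \<psi> (src b) * t b) c \<partial>M')" by (simp only: osum_src_mult)
    also have "\<dots> = (\<integral>\<^sup>+ c. osum (\<lambda>b. \<psi> (tgt b) * t (flip b)) c \<partial>M')" by (subst mass_transport) simp_all
    also have "\<dots> = (\<integral>\<^sup>+ c. osum (\<lambda>b. \<psi> (src b) * t (flip b)) c \<partial>M')"
      by (simp only: root_independent_tgt[OF \<psi>(1)])
    also have "\<dots> = (\<integral>\<^sup>+ c. \<psi> c * osum (\<lambda>b. t (flip b)) c \<partial>M')"
      by (simp only: osum_src_mult[of \<psi> "\<lambda>b. t (flip b)"])
    finally have swap: "?t = (\<integral>\<^sup>+ c. \<psi> c * osum (\<lambda>b. t (flip b)) c \<partial>M')" .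
    have total: "?t + (\<integral>\<^sup>+ c. \<psi> c * s\<^sub>r c \<partial>M') = (\<integral>\<^sup>+ c. \<psi> c \<partial>M')"
      by (subst nn_integral_add[symmetric]) (simp_all add: distrib_left[symmetric] row)
    have "?t + (\<integral>\<^sup>+ c. \<psi> c * c\<^sub>r c \<partial>M') = (\<integral>\<^sup>+ c. (\<psi> c * C c) * indicator R c \<partial>M')"
      unfolding swap
      by (subst nn_integral_add[symmetric]) (simp_all add: distrib_left[symmetric] col, simp add: ac_simps)
    moreover have "(\<integral>\<^sup>+ c. (\<psi> c * C c) * indicator R c \<partial>M') = (\<integral>\<^sup>+ c. (\<psi> c * C c) * p c \<partial>M')"
      using \<psi> C_ri by (intro p_int[symmetric]) (auto simp: root_independent_iff)
    moreover have "\<dots> = (\<integral>\<^sup>+ c. \<psi> c \<partial>M')"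
      using p_inv by (intro nn_integral_cong_AE) (auto elim!: eventually_mono simp: C_def mult.assoc)
    ultimately have "?t + (\<integral>\<^sup>+ c. \<psi> c * s\<^sub>r c \<partial>M') = ?t + (\<integral>\<^sup>+ c. \<psi> c * c\<^sub>r c \<partial>M')"
      using total by (simp only:)
    moreover have "?t \<noteq> top"
    proof -
      have "?t \<le> (\<integral>\<^sup>+ c. \<psi> c \<partial>M')" using total by (metis le_iff_add)
      also have "\<dots> \<le> (\<integral>\<^sup>+ c. 1 \<partial>M')" using \<psi>(2) by (intro nn_integral_mono)
      also have "\<dots> = 1" using M'.emeasure_space_1 by simp
      finally show ?thesis by (auto simp: top_unique)
    qed
    ultimately show ?thesis unfolding ennreal_add_left_cancel by simp
  qed
  define A where "A = {c. \<not> everywhere (\<lambda>d. s\<^sub>r d = 0) c}"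
  have [measurable]: "A \<in> sets borel" unfolding A_def by measurable
  have A_ri: "root_independent (indicator A :: _ \<Rightarrow> ennreal)"
    using everywhere_root_independent[of "\<lambda>d. s\<^sub>r d = 0"]
    by (simp add: root_independent_iff A_def indicator_def)
  have "(\<integral>\<^sup>+ c. s\<^sub>r c \<partial>M') = (\<integral>\<^sup>+ c. indicator A c * s\<^sub>r c \<partial>M')"
    by (intro nn_integral_cong) (auto simp: A_def indicator_def dest: everywhereD)
  also have "\<dots> = (\<integral>\<^sup>+ c. indicator A c * c\<^sub>r c \<partial>M')"
    using A_ri by (intro remainder) (auto split: split_indicator)
  also have "\<dots> = (\<integral>\<^sup>+ c. 0 \<partial>M')"
  proof (intro nn_integral_cong)
    fix c
    show "indicator A c * c\<^sub>r c = 0"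
    proof (cases "c \<in> A")
      case True
      then obtain b where "src b = c" "s\<^sub>r (tgt b) \<noteq> 0" by (auto simp: A_def everywhere_def)
      then show ?thesis using excl[of "flip b"] by simp
    qed simp
  qed
  finally have s0: "(\<integral>\<^sup>+ c. s\<^sub>r c \<partial>M') = 0" by simp
  then have c0: "(\<integral>\<^sup>+ c. c\<^sub>r c \<partial>M') = 0"
    using remainder[of "\<lambda>_. 1"] by (simp add: root_independent_iff)
  have "AE c in M'. s\<^sub>r c = 0" "AE c in M'. c\<^sub>r c = 0"
    using s0 c0 by (auto intro!: nn_integral_0_iff_AE[THEN iffD1, rotated])
  then have "AE c in M'. osum t c = 1 \<and> osum (\<lambda>b. t (flip b)) c = indicator R c * C c"
  proof eventually_elim
    case (elim c)
    then show ?case using row[of c] col[of c] by simp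
  qed
  moreover have "t b < top" for b using t_le[of b] by (rule le_less_trans) simp
  ultimately show thesis using t_R C C_ri by (intro that[of t C]) auto
qed

end

section \<open>Kernel laws\<close>

locale unimodular_density = unimodular_pair +
  fixes \<rho> :: "'a rooted \<Rightarrow> ennreal"
  assumes \<rho> [measurable]: "\<rho> \<in> borel_measurable borel"
    and \<rho>_ri: "root_independent \<rho>"
    and \<rho>_pos: "\<And>c. 0 < \<rho> c" and \<rho>_fin: "\<And>c. \<rho> c < \<infinity>"
    and M_eq: "M = density M' (\<lambda>c. indicator R c * \<rho> c)"
begin

text \<open>
  The density turns the integral into one over \<open>M'\<close>, and mass transport moves the root to the sender
  of the mass. There the outgoing mass is 1, all of it goes to \<open>R\<close>, and the root-independent factors
  are unchanged.
\<close>

lemma kernel_integral: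
  assumes t: "kernel t" and [measurable]: "\<phi> \<in> borel_measurable borel" "\<psi> \<in> borel_measurable borel"
    and \<psi>: "root_independent \<psi>"
  shows "(\<integral>\<^sup>+ c. \<psi> c * osum (\<lambda>b. t (flip b) * \<phi> (tgt b)) c \<partial>M) = (\<integral>\<^sup>+ c. \<rho> c * \<psi> c * \<phi> c \<partial>M')"
proof -
  have [measurable]: "t \<in> borel_measurable borel" using t by (simp add: kernel_def)
  define a where "a c = indicator R c * \<rho> c * \<psi> c" for c
  have [measurable]: "a \<in> borel_measurable borel" unfolding a_def[abs_def] by measurable
  have "(\<integral>\<^sup>+ c. \<psi> c * osum (\<lambda>b. t (flip b) * \<phi> (tgt b)) c \<partial>M) =
      (\<integral>\<^sup>+ c. a c * osum (\<lambda>b. t (flip b) * \<phi> (tgt b)) c \<partial>M')"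
    by (subst M_eq) (simp add: nn_integral_density a_def mult.assoc)
  also have "\<dots> = (\<integral>\<^sup>+ c. osum (\<lambda>b. a (src b) * (t (flip b) * \<phi> (tgt b))) c \<partial>M')"
    by (simp only: osum_src_mult[of a "\<lambda>b. t (flip b) * \<phi> (tgt b)"])
  also have "\<dots> = (\<integral>\<^sup>+ c. osum (\<lambda>b. a (tgt b) * (t b * \<phi> (src b))) c \<partial>M')"
    by (subst (2) mass_transport) simp_all
  also have "\<dots> = (\<integral>\<^sup>+ c. \<rho> c * \<psi> c * \<phi> c \<partial>M')"
  proof (rule nn_integral_cong_AE)
    have "AE c in M'. everywhere (\<lambda>d. osum t d = 1 \<and> osum (\<lambda>b. indicator (- R) (tgt b) * t b) d = 0) c"
      using t by (subst AE_everywhere_iff[symmetric]) (auto simp: kernel_def)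
    then show "AE c in M'. osum (\<lambda>b. a (tgt b) * (t b * \<phi> (src b))) c = \<rho> c * \<psi> c * \<phi> c"
    proof eventually_elim
      case (elim c)
      then have c: "osum t c = 1" "osum (\<lambda>b. indicator (- R) (tgt b) * t b) c = 0"
        by (auto dest: everywhereD)
      have "osum (\<lambda>b. a (tgt b) * (t b * \<phi> (src b))) c = osum (\<lambda>b. \<rho> (src b) * \<psi> (src b) * \<phi> (src b) * t b) c"
      proof (rule osum_cong)
        fix b assume "src b = c"
        then have "tgt b \<notin> R \<Longrightarrow> t b = 0" using c(2) by (force simp: osum_eq_0_iff)
        then show "a (tgt b) * (t b * \<phi> (src b)) = \<rho> (src b) * \<psi> (src b) * \<phi> (src b) * t b"
          using \<rho>_ri \<psi> by (cases "tgt b \<in> R") (auto simp: a_def root_independent_tgt ac_simps)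
      qed
      also have "\<dots> = \<rho> c * \<psi> c * \<phi> c * osum t c"
        by (rule osum_src_mult[of "\<lambda>c. \<rho> c * \<psi> c * \<phi> c"])
      finally show ?case using c(1) by simp
    qed
  qed
  finally show ?thesis .
qed

text \<open>
  The function \<^const>\<open>cond_in_mass\<close> for kernels with values in \<^typ>\<open>ennreal\<close>.
\<close>

definition cond_mass :: "('a birooted \<Rightarrow> ennreal) \<Rightarrow> 'a rooted \<Rightarrow> ennreal" where
  "cond_mass t = nn_cond_exp M invariant_field (osum (\<lambda>b. t (flip b)))"

lemma measurable_cond_mass [measurable]: "cond_mass t \<in> borel_measurable borel"
  and cond_mass_ri: "root_independent (cond_mass t)"
  using borel_measurable_nn_cond_exp[of M invariant_field "osum (\<lambda>b. t (flip b))"]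
  unfolding cond_mass_def measurable_invariant_field_iff by auto

lemma cond_mass_integral:
  assumes "kernel t" "\<psi> \<in> borel_measurable borel" "root_independent \<psi>"
  shows "(\<integral>\<^sup>+ c. \<psi> c * cond_mass t c \<partial>M) = (\<integral>\<^sup>+ c. \<rho> c * \<psi> c \<partial>M')"
proof -
  have [measurable]: "t \<in> borel_measurable borel" using assms by (simp add: kernel_def)
  have "(\<integral>\<^sup>+ c. \<psi> c * cond_mass t c \<partial>M) = (\<integral>\<^sup>+ c. \<psi> c * osum (\<lambda>b. t (flip b)) c \<partial>M)"
    unfolding cond_mass_def using assms
    by (intro M.nn_cond_exp_intg) (auto simp: measurable_invariant_field_iff)
  then show ?thesis using kernel_integral[of t "\<lambda>_. 1" \<psi>] assms by simp
qed

text \<open>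
  Integrating \<open>1 / \<rho>\<close> against the conditional in-mass gives total mass 1, whatever the kernel.
\<close>

lemma cond_mass_finite:
  assumes t: "kernel t"
  shows "AE c in M. cond_mass t c < \<infinity>"
proof -
  have "(\<integral>\<^sup>+ c. inverse (\<rho> c) * cond_mass t c \<partial>M) = (\<integral>\<^sup>+ c. \<rho> c * inverse (\<rho> c) \<partial>M')"
    using \<rho>_ri by (intro cond_mass_integral t) (auto simp: root_independent_iff)
  also have "\<dots> = (\<integral>\<^sup>+ c. 1 \<partial>M')"
    using \<rho>_pos \<rho>_fin by (intro nn_integral_cong) (simp add: ennreal_inverse_mult_self)
  also have "\<dots> = 1" using M'.emeasure_space_1 by simp
  finally have "AE c in M. inverse (\<rho> c) * cond_mass t c \<noteq> \<infinity>"
    by (intro nn_integral_PInf_AE) simp_all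
  then show ?thesis
  proof eventually_elim
    case (elim c)
    then show ?case using \<rho>_fin[of c] by (auto simp: less_top ennreal_mult_eq_top_iff)
  qed
qed

lemma cond_mass_pos_finite:
  assumes t: "kernel t"
  shows "AE c in M'. 0 < cond_mass t c \<and> cond_mass t c < \<infinity>"
proof -
  let ?Z = "{c. cond_mass t c = 0}"
  have "(\<integral>\<^sup>+ c. \<rho> c * indicator ?Z c \<partial>M') = (\<integral>\<^sup>+ c. indicator ?Z c * cond_mass t c \<partial>M)"
    using cond_mass_ri[of t] by (intro cond_mass_integral[symmetric] t) (auto simp: root_independent_iff indicator_def)
  also have "\<dots> = (\<integral>\<^sup>+ c. 0 \<partial>M)" by (intro nn_integral_cong) (auto split: split_indicator)
  finally have "(\<integral>\<^sup>+ c. \<rho> c * indicator ?Z c \<partial>M') = 0" by simp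
  then have "AE c in M'. \<rho> c * indicator ?Z c = 0"
    by (rule nn_integral_0_iff_AE[THEN iffD1, rotated]) measurable
  moreover have "AE c in M'. cond_mass t c < \<infinity>"
    using cond_mass_finite[OF t] cond_mass_ri[of t]
    by (subst (asm) AE_transfer) (auto simp: root_independent_iff)
  ultimately show ?thesis
  proof eventually_elim
    case (elim c)
    then show ?case using \<rho>_pos[of c] by (auto simp: zero_less_iff_neq_zero indicator_def)
  qed
qed

end

section \<open>Networks with a covariant subset\<close>

lemma network_iso_of_ucls_eq:
  assumes "is_network G" "is_network H" "ucls G = ucls H"
  obtains f g where "network_iso G H f g"
proof -
  have refl: "unrooted_eq K K" if "is_network K" for K :: "'a network"
    using that network_iso_refl unfolding unrooted_eq_def by blast
  have "unrooted_eq G H"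
    using assms(3) Quotient3_rel[OF Quotient3_unrooted, of G H] refl[OF assms(1)] refl[OF assms(2)]
    by (simp add: ucls_def)
  then show thesis using that by (auto simp: unrooted_eq_def)
qed

lemma forget_root_eq_iff: "forget_root c = forget_root d \<longleftrightarrow> (\<exists>b. src b = c \<and> tgt b = d)"
proof
  assume eq: "forget_root c = forget_root d"
  obtain G u where c: "is_network G" "u \<in> verts G" "c = rcls G u" by (rule rooted_cases)
  obtain H v where d: "is_network H" "v \<in> verts H" "d = rcls H v" by (rule rooted_cases)
  have "ucls G = ucls H" using eq c d by (simp add: forget_root_rcls)
  then obtain f g where f: "network_iso G H f g" by (rule network_iso_of_ucls_eq[OF c(1) d(1)])
  have "f u \<in> verts H" using network_iso_verts[OF f c(2)] .
  then show "\<exists>b. src b = c \<and> tgt b = d"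
    using rcls_iso[OF c(1) d(1) c(2) f] c d by (intro exI[of _ "bcls H (f u) v"]) simp
next
  assume "\<exists>b. src b = c \<and> tgt b = d"
  then obtain b where b: "src b = c" "tgt b = d" by blast
  obtain G u v where "is_network G" "u \<in> verts G" "v \<in> verts G" "b = bcls G u v" by (rule birooted_cases)
  then show "forget_root c = forget_root d" using b by (auto simp: forget_root_rcls)
qed

lemma forget_root_measurable: "sets (N :: 'a::metric_space rooted measure) = sets borel \<Longrightarrow> forget_root \<in> N \<rightarrow>\<^sub>M unrooted_space"
proof (rule measurableI)
  fix B :: "'a::metric_space unrooted set" assume N: "sets N = sets borel" and "B \<in> sets unrooted_space"
  then show "forget_root -` B \<inter> space N \<in> sets N"
    using sets_eq_imp_space_eq[OF N] by (simp add: sets_unrooted_space)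
qed (simp add: unrooted_space_def space_measure_of_conv)

text \<open>
  Invariant events are the preimages of events for the unrooted network; this translates between
  the laws of \<open>[G]\<close> and the invariant sigma-field.
\<close>

lemma emeasure_invariant_forget_root:
  fixes N :: "'x::metric_space rooted measure"
  assumes N: "sets N = sets borel" and A: "A \<in> sets invariant_field"
  shows "emeasure N A = emeasure (distr N unrooted_space forget_root) (forget_root ` A)"
    and "forget_root ` A \<in> sets unrooted_space"
proof -
  have A': "A \<in> sets borel" and inv: "\<And>b. src b \<in> A \<Longrightarrow> tgt b \<in> A"
    using A by (auto simp: in_invariant_field_iff)
  have eq: "forget_root -` forget_root ` A = A"
  proof (intro equalityI subsetI)
    fix c assume "c \<in> forget_root -` forget_root ` A"
    then obtain a where "a \<in> A" "forget_root a = forget_root c" by auto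
    then show "c \<in> A" unfolding forget_root_eq_iff using inv by auto
  qed auto
  show B: "forget_root ` A \<in> sets unrooted_space" using A' by (simp add: sets_unrooted_space eq)
  have "space N = UNIV" using sets_eq_imp_space_eq[OF N] by simp
  then show "emeasure N A = emeasure (distr N unrooted_space forget_root) (forget_root ` A)"
    using forget_root_measurable[OF N] B by (simp add: emeasure_distr eq)
qed

lemma unimodularization_equivalent:
  assumes "unimodularization M' M" "sets M = sets borel" "A \<in> sets invariant_field"
  shows "emeasure M A = 0 \<longleftrightarrow> emeasure M' A = 0"
proof -
  let ?D = "\<lambda>N. distr N unrooted_space forget_root"
  have M': "sets M' = sets borel"
    using assms(1) by (auto simp: unimodularization_def weak_unimodularization_def
        strong_unimodularization_def unimodular_def random_rooted_network_def)
  have B: "forget_root ` A \<in> sets unrooted_space"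
    by (rule emeasure_invariant_forget_root(2)[OF assms(2,3)])
  have "null_sets (?D M) = null_sets (?D M')"
    using assms(1) by (auto simp: unimodularization_def weak_unimodularization_def
        strong_unimodularization_def absolutely_continuous_def)
  then have "forget_root ` A \<in> null_sets (?D M) \<longleftrightarrow> forget_root ` A \<in> null_sets (?D M')" by simp
  then show ?thesis
    using B by (simp add: null_sets_def emeasure_invariant_forget_root(1)[OF assms(2,3)]
        emeasure_invariant_forget_root(1)[OF M' assms(3)])
qed

lemma src_eq_rclsE:
  assumes "is_network G" "u \<in> verts G" "src b = rcls G u"
  obtains v where "v \<in> verts G" "b = bcls G u v"
proof -
  obtain H w z where H: "is_network H" "w \<in> verts H" "z \<in> verts H" "b = bcls H w z" by (rule birooted_cases)
  then obtain f g where f: "network_iso H G f g" "f w = u"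
    using assms rcls_eq_iff[of H w G u] by auto
  have "b = bcls G u (f z)" using bcls_eqI[OF H(1) assms(1) H(2,3) f(1)] H(4) f(2) by simp
  then show thesis using that network_iso_verts[OF f(1) H(3)] by blast
qed

lemma everywhere_rcls:
  assumes "is_network G" "u \<in> verts G"
  shows "everywhere Q (rcls G u) \<longleftrightarrow> (\<forall>v\<in>verts G. Q (rcls G v))"
proof (intro iffI ballI)
  fix v assume "everywhere Q (rcls G u)" "v \<in> verts G"
  then show "Q (rcls G v)" using everywhere_tgt[of Q "bcls G u v"] assms by simp
next
  assume Q: "\<forall>v\<in>verts G. Q (rcls G v)"
  show "everywhere Q (rcls G u)"
    unfolding everywhere_def
  proof (intro allI impI)
    fix b assume "src b = rcls G u"
    then obtain v where "v \<in> verts G" "b = bcls G u v" by (rule src_eq_rclsE[OF assms])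
    then show "Q (tgt b)" using Q assms by simp
  qed
qed

lemma osum_rcls_eq_0_iff:
  assumes "is_network G" "u \<in> verts G"
  shows "osum g (rcls G u) = 0 \<longleftrightarrow> (\<forall>v\<in>verts G. g (bcls G u v) = 0)"
  unfolding osum_eq_0_iff
proof (intro iffI ballI allI impI)
  fix b assume *: "\<forall>v\<in>verts G. g (bcls G u v) = 0" and "src b = rcls G u"
  from this(2) obtain v where "v \<in> verts G" "b = bcls G u v" by (rule src_eq_rclsE[OF assms])
  then show "g b = 0" using * by simp
qed (use assms in simp)

definition occupied :: "('x network \<Rightarrow> nat set) \<Rightarrow> 'x rooted set" where
  "occupied S = {c. at_root (\<lambda>G u. u \<in> S G) c}"

lemma rcls_in_occupied:
  assumes "covariant_subset S" "is_network G" "u \<in> verts G"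
  shows "rcls G u \<in> occupied S \<longleftrightarrow> u \<in> S G"
proof -
  have "at_root (\<lambda>G u. u \<in> S G) (rcls G u) = (u \<in> S G)"
  proof (rule at_root_rcls[OF assms(2,3)])
    fix H f g assume H: "is_network H" "network_iso G H f g"
    show "(f u \<in> S H) = (u \<in> S G)"
      using assms(1) rcls_iso[OF assms(2) H(1) assms(3) H(2)] network_iso_verts[OF H(2) assms(3)] H(1) assms(2,3)
      unfolding covariant_subset_def by metis
  qed
  then show ?thesis by (simp add: occupied_def)
qed

lemma at_root_representative:
  obtains G u where "is_network G" "u \<in> verts G" "c = rcls G u" "at_root F c = F G u"
proof -
  obtain G u where "rep_rooted c = (G, u)" "is_network G" "u \<in> verts G" "c = rcls G u"
    by (rule rooted_representative)
  then show thesis using that by (simp add: at_root_def)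
qed

text \<open>
  A sum over \<open>S\<close> becomes a weighted sum over all vertices, in which \<open>S\<close> enters only through the event
  \<^term>\<open>occupied S\<close>.
\<close>

lemma sum_over_covariant_subset:
  assumes S: "covariant_subset S"
  shows "at_root (\<lambda>G u. \<integral>\<^sup>+ v. g G u v \<partial>count_space (S G)) c =
    at_root (\<lambda>G u. \<integral>\<^sup>+ v. indicator (occupied S) (rcls G v) * g G u v \<partial>count_space (verts G)) c"
proof -
  obtain G u where c: "rep_rooted c = (G, u)" "is_network G" "u \<in> verts G" "c = rcls G u"
    by (rule rooted_representative)
  have "S G \<subseteq> verts G" using S c by (auto simp: covariant_subset_def)
  then have "(\<integral>\<^sup>+ v. g G u v \<partial>count_space (S G)) =
      (\<integral>\<^sup>+ v. indicator (occupied S) (rcls G v) * g G u v \<partial>count_space (verts G))"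
    using rcls_in_occupied[OF S c(2)]
    by (subst (1 2) nn_integral_count_space_indicator) (auto intro!: nn_integral_cong split: split_indicator)
  then show ?thesis by (simp only: at_root_def c(1) prod.case)
qed

lemma at_root_eq_osum:
  assumes "\<And>G u v. is_network G \<Longrightarrow> u \<in> verts G \<Longrightarrow> v \<in> verts G \<Longrightarrow> F G u v = g (bcls G u v)"
  shows "at_root (\<lambda>G u. \<integral>\<^sup>+ v. F G u v \<partial>count_space (verts G)) c = osum g c"
proof -
  obtain G u where c: "is_network G" "u \<in> verts G" "c = rcls G u"
    "at_root (\<lambda>G u. \<integral>\<^sup>+ v. F G u v \<partial>count_space (verts G)) c = (\<integral>\<^sup>+ v. F G u v \<partial>count_space (verts G))"
    by (rule at_root_representative[of c "\<lambda>G u. \<integral>\<^sup>+ v. F G u v \<partial>count_space (verts G)"])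
  have "(\<integral>\<^sup>+ v. F G u v \<partial>count_space (verts G)) = osum g (rcls G u)"
    unfolding osum_rcls[OF c(1,2)] using assms[OF c(1,2)] by (intro nn_integral_cong) simp
  then show ?thesis unfolding c(4) by (simp only: c(3))
qed

lemma proper_extension_transport:
  fixes M :: "'x::metric_space rooted measure"
  assumes proper: "proper_extension \<iota> M\<^sub>0 M S" and [measurable]: "g \<in> borel_measurable borel"
  shows "(\<integral>\<^sup>+ c. osum (\<lambda>b. indicator (occupied S) (tgt b) * g b) c \<partial>M) =
    (\<integral>\<^sup>+ c. osum (\<lambda>b. indicator (occupied S) (tgt b) * g (flip b)) c \<partial>M)"
proof (rule osum_transport_ennreal)
  have S: "covariant_subset S" using proper by (simp add: proper_extension_def extension_def)
  then have [measurable]: "occupied S \<in> sets borel" by (simp add: covariant_subset_def occupied_def)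
  show "sets M = sets borel"
    using proper by (simp add: proper_extension_def extension_def random_rooted_network_def)
  show "(\<lambda>b. indicator (occupied S) (tgt b)) \<in> borel_measurable borel" by measurable
  fix k :: "'x birooted \<Rightarrow> real" assume k: "transport k"
  have outgoing: "at_root (\<lambda>G u. \<integral>\<^sup>+ v. ennreal (k (bcls G u v)) \<partial>count_space (S G)) =
      osum (\<lambda>b. indicator (occupied S) (tgt b) * ennreal (k b))"
    by (rule ext, unfold sum_over_covariant_subset[OF S], rule at_root_eq_osum) simp
  have incoming: "at_root (\<lambda>G u. \<integral>\<^sup>+ v. ennreal (k (bcls G v u)) \<partial>count_space (S G)) =
      osum (\<lambda>b. indicator (occupied S) (tgt b) * ennreal (k (flip b)))"
    by (rule ext, unfold sum_over_covariant_subset[OF S], rule at_root_eq_osum) simp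
  show "(\<integral>\<^sup>+ c. osum (\<lambda>b. indicator (occupied S) (tgt b) * ennreal (k b)) c \<partial>M) =
      (\<integral>\<^sup>+ c. osum (\<lambda>b. indicator (occupied S) (tgt b) * ennreal (k (flip b))) c \<partial>M)"
    using proper[unfolded proper_extension_def, THEN conjunct2, rule_format, OF k]
    unfolding outgoing incoming .
qed measurable

lemma unimodular_pair_extension:
  assumes proper: "proper_extension \<iota> M\<^sub>0 M S" and uni: "unimodularization M' M"
  shows "unimodular_pair M M' (occupied S)"
proof
  show M: "random_rooted_network M" using proper by (simp add: proper_extension_def extension_def)
  show "unimodular M'"
    using uni by (auto simp: unimodularization_def weak_unimodularization_def strong_unimodularization_def)
  show "occupied S \<in> sets borel" and "AE c in M. c \<in> occupied S"
    using proper by (simp_all add: proper_extension_def extension_def covariant_subset_def occupied_def)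
  show "emeasure M A = 0 \<longleftrightarrow> emeasure M' A = 0" if "A \<in> sets invariant_field" for A
    using M by (intro unimodularization_equivalent[OF uni _ that]) (simp add: random_rooted_network_def)
qed (rule proper_extension_transport[OF proper])

lemma admissible_kernel_iff:
  assumes pair: "unimodular_pair M M' (occupied S)" and S: "covariant_subset S"
  shows "admissible_kernel M S T \<longleftrightarrow> transport T \<and> unimodular_pair.kernel M (occupied S) (\<lambda>b. ennreal (T b))"
proof (cases "transport T")
  case True
  then have [measurable]: "T \<in> borel_measurable borel" and pos: "\<And>b. 0 \<le> T b" by (auto simp: transport_def)
  interpret unimodular_pair M M' "occupied S" by (rule pair)
  let ?K = "\<lambda>d. osum (\<lambda>b. ennreal (T b)) d = 1 \<and>
    osum (\<lambda>b. indicator (- occupied S) (tgt b) * ennreal (T b)) d = 0"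
  have K: "?K (rcls G v) \<longleftrightarrow> out_mass T G v = 1 \<and> (\<forall>z\<in>verts G - S G. T (bcls G v z) = 0)"
    if G: "is_network G" "v \<in> verts G" for G v
  proof -
    have "indicator (- occupied S) (tgt (bcls G v z)) * ennreal (T (bcls G v z)) = 0 \<longleftrightarrow>
        (z \<notin> S G \<longrightarrow> T (bcls G v z) = 0)" if z: "z \<in> verts G" for z
    proof -
      have "tgt (bcls G v z) \<in> occupied S \<longleftrightarrow> z \<in> S G" using rcls_in_occupied[OF S G(1) z] G z by simp
      moreover have "ennreal (T (bcls G v z)) = 0 \<longleftrightarrow> T (bcls G v z) = 0"
        using pos[of "bcls G v z"] by (auto simp: ennreal_eq_0_iff)
      ultimately show ?thesis by (cases "z \<in> S G") simp_all
    qed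
    then have "osum (\<lambda>b. indicator (- occupied S) (tgt b) * ennreal (T b)) (rcls G v) = 0 \<longleftrightarrow>
        (\<forall>z\<in>verts G. z \<notin> S G \<longrightarrow> T (bcls G v z) = 0)"
      unfolding osum_rcls_eq_0_iff[OF G] by (rule ball_cong[OF refl])
    moreover have "osum (\<lambda>b. ennreal (T b)) (rcls G v) = out_mass T G v"
      by (simp only: osum_rcls[OF G] out_mass_def)
    ultimately show ?thesis by (simp only: Ball_def Diff_iff) blast
  qed
  have "at_root (\<lambda>G u. \<forall>v\<in>verts G. out_mass T G v = 1 \<and> (\<forall>z\<in>verts G - S G. T (bcls G v z) = 0)) c \<longleftrightarrow>
      everywhere ?K c" for c
  proof -
    obtain G u where c: "is_network G" "u \<in> verts G" "c = rcls G u"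
      "at_root (\<lambda>G u. \<forall>v\<in>verts G. out_mass T G v = 1 \<and> (\<forall>z\<in>verts G - S G. T (bcls G v z) = 0)) c \<longleftrightarrow>
        (\<forall>v\<in>verts G. out_mass T G v = 1 \<and> (\<forall>z\<in>verts G - S G. T (bcls G v z) = 0))"
      by (rule at_root_representative[of c "\<lambda>G u. \<forall>v\<in>verts G. out_mass T G v = 1 \<and> (\<forall>z\<in>verts G - S G. T (bcls G v z) = 0)"])
    have "everywhere ?K c \<longleftrightarrow> (\<forall>v\<in>verts G. ?K (rcls G v))"
      unfolding c(3) by (rule everywhere_rcls[OF c(1,2)])
    also have "\<dots> \<longleftrightarrow> (\<forall>v\<in>verts G. out_mass T G v = 1 \<and> (\<forall>z\<in>verts G - S G. T (bcls G v z) = 0))"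
      by (intro ball_cong refl K c(1))
    finally show ?thesis by (rule trans[OF c(4) sym])
  qed
  then show ?thesis using True by (simp add: admissible_kernel_def kernel_def)
qed (simp add: admissible_kernel_def)

context unimodular_density
begin

lemma cond_in_mass_eq: "cond_in_mass M T = cond_mass (\<lambda>b. ennreal (T b))"
  by (simp add: cond_in_mass_def cond_mass_def at_root_in_mass_osum)

lemma kernel_law_eq:
  assumes T: "kernel (\<lambda>b. ennreal (T b))"
  shows "kernel_law M T = density M' (\<lambda>c. \<rho> c * inverse (cond_in_mass M T c))"
proof -
  let ?t = "\<lambda>b. ennreal (T b)"
  let ?D = "density M' (\<lambda>c. \<rho> c * inverse (cond_in_mass M T c))"
  have [measurable]: "cond_in_mass M T \<in> borel_measurable borel" by (simp add: cond_in_mass_eq)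
  have sum: "at_root (\<lambda>G u. \<integral>\<^sup>+ v. ennreal (T (bcls G v u)) * indicator A (rcls G v) \<partial>count_space (verts G)) c =
      osum (\<lambda>b. ?t (flip b) * indicator A (tgt b)) c" for A c
    by (rule at_root_eq_osum) simp
  have "kernel_law M T = measure_of UNIV (sets borel) (emeasure ?D)"
    unfolding kernel_law_def
  proof (rule measure_of_eq)
    fix A :: "'a rooted set" assume "A \<in> sigma_sets UNIV (sets borel)"
    then have [measurable]: "A \<in> sets borel" using sets.sigma_sets_eq[of "borel :: 'a rooted measure"] by simp
    have "(\<integral>\<^sup>+ c. 1 / cond_in_mass M T c * osum (\<lambda>b. ?t (flip b) * indicator A (tgt b)) c \<partial>M) =
        (\<integral>\<^sup>+ c. \<rho> c * (1 / cond_in_mass M T c) * indicator A c \<partial>M')"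
      using cond_mass_ri[of ?t]
      by (intro kernel_integral T) (auto simp: cond_in_mass_eq root_independent_iff)
    then show "(\<integral>\<^sup>+ c. 1 / cond_in_mass M T c * at_root (\<lambda>G u. \<integral>\<^sup>+ v. ennreal (T (bcls G v u)) *
        indicator A (rcls G v) \<partial>count_space (verts G)) c \<partial>M) = emeasure ?D A"
      unfolding sum by (simp add: emeasure_density divide_ennreal_def)
  qed simp
  also have "\<dots> = ?D"
    using measure_of_of_measure[of ?D] by (simp add: sets_M')
  finally show ?thesis .
qed

text \<open>
  The kernel law is \<open>M'\<close> with density \<open>\<rho> / E\<close>, and \<open>0 < E < \<infinity>\<close> almost surely, so \<open>E / \<rho>\<close> reverses the
  change of measure. The normalizing constant is 1.
\<close>

lemma bias_kernel_law:
  assumes T: "kernel (\<lambda>b. ennreal (T b))"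
  obtains w where "w \<in> borel_measurable borel" "\<And>c. (0::real) \<le> w c" "root_independent w"
    "(\<integral>\<^sup>+ c. ennreal (w c) \<partial>kernel_law M T) = 1" "M' = bias (kernel_law M T) w"
proof -
  define E where "E = cond_in_mass M T"
  have [measurable]: "E \<in> borel_measurable borel" and E_ri: "root_independent E"
    using cond_mass_ri by (simp_all add: E_def cond_in_mass_eq)
  define w where "w c = enn2real (E c * inverse (\<rho> c))" for c
  have w [measurable]: "w \<in> borel_measurable borel" unfolding w_def[abs_def] by measurable
  have "AE c in M'. 0 < E c \<and> E c < \<infinity>"
    using cond_mass_pos_finite[OF T] by (simp add: E_def cond_in_mass_eq)
  then have inv: "AE c in M'. \<rho> c * inverse (E c) * ennreal (w c) = 1"
  proof eventually_elim
    case (elim c)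
    have "inverse (\<rho> c) < top" using \<rho>_pos[of c] by (simp add: less_top[symmetric])
    then have "ennreal (w c) = E c * inverse (\<rho> c)"
      using elim unfolding w_def by (intro ennreal_enn2real) (auto simp: ennreal_mult_less_top)
    then have "\<rho> c * inverse (E c) * ennreal (w c) = (\<rho> c * inverse (\<rho> c)) * (E c * inverse (E c))"
      by (simp add: ac_simps)
    then show ?case using elim \<rho>_pos[of c] \<rho>_fin[of c] by (simp add: ennreal_inverse_mult_self)
  qed
  have law: "kernel_law M T = density M' (\<lambda>c. \<rho> c * inverse (E c))"
    unfolding E_def by (rule kernel_law_eq[OF T])
  have int: "(\<integral>\<^sup>+ c. ennreal (w c) \<partial>kernel_law M T) = 1"
  proof -
    have "(\<integral>\<^sup>+ c. ennreal (w c) \<partial>kernel_law M T) = (\<integral>\<^sup>+ c. \<rho> c * inverse (E c) * ennreal (w c) \<partial>M')"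
      unfolding law by (simp add: nn_integral_density)
    also have "\<dots> = (\<integral>\<^sup>+ c. 1 \<partial>M')" by (rule nn_integral_cong_AE[OF inv])
    finally show ?thesis using M'.emeasure_space_1 by simp
  qed
  have "density (kernel_law M T) (\<lambda>c. ennreal (w c)) = density M' (\<lambda>c. \<rho> c * inverse (E c) * ennreal (w c))"
    unfolding law by (simp add: density_density_eq)
  also have "\<dots> = density M' (\<lambda>_. 1)" by (rule density_cong[OF _ _ inv]) measurable
  also have "\<dots> = M'" by (rule density_1)
  finally have "M' = bias (kernel_law M T) w" by (simp add: bias_def int)
  moreover have "root_independent w" using E_ri \<rho>_ri by (simp add: w_def root_independent_iff)
  ultimately show thesis using int w by (intro that[of w]) (simp_all add: w_def)
qed

end

text \<open>
  A root-independent function can be evaluated at any root of an unrooted network, so a chosen one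
  will do.
\<close>

lemma root_independent_forget_root:
  fixes C :: "'x::metric_space rooted \<Rightarrow> ennreal"
  assumes [measurable]: "C \<in> borel_measurable borel" and ri: "root_independent C"
  obtains \<kappa> where "\<kappa> \<in> borel_measurable unrooted_space" "\<And>c. \<kappa> (forget_root c) = C c"
proof -
  define \<kappa> where "\<kappa> U = C (SOME c. forget_root c = U)" for U
  have \<kappa>: "\<kappa> (forget_root c) = C c" for c
  proof -
    have "forget_root (SOME d. forget_root d = forget_root c) = forget_root c" by (rule someI) simp
    then show ?thesis unfolding \<kappa>_def forget_root_eq_iff using ri by (metis root_independent_iff)
  qed
  have "\<kappa> \<in> borel_measurable unrooted_space"
  proof (rule measurableI)
    fix B :: "ennreal set" assume "B \<in> sets borel"
    then have "C -` B \<in> sets borel" using measurable_sets[OF assms(1)] by simp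
    moreover have "forget_root -` \<kappa> -` B = C -` B" by (auto simp: \<kappa>)
    ultimately show "\<kappa> -` B \<inter> space unrooted_space \<in> sets unrooted_space"
      by (simp add: sets_unrooted_space)
  qed simp
  then show thesis using \<kappa> that by blast
qed

theorem theorem6:
  fixes M\<^sub>0 :: "'y::polish_space rooted measure"
    and M :: "'x::polish_space rooted measure"
    and \<iota> :: "'y \<Rightarrow> 'x"
    and S :: "'x network \<Rightarrow> nat set"
  assumes "proper_extension \<iota> M\<^sub>0 M S"
    and "\<exists>M'. unimodularization M' M"
  shows "(\<exists>T. admissible_kernel M S T \<and> kernel_law_exists M T) \<and>
    (\<forall>T M'. admissible_kernel M S T \<longrightarrow> kernel_law_exists M T \<longrightarrow> unimodularization M' M \<longrightarrow>
       (\<exists>w \<in> borel_measurable borel. (\<forall>c. 0 \<le> w c) \<and> root_independent w \<and>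
          0 < (\<integral>\<^sup>+ c. ennreal (w c) \<partial>kernel_law M T) \<and>
          (\<integral>\<^sup>+ c. ennreal (w c) \<partial>kernel_law M T) < \<infinity> \<and>
          M' = bias (kernel_law M T) w)) \<and>
    (\<exists>T. admissible_kernel M S T \<and> kernel_law_exists M T \<and>
       (\<exists>\<kappa> \<in> borel_measurable unrooted_space.
          AE c in M. at_root (\<lambda>G u. \<forall>v\<in>S G. in_mass T G v = (\<kappa> (ucls G) :: ennreal)) c))"
proof -
  have S: "covariant_subset S" using assms(1) by (simp add: proper_extension_def extension_def)
  have pair: "unimodular_pair M M' (occupied S)" if "unimodularization M' M" for M'
    by (rule unimodular_pair_extension[OF assms(1) that])
  have density: "\<exists>\<rho>. unimodular_density M M' (occupied S) \<rho>" if M': "unimodularization M' M" for M'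
  proof -
    interpret unimodular_pair M M' "occupied S" by (rule pair[OF M'])
    obtain \<rho> :: "'x rooted \<Rightarrow> ennreal" where \<rho>: "\<rho> \<in> borel_measurable borel" "root_independent \<rho>"
      "\<And>c. 0 < \<rho> c" "\<And>c. \<rho> c < \<infinity>" "M = density M' (\<lambda>c. indicator (occupied S) c * \<rho> c)"
      by (rule root_independent_density) blast
    show ?thesis by (intro exI[of _ \<rho>]) (unfold_locales, use \<rho> in auto)
  qed
  have bias: "\<exists>w \<in> borel_measurable borel. (\<forall>c. 0 \<le> w c) \<and> root_independent w \<and>
          0 < (\<integral>\<^sup>+ c. ennreal (w c) \<partial>kernel_law M T) \<and>
          (\<integral>\<^sup>+ c. ennreal (w c) \<partial>kernel_law M T) < \<infinity> \<and>
          M' = bias (kernel_law M T) w"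
    if T: "admissible_kernel M S T" and M': "unimodularization M' M" for T M'
  proof -
    obtain \<rho> where "unimodular_density M M' (occupied S) \<rho>" using density[OF M'] by blast
    then interpret unimodular_density M M' "occupied S" \<rho> .
    have "kernel (\<lambda>b. ennreal (T b))" using T admissible_kernel_iff[OF pair[OF M'] S] by simp
    then obtain w where "w \<in> borel_measurable borel" "\<And>c. 0 \<le> w c" "root_independent w"
        "(\<integral>\<^sup>+ c. ennreal (w c) \<partial>kernel_law M T) = 1" "M' = bias (kernel_law M T) w"
      by (rule bias_kernel_law) blast
    then show ?thesis by (intro bexI[of _ w]) simp_all
  qed
  have balanced: "\<exists>T. admissible_kernel M S T \<and> kernel_law_exists M T \<and>
       (\<exists>\<kappa> \<in> borel_measurable unrooted_space.
          AE c in M. at_root (\<lambda>G u. \<forall>v\<in>S G. in_mass T G v = (\<kappa> (ucls G) :: ennreal)) c)"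
  proof -
    obtain M' where M': "unimodularization M' M" using assms(2) by blast
    obtain \<rho> where "unimodular_density M M' (occupied S) \<rho>" using density[OF M'] by blast
    then interpret unimodular_density M M' "occupied S" \<rho> .
    obtain t C where t [measurable]: "t \<in> borel_measurable borel" and t_fin: "\<And>b. t b < top"
      and t_S: "\<And>b. tgt b \<notin> occupied S \<Longrightarrow> t b = 0"
      and C [measurable]: "C \<in> borel_measurable borel" and C_ri: "root_independent C"
      and mass: "AE c in M'. osum t c = 1 \<and> osum (\<lambda>b. t (flip b)) c = indicator (occupied S) c * C c"
      by (rule balanced_kernel) blast
    define T where "T b = enn2real (t b)" for b
    have T: "ennreal (T b) = t b" for b using t_fin[of b] by (simp add: T_def ennreal_enn2real)
    have tr: "transport T" unfolding transport_def T_def[abs_def] by simp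
    have mass_M: "AE c in M. everywhere (\<lambda>c. osum t c = 1 \<and> osum (\<lambda>b. t (flip b)) c = indicator (occupied S) c * C c) c"
      by (rule AE_M_everywhere[OF _ mass]) measurable
    have "kernel t"
      unfolding kernel_def
    proof (intro conjI t)
      have "osum (\<lambda>b. indicator (- occupied S) (tgt b) * t b) c = 0" for c
        using t_S by (auto simp: osum_eq_0_iff indicator_def)
      then show "AE c in M. everywhere (\<lambda>d. osum t d = 1 \<and>
          osum (\<lambda>b. indicator (- occupied S) (tgt b) * t b) d = 0) c"
        using mass_M by (auto simp: everywhere_def elim!: eventually_mono)
    qed
    then have kT: "kernel (\<lambda>b. ennreal (T b))" by (simp add: T)
    have adm: "admissible_kernel M S T" using admissible_kernel_iff[OF pair[OF M'] S] tr kT by simp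
    have ex: "kernel_law_exists M T"
      using cond_mass_finite[OF kT] by (simp add: kernel_law_exists_def cond_in_mass_eq)
    obtain \<kappa> where \<kappa>: "\<kappa> \<in> borel_measurable unrooted_space" "\<And>c. \<kappa> (forget_root c) = C c"
      by (rule root_independent_forget_root[OF C C_ri]) blast
    have "AE c in M. at_root (\<lambda>G u. \<forall>v\<in>S G. in_mass T G v = \<kappa> (ucls G)) c"
      using mass_M
    proof eventually_elim
      case (elim c)
      obtain G u where c: "is_network G" "u \<in> verts G" "c = rcls G u"
        "at_root (\<lambda>G u. \<forall>v\<in>S G. in_mass T G v = \<kappa> (ucls G)) c = (\<forall>v\<in>S G. in_mass T G v = \<kappa> (ucls G))"
        by (rule at_root_representative[of c "\<lambda>G u. \<forall>v\<in>S G. in_mass T G v = \<kappa> (ucls G)"])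
      have "in_mass T G v = \<kappa> (ucls G)" if v: "v \<in> S G" for v
      proof -
        have vG: "v \<in> verts G" using S c(1) v by (auto simp: covariant_subset_def)
        have "osum (\<lambda>b. t (flip b)) (rcls G v) = indicator (occupied S) (rcls G v) * C (rcls G v)"
          using elim vG by (simp add: c(3) everywhere_rcls[OF c(1,2)])
        moreover have "rcls G v \<in> occupied S" using rcls_in_occupied[OF S c(1) vG] v by simp
        moreover have "in_mass T G v = osum (\<lambda>b. t (flip b)) (rcls G v)"
          using at_root_in_mass[OF c(1) vG, of T] by (simp add: at_root_in_mass_osum T)
        moreover have "\<kappa> (ucls G) = C (rcls G v)"
          using \<kappa>(2)[of "rcls G v"] forget_root_rcls[OF c(1) vG] by simp
        ultimately show ?thesis by simp
      qed
      then show ?case unfolding c(4) by blast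
    qed
    then show ?thesis using adm ex \<kappa>(1) by blast
  qed
  show ?thesis using balanced bias by blast
qed

end
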